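(* Let $A$ be an elliptic operator on $X$ such that both $A$ and $A^*$ possess the Unique Continuation Property on $X$, let $D$ be a relatively compact domain in $X$ with $\partial D\in C^\infty$, and let $s\in\mathbb Z$, $1<p<+\infty$. Assume that $X\setminus D$ has no compact components in $X$. Let $N\in\mathbb N$, let $\mathcal M:S_A^{s,p}(D)\to\mathbb R^N$ be a continuous linear operator onto $\mathbb R^N$, let $F:\mathbb R^N\to(-\infty,+\infty]$ be a proper convex coercive lower semi-continuous functional, and let $b_N>0$. Then the functional $$\mathcal F(u)=F(\mathcal Mu)+b_N\|u\|_{[W^{s,p}(D)]^k},\quad u\in S_A^{s,p}(D),$$ has at least one minimizer $u^{(0)}\in S_A^{s,p}(D)$, i.e. $\mathcal F(u^{(0)})=\min_{u\in S_A^{s,p}(D)}\mathcal F(u)$. Moreover, if the functional $F$ is strictly convex, then the minimizer is unique.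
   Context: $X\subset\mathbb R^n$, $n\ge2$, is open and connected; $k,m\in\mathbb N$; $A=\sum_{|\alpha|\le m}a_\alpha(x)\partial^\alpha$ with $(k\times k)$-matrices $a_\alpha$ of real $C^\infty(X)$-functions. $A$ is elliptic if $\sum_{|\alpha|=m}a_\alpha(x)(\iota\zeta)^\alpha$ is invertible on $\mathbb C^k$ for all $x\in X$, $\zeta\in\mathbb R^n\setminus\{0\}$. The formal adjoint is $A^*g=\sum_{|\alpha|\le m}(-1)^{|\alpha|}\partial^\alpha(a_\alpha^Tg)$. An operator has the Unique Continuation Property on $X$ if, for every domain $O\subset X$, every solution in $O$ of the homogeneous equation vanishing on a non-empty open subset of $O$ is identically zero in $O$. $S_A(D)$ is the space of ($\mathbb R^k$-valued) solutions of $Au=0$ in $D$. $W^{s,p}(D)$ is the usual Sobolev space for $s\ge0$ and, for $s\in\mathbb N$, $W^{-s,p}(D)$ is the dual of $W_0^{s,p'}(D)$ (closure of $C_0^\infty(D)$), $1/p+1/p'=1$, with the dual norm; $\|u\|_{[W^{s,p}(D)]^k}=(\sum_{r=1}^k\|u_r\|^p_{W^{s,p}(D)})^{1/p}$. $S_A^{s,p}(D)=S_A(D)\cap[W^{s,p}(D)]^k$, a Banach space with this norm. Proper means not identically $+\infty$; coercive means $F(x)\to+\infty$ as $|x|\to\infty$. *)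

theory Defs
  imports "HOL-Analysis.Analysis"
begin

text \<open>
  Solutions of \<open>A u = 0\<close> and elements of all Sobolev spaces \<open>W\<^sup>s\<^sup>,\<^sup>p(D)\<close>, \<open>s \<in> \<int>\<close>, live in the
  space of distributions \<open>\<D>'(D)\<close>. This is the only common home in which the intersection of the
  solution space with \<open>W\<^sup>s\<^sup>,\<^sup>p(D)\<close> makes sense for \<open>s < 0\<close>, and it also takes care of identifying
  functions that agree almost everywhere. For elliptic \<open>A\<close>, distributional solutions are
  smooth functions.
\<close>

section \<open>Multi-indices, partial derivatives, smooth functions\<close>

type_synonym 'n multi_index = "'n \<Rightarrow> nat"

definition mi_deg :: "'n::finite multi_index \<Rightarrow> nat" where
  "mi_deg \<alpha> = (\<Sum>i\<in>UNIV. \<alpha> i)"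

definition pdiff :: "'n::finite \<Rightarrow> (real^'n \<Rightarrow> real) \<Rightarrow> real^'n \<Rightarrow> real" where
  "pdiff i f = (\<lambda>x. frechet_derivative f (at x) (axis i 1))"

text \<open>To be used on open sets \<open>X\<close> only. Differentiability of all iterated partial derivatives
  forces their continuity.\<close>

definition smooth_fun_on :: "(real^'n::finite) set \<Rightarrow> (real^'n \<Rightarrow> real) \<Rightarrow> bool" where
  "smooth_fun_on X f \<longleftrightarrow> (\<forall>is. foldr pdiff is f differentiable_on X)"

text \<open>\<open>\<partial>\<^sup>\<alpha> f\<close> differentiates \<open>\<alpha> i\<close> times in direction \<open>i\<close>. The index type carries no order,
  so some enumeration of the directions is chosen; by symmetry of mixed
  derivatives the choice is irrelevant for smooth \<open>f\<close>.\<close>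

definition mdiff :: "'n::finite multi_index \<Rightarrow> (real^'n \<Rightarrow> real) \<Rightarrow> real^'n \<Rightarrow> real" where
  "mdiff \<alpha> f = foldr pdiff (SOME is. \<forall>i. count_list is i = \<alpha> i) f"


section \<open>Test functions and distributions\<close>

definition supp :: "(real^'n::finite \<Rightarrow> real) \<Rightarrow> (real^'n) set" where
  "supp \<phi> = closure {x. \<phi> x \<noteq> 0}"

definition test_fun :: "(real^'n::finite) set \<Rightarrow> (real^'n \<Rightarrow> real) set" where
  "test_fun U = {\<phi>. smooth_fun_on UNIV \<phi> \<and> compact (supp \<phi>) \<and> supp \<phi> \<subseteq> U}"

type_synonym 'n distr = "(real^'n \<Rightarrow> real) \<Rightarrow> real"

text \<open>A distribution on \<open>U\<close> is extended by \<open>0\<close> to arguments that are not test functions on \<open>U\<close>,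
  so that equality of distributions on \<open>U\<close> is equality in HOL.\<close>

definition distributions :: "(real^'n::finite) set \<Rightarrow> 'n distr set" where
  "distributions U = {T.
     (\<forall>\<phi>. \<phi> \<notin> test_fun U \<longrightarrow> T \<phi> = 0) \<and>
     (\<forall>\<phi>\<in>test_fun U. \<forall>\<psi>\<in>test_fun U. T (\<lambda>x. \<phi> x + \<psi> x) = T \<phi> + T \<psi>) \<and>
     (\<forall>\<phi>\<in>test_fun U. \<forall>c. T (\<lambda>x. c * \<phi> x) = c * T \<phi>) \<and>
     (\<forall>K. compact K \<and> K \<subseteq> U \<longrightarrow>
        (\<exists>C j. \<forall>\<phi>\<in>test_fun U. supp \<phi> \<subseteq> K \<longrightarrow>
           \<bar>T \<phi>\<bar> \<le> C * (\<Sum>\<alpha> | mi_deg \<alpha> \<le> j. SUP x. \<bar>mdiff \<alpha> \<phi> x\<bar>)))}"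

definition distr_of_fun :: "(real^'n::finite) set \<Rightarrow> (real^'n \<Rightarrow> real) \<Rightarrow> 'n distr" where
  "distr_of_fun U f = (\<lambda>\<phi>. if \<phi> \<in> test_fun U
      then (LINT x | lebesgue_on U. f x * \<phi> x) else 0)"

definition distr_diff :: "(real^'n::finite) set \<Rightarrow> 'n multi_index \<Rightarrow> 'n distr \<Rightarrow> 'n distr" where
  "distr_diff U \<alpha> T = (\<lambda>\<phi>. if \<phi> \<in> test_fun U then (-1) ^ mi_deg \<alpha> * T (mdiff \<alpha> \<phi>) else 0)"

definition distr_mult :: "(real^'n::finite) set \<Rightarrow> (real^'n \<Rightarrow> real) \<Rightarrow> 'n distr \<Rightarrow> 'n distr" where
  "distr_mult U c T = (\<lambda>\<phi>. if \<phi> \<in> test_fun U then T (\<lambda>x. c x * \<phi> x) else 0)"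


section \<open>Differential operators\<close>

text \<open>The coefficients of an operator of order at most \<open>m\<close> are the matrix functions \<open>a \<alpha>\<close>
  with \<open>mi_deg \<alpha> \<le> m\<close>; other values of \<open>a\<close> are never used.\<close>

type_synonym ('n, 'k) coeffs = "'n multi_index \<Rightarrow> real^'n \<Rightarrow> real^'k^'k"

definition smooth_coeffs :: "(real^'n::finite) set \<Rightarrow> nat \<Rightarrow> ('n, 'k::finite) coeffs \<Rightarrow> bool" where
  "smooth_coeffs X m a \<longleftrightarrow>
     (\<forall>\<alpha> r j. mi_deg \<alpha> \<le> m \<longrightarrow> smooth_fun_on X (\<lambda>x. a \<alpha> x $ r $ j))"

definition principal_symbol ::
  "nat \<Rightarrow> ('n::finite, 'k::finite) coeffs \<Rightarrow> real^'n \<Rightarrow> real^'n \<Rightarrow> complex^'k^'k" where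
  "principal_symbol m a x \<zeta> = (\<chi> r j. \<Sum>\<alpha> | mi_deg \<alpha> = m.
      complex_of_real (a \<alpha> x $ r $ j) * (\<Prod>i\<in>UNIV. (\<i> * complex_of_real (\<zeta> $ i)) ^ \<alpha> i))"

definition elliptic :: "(real^'n::finite) set \<Rightarrow> nat \<Rightarrow> ('n, 'k::finite) coeffs \<Rightarrow> bool" where
  "elliptic X m a \<longleftrightarrow> (\<forall>x\<in>X. \<forall>\<zeta>. \<zeta> \<noteq> 0 \<longrightarrow> invertible (principal_symbol m a x \<zeta>))"

text \<open>\<open>A u = \<Sum>\<^sub>\<alpha> a\<^sub>\<alpha> \<partial>\<^sup>\<alpha> u\<close> and
  \<open>A\<^sup>* g = \<Sum>\<^sub>\<alpha> (-1)\<^bsup>|\<alpha>|\<^esup> \<partial>\<^sup>\<alpha> (a\<^sub>\<alpha>\<^sup>T g)\<close> on vectors of distributions on an open \<open>U\<close>.\<close>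

definition diff_op :: "nat \<Rightarrow> ('n::finite, 'k::finite) coeffs \<Rightarrow>
    (real^'n) set \<Rightarrow> ('k \<Rightarrow> 'n distr) \<Rightarrow> 'k \<Rightarrow> 'n distr" where
  "diff_op m a U u = (\<lambda>r \<phi>. \<Sum>\<alpha> | mi_deg \<alpha> \<le> m. \<Sum>j\<in>UNIV.
      distr_mult U (\<lambda>x. a \<alpha> x $ r $ j) (distr_diff U \<alpha> (u j)) \<phi>)"

definition adjoint_op :: "nat \<Rightarrow> ('n::finite, 'k::finite) coeffs \<Rightarrow>
    (real^'n) set \<Rightarrow> ('k \<Rightarrow> 'n distr) \<Rightarrow> 'k \<Rightarrow> 'n distr" where
  "adjoint_op m a U g = (\<lambda>r \<phi>. \<Sum>\<alpha> | mi_deg \<alpha> \<le> m. (-1) ^ mi_deg \<alpha> *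
      distr_diff U \<alpha> (\<lambda>\<psi>. \<Sum>j\<in>UNIV.
        distr_mult U (\<lambda>x. transpose (a \<alpha> x) $ r $ j) (g j) \<psi>) \<phi>)"

definition solutions :: "((real^'n::finite) set \<Rightarrow> ('k::finite \<Rightarrow> 'n distr) \<Rightarrow> 'k \<Rightarrow> 'n distr) \<Rightarrow>
    (real^'n) set \<Rightarrow> ('k \<Rightarrow> 'n distr) set" where
  "solutions P U = {u. (\<forall>r. u r \<in> distributions U) \<and> P U u = (\<lambda>_ _. 0)}"

definition is_domain :: "(real^'n::finite) set \<Rightarrow> bool" where
  "is_domain U \<longleftrightarrow> open U \<and> connected U \<and> U \<noteq> {}"

definition unique_continuation :: "(real^'n::finite) set \<Rightarrow>
    ((real^'n) set \<Rightarrow> ('k::finite \<Rightarrow> 'n distr) \<Rightarrow> 'k \<Rightarrow> 'n distr) \<Rightarrow> bool" where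
  "unique_continuation X P \<longleftrightarrow> (\<forall>U u V.
     is_domain U \<and> U \<subseteq> X \<and> u \<in> solutions P U \<and>
     open V \<and> V \<noteq> {} \<and> V \<subseteq> U \<and> (\<forall>r. \<forall>\<phi>\<in>test_fun V. u r \<phi> = 0)
     \<longrightarrow> u = (\<lambda>_ _. 0))"


section \<open>Sobolev spaces of integer order\<close>

definition Lp_fun :: "(real^'n::finite) set \<Rightarrow> real \<Rightarrow> (real^'n \<Rightarrow> real) set" where
  "Lp_fun D p = {f. f \<in> borel_measurable (lebesgue_on D) \<and>
      integrable (lebesgue_on D) (\<lambda>x. \<bar>f x\<bar> powr p)}"

definition Lp_distr :: "(real^'n::finite) set \<Rightarrow> real \<Rightarrow> 'n distr set" where
  "Lp_distr D p = distr_of_fun D ` Lp_fun D p"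

text \<open>The density of \<open>T\<close> is unique up to null sets, hence the norm does not depend on the choice.\<close>

definition Lp_norm :: "(real^'n::finite) set \<Rightarrow> real \<Rightarrow> 'n distr \<Rightarrow> real" where
  "Lp_norm D p T =
     (let f = (SOME f. f \<in> Lp_fun D p \<and> T = distr_of_fun D f)
      in (LINT x | lebesgue_on D. \<bar>f x\<bar> powr p) powr (1 / p))"

definition sobolev_pos :: "(real^'n::finite) set \<Rightarrow> nat \<Rightarrow> real \<Rightarrow> 'n distr set" where
  "sobolev_pos D s p =
     {T \<in> distributions D. \<forall>\<alpha>. mi_deg \<alpha> \<le> s \<longrightarrow> distr_diff D \<alpha> T \<in> Lp_distr D p}"

definition sobolev_pos_norm :: "(real^'n::finite) set \<Rightarrow> nat \<Rightarrow> real \<Rightarrow> 'n distr \<Rightarrow> real" where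
  "sobolev_pos_norm D s p T =
     (\<Sum>\<alpha> | mi_deg \<alpha> \<le> s. Lp_norm D p (distr_diff D \<alpha> T) powr p) powr (1 / p)"

definition sobolev_zero :: "(real^'n::finite) set \<Rightarrow> nat \<Rightarrow> real \<Rightarrow> 'n distr set" where
  "sobolev_zero D s p = {T \<in> sobolev_pos D s p. \<forall>\<epsilon>>0. \<exists>\<phi>\<in>test_fun D.
      sobolev_pos_norm D s p (\<lambda>\<psi>. T \<psi> - distr_of_fun D \<phi> \<psi>) < \<epsilon>}"

definition sobolev_zero_dual :: "(real^'n::finite) set \<Rightarrow> nat \<Rightarrow> real \<Rightarrow> ('n distr \<Rightarrow> real) set" where
  "sobolev_zero_dual D s p = {L.
     (\<forall>v\<in>sobolev_zero D s p. \<forall>w\<in>sobolev_zero D s p. L (\<lambda>\<psi>. v \<psi> + w \<psi>) = L v + L w) \<and>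
     (\<forall>v\<in>sobolev_zero D s p. \<forall>c. L (\<lambda>\<psi>. c * v \<psi>) = c * L v) \<and>
     (\<exists>C. \<forall>v\<in>sobolev_zero D s p. \<bar>L v\<bar> \<le> C * sobolev_pos_norm D s p v)}"

text \<open>A functional on \<open>W\<^sub>0\<^sup>s\<^sup>,\<^sup>q(D)\<close> is identified with the distribution it induces on
  test functions. Since these are dense, the functional is determined on
  \<open>W\<^sub>0\<^sup>s\<^sup>,\<^sup>q(D)\<close> by that distribution, so the choice in the dual norm is harmless.\<close>

definition distr_of_functional :: "(real^'n::finite) set \<Rightarrow> ('n distr \<Rightarrow> real) \<Rightarrow> 'n distr" where
  "distr_of_functional D L = (\<lambda>\<phi>. if \<phi> \<in> test_fun D then L (distr_of_fun D \<phi>) else 0)"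

definition conj_exp :: "real \<Rightarrow> real" where
  "conj_exp p = p / (p - 1)"

definition sobolev_neg :: "(real^'n::finite) set \<Rightarrow> nat \<Rightarrow> real \<Rightarrow> 'n distr set" where
  "sobolev_neg D s p = distr_of_functional D ` sobolev_zero_dual D s (conj_exp p)"

definition sobolev_neg_norm :: "(real^'n::finite) set \<Rightarrow> nat \<Rightarrow> real \<Rightarrow> 'n distr \<Rightarrow> real" where
  "sobolev_neg_norm D s p T =
     (let q = conj_exp p;
          L = (SOME L. L \<in> sobolev_zero_dual D s q \<and> T = distr_of_functional D L)
      in Sup {\<bar>L v\<bar> | v. v \<in> sobolev_zero D s q \<and> sobolev_pos_norm D s q v \<le> 1})"

definition sobolev :: "(real^'n::finite) set \<Rightarrow> int \<Rightarrow> real \<Rightarrow> 'n distr set" where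
  "sobolev D s p = (if 0 \<le> s then sobolev_pos D (nat s) p else sobolev_neg D (nat (- s)) p)"

definition sobolev_norm :: "(real^'n::finite) set \<Rightarrow> int \<Rightarrow> real \<Rightarrow> 'n distr \<Rightarrow> real" where
  "sobolev_norm D s p T =
     (if 0 \<le> s then sobolev_pos_norm D (nat s) p T else sobolev_neg_norm D (nat (- s)) p T)"

definition sobolev_vec_norm ::
  "(real^'n::finite) set \<Rightarrow> int \<Rightarrow> real \<Rightarrow> ('k::finite \<Rightarrow> 'n distr) \<Rightarrow> real" where
  "sobolev_vec_norm D s p u = (\<Sum>r\<in>UNIV. sobolev_norm D s p (u r) powr p) powr (1 / p)"

definition sobolev_solutions :: "nat \<Rightarrow> ('n::finite, 'k::finite) coeffs \<Rightarrow>
    (real^'n) set \<Rightarrow> int \<Rightarrow> real \<Rightarrow> ('k \<Rightarrow> 'n distr) set" where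
  "sobolev_solutions m a D s p = solutions (diff_op m a) D \<inter> {u. \<forall>r. u r \<in> sobolev D s p}"

definition continuous_linear_on_solutions :: "nat \<Rightarrow> ('n::finite, 'k::finite) coeffs \<Rightarrow>
    (real^'n) set \<Rightarrow> int \<Rightarrow> real \<Rightarrow> (('k \<Rightarrow> 'n distr) \<Rightarrow> real^'N::finite) \<Rightarrow> bool" where
  "continuous_linear_on_solutions m a D s p M \<longleftrightarrow>
     (let S = sobolev_solutions m a D s p in
       (\<forall>u\<in>S. \<forall>v\<in>S. M (\<lambda>r \<phi>. u r \<phi> + v r \<phi>) = M u + M v) \<and>
       (\<forall>u\<in>S. \<forall>c. M (\<lambda>r \<phi>. c * u r \<phi>) = c *\<^sub>R M u) \<and>
       (\<forall>u\<in>S. \<forall>\<epsilon>>0. \<exists>\<delta>>0. \<forall>v\<in>S.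
          sobolev_vec_norm D s p (\<lambda>r \<phi>. v r \<phi> - u r \<phi>) < \<delta> \<longrightarrow> norm (M v - M u) < \<epsilon>))"


section \<open>Domains with smooth boundary\<close>

text \<open>\<open>D\<close> is locally, near each boundary point, a strict sublevel set of a smooth function
  without critical points.\<close>

definition smooth_boundary :: "(real^'n::finite) set \<Rightarrow> bool" where
  "smooth_boundary D \<longleftrightarrow> (\<forall>x0\<in>frontier D. \<exists>U \<rho>. open U \<and> x0 \<in> U \<and> smooth_fun_on U \<rho> \<and>
     (\<forall>x\<in>U. \<exists>i. pdiff i \<rho> x \<noteq> 0) \<and> D \<inter> U = {x \<in> U. \<rho> x < 0})"


section \<open>Extended-valued functionals on \<open>\<real>\<^sup>N\<close>\<close>

definition proper_fun :: "(real^'N::finite \<Rightarrow> ereal) \<Rightarrow> bool" where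
  "proper_fun F \<longleftrightarrow> (\<exists>x. F x \<noteq> \<infinity>)"

definition convex_fun :: "(real^'N::finite \<Rightarrow> ereal) \<Rightarrow> bool" where
  "convex_fun F \<longleftrightarrow> (\<forall>x y t. 0 < t \<and> t < 1 \<longrightarrow>
     F ((1 - t) *\<^sub>R x + t *\<^sub>R y) \<le> ereal (1 - t) * F x + ereal t * F y)"

text \<open>As usual for extended-valued functionals, strictness is required on the effective domain.\<close>

definition strictly_convex_fun :: "(real^'N::finite \<Rightarrow> ereal) \<Rightarrow> bool" where
  "strictly_convex_fun F \<longleftrightarrow> convex_fun F \<and>
     (\<forall>x y t. 0 < t \<and> t < 1 \<and> x \<noteq> y \<and> F x < \<infinity> \<and> F y < \<infinity> \<longrightarrow>
       F ((1 - t) *\<^sub>R x + t *\<^sub>R y) < ereal (1 - t) * F x + ereal t * F y)"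

definition coercive_fun :: "(real^'N::finite \<Rightarrow> ereal) \<Rightarrow> bool" where
  "coercive_fun F \<longleftrightarrow> (F \<longlongrightarrow> \<infinity>) at_infinity"

definition lower_semicont :: "(real^'N::finite \<Rightarrow> ereal) \<Rightarrow> bool" where
  "lower_semicont F \<longleftrightarrow> (\<forall>x. F x \<le> Liminf (at x) F)"

definition minimizer_on :: "'a set \<Rightarrow> ('a \<Rightarrow> ereal) \<Rightarrow> 'a \<Rightarrow> bool" where
  "minimizer_on S G u \<longleftrightarrow> u \<in> S \<and> (\<forall>v\<in>S. G u \<le> G v)"

end

theory Submission
  imports Defs
begin

text \<open>
  The proof splits the minimization along the observation operator \<open>M\<close>. Among all solutions \<open>u\<close>
  with \<open>M u = y\<close> there is exactly one of least norm. The value \<open>h y\<close> of that least norm, raised to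
  the power \<open>p\<close>, is a finite convex function on \<open>\<real>\<^sup>N\<close>, hence continuous. So minimizing the
  functional over solutions amounts to minimizing \<open>F y + b h(y)\<^bsup>1/p\<^esup>\<close> over \<open>y\<close>, and that function
  is lower semicontinuous and tends to infinity: a finite-dimensional problem with a minimum.

  The elements of least norm come from uniform convexity and completeness. A minimizing sequence in the
  affine subspace \<open>{u. M u = y}\<close> has midpoints in the same subspace, whose norm cannot drop below the
  infimum. Uniform convexity then makes the sequence Cauchy, and completeness provides the limit.
  The same argument shows that two elements of least norm coincide. If \<open>F\<close> is strictly convex, any
  two minimizers \<open>u, v\<close> satisfy \<open>M u = M v\<close>, since otherwise their midpoint would do better; both
  then have least norm over the same \<open>y\<close> and are equal. This part is carried out for an abstract
  space of real functions in the locale \<open>observed_subspace\<close>.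

  What remains is that \<open>W\<^sup>s\<^sup>,\<^sup>p(D)\<close> is a complete uniformly convex space whose convergence implies
  convergence of distributions, tested function by function; the last property keeps the limit a
  solution of \<open>A u = 0\<close>.

  \<^item> For \<open>s \<ge> 0\<close> the \<open>p\<close>-th power of the norm is a sum of integrals of \<open>p\<close>-th powers, so convexity
    estimates for the real function \<open>|x|\<^sup>p\<close> may be integrated. A distribution determines its density
    almost everywhere because smooth bump functions approximate the indicators of open sets.
    Completeness is the theorem of Riesz and Fischer.
  \<^item> For \<open>s < 0\<close> the space is a dual, and uniform convexity of its norm is the dual counterpart of
    uniform smoothness of the norm of \<open>W\<^bsup>-s,q\<^esup>(D)\<close>, with \<open>q\<close> the conjugate exponent; this again comes
    from an estimate for \<open>|x|\<^sup>q\<close>.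
\<close>

section \<open>Convexity and smoothness of the power function\<close>

text \<open>
  The left-hand side is the tangent to \<open>|y|\<^sup>p\<close> at \<open>y = 1\<close>; all
  convexity estimates below come from it by scaling.
\<close>

lemma powr_tangent_strict_1:
  fixes p y :: real
  assumes "1 < p" "y \<noteq> 1"
  shows "1 + p * (y - 1) < \<bar>y\<bar> powr p"
proof -
  have der: "((\<lambda>z. z powr p) has_real_derivative p * z powr (p - 1)) (at z)" if "z > 0" for z
    using that by (auto intro!: derivative_eq_intros)
  consider "y \<le> 0" | "0 < y" "y < 1" | "1 < y" using assms by linarith
  then show ?thesis
  proof cases
    case 1
    have "p * y \<le> 0" using 1 assms by (simp add: mult_le_0_iff)
    then have "1 + p * (y - 1) < 0" using assms by (simp add: algebra_simps)
    then show ?thesis by (smt (verit) powr_ge_zero)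
  next
    case 2
    obtain z where z: "y < z" "z < 1" "1 powr p - y powr p = (1 - y) * (p * z powr (p - 1))"
      using MVT2[of y 1 "\<lambda>z. z powr p" "\<lambda>z. p * z powr (p - 1)"] der 2 by force
    have "z powr (p - 1) < 1" using z 2 assms powr_less_mono2[of "p-1" z 1] by simp
    then have "(1 - y) * (p * z powr (p - 1)) < (1 - y) * (p * 1)" using 2 assms by simp
    then show ?thesis using z 2 by (simp add: algebra_simps)
  next
    case 3
    obtain z where z: "1 < z" "z < y" "y powr p - 1 powr p = (y - 1) * (p * z powr (p - 1))"
      using MVT2[of 1 y "\<lambda>z. z powr p" "\<lambda>z. p * z powr (p - 1)"] der 3 by force
    have "z powr (p - 1) > 1" using z assms powr_less_mono2[of "p-1" 1 z] by simp
    then have "(y - 1) * (p * z powr (p - 1)) > (y - 1) * (p * 1)" using 3 assms by simp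
    then show ?thesis using z 3 by (simp add: algebra_simps)
  qed
qed

text \<open>
  The factor \<open>|c|\<^bsup>p-1\<^esup> sgn c\<close>, multiplied by \<open>p\<close>, is the
  derivative of \<open>|x|\<^sup>p\<close> at \<open>c\<close>.
\<close>

lemma powr_tangent_strict:
  fixes p x c :: real
  assumes p: "1 < p" and "x \<noteq> c"
  shows "\<bar>c\<bar> powr p + p * (\<bar>c\<bar> powr (p - 1) * sgn c) * (x - c) < \<bar>x\<bar> powr p"
proof (cases "c = 0")
  case True
  then show ?thesis using assms by simp
next
  case False
  have pos: "\<bar>c\<bar> powr p > 0" using False by simp
  have e1: "\<bar>c\<bar> powr p = \<bar>c\<bar> powr (p - 1) * \<bar>c\<bar>"
    using False by (simp add: powr_mult_base[of "\<bar>c\<bar>" "p-1", simplified] mult.commute)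
  have "x / c \<noteq> 1" using assms False by simp
  from powr_tangent_strict_1[OF p this]
  have "\<bar>c\<bar> powr p * (1 + p * (x / c - 1)) < \<bar>c\<bar> powr p * \<bar>x / c\<bar> powr p" using pos by simp
  also have "\<dots> = \<bar>x\<bar> powr p" using False by (simp add: powr_divide)
  also have "\<bar>c\<bar> powr p * (1 + p * (x / c - 1)) =
      \<bar>c\<bar> powr p + p * (\<bar>c\<bar> powr p * (x / c - 1))"
    by (simp add: algebra_simps)
  also have "\<bar>c\<bar> powr p * (x / c - 1) = \<bar>c\<bar> powr (p - 1) * sgn c * (x - c)"
    unfolding e1 using False by (simp add: field_simps sgn_real_def)
  finally show ?thesis by (simp add: mult.assoc)
qed

lemma powr_tangent:
  fixes p x c :: real
  assumes p: "1 < p"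
  shows "\<bar>c\<bar> powr p + p * (\<bar>c\<bar> powr (p - 1) * sgn c) * (x - c) \<le> \<bar>x\<bar> powr p"
  using powr_tangent_strict[OF p, of x c] by (cases "x = c") auto

lemma powr_convex:
  fixes p a b t :: real
  assumes p: "1 < p" and t: "0 \<le> t" "t \<le> 1"
  shows "\<bar>(1 - t) * a + t * b\<bar> powr p \<le> (1 - t) * \<bar>a\<bar> powr p + t * \<bar>b\<bar> powr p"
proof -
  define c where "c = (1 - t) * a + t * b"
  define d where "d = p * (\<bar>c\<bar> powr (p - 1) * sgn c)"
  have "(1 - t) * (\<bar>c\<bar> powr p + d * (a - c)) + t * (\<bar>c\<bar> powr p + d * (b - c))
      \<le> (1 - t) * \<bar>a\<bar> powr p + t * \<bar>b\<bar> powr p"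
    unfolding d_def using powr_tangent[OF p] t by (intro add_mono mult_left_mono) auto
  moreover have "(1 - t) * (\<bar>c\<bar> powr p + d * (a - c)) + t * (\<bar>c\<bar> powr p + d * (b - c))
     = \<bar>c\<bar> powr p + d * ((1 - t) * a + t * b - c)" by (simp add: algebra_simps)
  ultimately show ?thesis by (simp add: c_def)
qed

lemma powr_midpoint_strict:
  fixes p a b :: real
  assumes p: "1 < p" and "a \<noteq> b"
  shows "\<bar>(a + b) / 2\<bar> powr p < (\<bar>a\<bar> powr p + \<bar>b\<bar> powr p) / 2"
proof -
  define c where "c = (a + b) / 2"
  define d where "d = p * (\<bar>c\<bar> powr (p - 1) * sgn c)"
  have "a \<noteq> c" "b \<noteq> c" using assms by (auto simp: c_def field_simps)
  then have "\<bar>c\<bar> powr p + d * (a - c) < \<bar>a\<bar> powr p" "\<bar>c\<bar> powr p + d * (b - c) < \<bar>b\<bar> powr p"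
    unfolding d_def using powr_tangent_strict[OF p] by blast+
  moreover have "d * (a - c) + d * (b - c) = 0" by (simp add: c_def field_simps)
  moreover have "A < (P + Q) / 2" if "A + x < P" "A + y < Q" "x + y = 0" for A P Q x y :: real
    using that by argo
  ultimately have "\<bar>c\<bar> powr p < (\<bar>a\<bar> powr p + \<bar>b\<bar> powr p) / 2" by blast
  then show ?thesis unfolding c_def .
qed

lemma powr_abs_mult: "\<bar>c * x\<bar> powr p = \<bar>c\<bar> powr p * \<bar>x\<bar> powr p" for c x p :: real
  by (simp add: abs_mult powr_mult)

text \<open>
  The sum is homogeneous of degree \<open>p\<close> in \<open>(a, b)\<close>, so it suffices to
  treat \<open>max |a| |b| = 1\<close>. The list of triples \<open>(c, \<alpha>,
  \<beta>)\<close> is one format for the various inequalities between \<open>p\<close>-th powers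
  of linear combinations of two quantities; inequalities in this format carry over from numbers
  to Sobolev norms.
\<close>

lemma powr_combination_nonneg:
  fixes cs :: "(real \<times> real \<times> real) list" and a b :: real
  assumes unit: "\<And>a b. max \<bar>a\<bar> \<bar>b\<bar> = 1 \<Longrightarrow> 0 \<le> (\<Sum>(c, \<alpha>, \<beta>)\<leftarrow>cs. c * \<bar>\<alpha> * a + \<beta> * b\<bar> powr p)"
  shows "0 \<le> (\<Sum>(c, \<alpha>, \<beta>)\<leftarrow>cs. c * \<bar>\<alpha> * a + \<beta> * b\<bar> powr p)"
proof (cases "max \<bar>a\<bar> \<bar>b\<bar> = 0")
  case True
  then have "a = 0" "b = 0" by (auto simp: max_def split: if_splits)
  moreover have "(\<Sum>(c, \<alpha>, \<beta>)\<leftarrow>cs. c * \<bar>\<alpha> * 0 + \<beta> * 0\<bar> powr p) = 0" by (induction cs) auto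
  ultimately show ?thesis by simp
next
  case False
  define l where "l = max \<bar>a\<bar> \<bar>b\<bar>"
  have l: "0 < l" using False unfolding l_def by linarith
  have hom: "c * \<bar>\<alpha> * a + \<beta> * b\<bar> powr p = l powr p * (c * \<bar>\<alpha> * (a / l) + \<beta> * (b / l)\<bar> powr p)" for c \<alpha> \<beta>
  proof -
    have "\<alpha> * a + \<beta> * b = l * (\<alpha> * (a / l) + \<beta> * (b / l))" using l by (simp add: distrib_left)
    then show ?thesis using l by (simp only: powr_abs_mult abs_of_pos mult.left_commute)
  qed
  have eq: "(\<Sum>(c, \<alpha>, \<beta>)\<leftarrow>cs. c * \<bar>\<alpha> * a + \<beta> * b\<bar> powr p)
      = l powr p * (\<Sum>(c, \<alpha>, \<beta>)\<leftarrow>cs. c * \<bar>\<alpha> * (a / l) + \<beta> * (b / l)\<bar> powr p)"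
  proof (induction cs)
    case (Cons z cs)
    obtain c \<alpha> \<beta> where z: "z = (c, \<alpha>, \<beta>)" by (cases z)
    show ?case unfolding z using Cons
      by (simp only: list.map sum_list.Cons prod.case distrib_left hom[of c \<alpha> \<beta>])
  qed simp
  have "max \<bar>a / l\<bar> \<bar>b / l\<bar> = 1"
    using l by (simp add: abs_divide l_def max_def split: if_splits)
  then show ?thesis unfolding eq by (intro mult_nonneg_nonneg powr_ge_zero unit)
qed

text \<open>
  A quantitative form of strict convexity that is linear in all \<open>p\<close>-th powers and
  can therefore be integrated term by term, for every \<open>p > 1\<close>. On the part of the
  unit square boundary where \<open>|a - b|\<^sup>p\<close> is not already absorbed by the first
  term, the convexity gap in the second term is bounded below by compactness.
\<close>

lemma powr_uniformly_convex:
  fixes p \<epsilon> :: real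
  assumes p: "1 < p" and \<epsilon>: "0 < \<epsilon>"
  obtains C where "0 < C"
    "\<And>a b. \<bar>a - b\<bar> powr p \<le> \<epsilon> * (\<bar>a\<bar> powr p + \<bar>b\<bar> powr p)
        + C * ((\<bar>a\<bar> powr p + \<bar>b\<bar> powr p) / 2 - \<bar>(a + b) / 2\<bar> powr p)"
proof -
  define g where "g = (\<lambda>z::real\<times>real. (\<bar>fst z\<bar> powr p + \<bar>snd z\<bar> powr p) / 2 - \<bar>(fst z + snd z) / 2\<bar> powr p)"
  define s where "s = (\<lambda>z::real\<times>real. \<bar>fst z\<bar> powr p + \<bar>snd z\<bar> powr p)"
  define K where "K = ({-1..1} \<times> {-1..1}) \<inter> {z. 1 \<le> s z \<and> \<epsilon> * s z \<le> \<bar>fst z - snd z\<bar> powr p}"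
  have cs: "continuous_on UNIV s" and cg: "continuous_on UNIV g"
    and cd: "continuous_on UNIV (\<lambda>z::real\<times>real. \<bar>fst z - snd z\<bar> powr p)"
    unfolding s_def g_def using p by (auto intro!: continuous_intros continuous_on_powr')
  have "closed {z. 1 \<le> s z \<and> \<epsilon> * s z \<le> \<bar>fst z - snd z\<bar> powr p}"
    by (intro closed_Collect_conj closed_Collect_le continuous_intros cs cd)
  then have K: "compact K" unfolding K_def by (intro compact_Int_closed compact_Times) auto
  have gpos: "0 \<le> g z" for z
    using powr_convex[OF p, of "1/2" "fst z" "snd z"] unfolding g_def by (simp add: field_simps)
  have "\<exists>\<delta>>0. \<forall>z\<in>K. \<delta> \<le> g z"
  proof (cases "K = {}")
    case True
    then show ?thesis by (auto intro!: exI[of _ 1])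
  next
    case False
    obtain z where z: "z \<in> K" "\<forall>w\<in>K. g z \<le> g w"
      using continuous_attains_inf[OF K False continuous_on_subset[OF cg]] by auto
    have "0 < \<epsilon> * s z" using z(1) \<epsilon> unfolding K_def by auto
    then have "fst z \<noteq> snd z" using z(1) p unfolding K_def by auto
    then have "0 < g z" using powr_midpoint_strict[OF p] unfolding g_def by simp
    then show ?thesis using z by auto
  qed
  then obtain \<delta> where \<delta>: "0 < \<delta>" "\<And>z. z \<in> K \<Longrightarrow> \<delta> \<le> g z" by blast
  \<comment> \<open>On the unit square \<open>|a - b| \<le> 2\<close>, so this \<open>C\<close> times a gap of at least \<open>\<delta>\<close> dominates \<open>|a - b|\<^sup>p\<close>.\<close>
  define C where "C = 2 powr p / \<delta>"
  have C: "0 < C" using \<delta> by (simp add: C_def)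
  have norm1: "\<bar>a - b\<bar> powr p \<le> \<epsilon> * s (a, b) + C * g (a, b)"
    if m: "max \<bar>a\<bar> \<bar>b\<bar> = 1" for a b
  proof -
    have s1: "1 \<le> s (a, b)"
      using m by (auto simp: s_def max_def split: if_splits)
    have ab: "a \<in> {-1..1}" "b \<in> {-1..1}" using m by (auto simp: max_def split: if_splits)
    show ?thesis
    proof (cases "(a, b) \<in> K")
      case True
      have "\<bar>a - b\<bar> powr p \<le> 2 powr p" using ab p by (intro powr_mono2) auto
      also have "\<dots> = C * \<delta>" using \<delta> by (simp add: C_def)
      also have "\<dots> \<le> C * g (a, b)" using \<delta>(2)[OF True] C by simp
      finally show ?thesis using \<epsilon> s1 by (smt (verit) mult_nonneg_nonneg)
    next
      case False
      then have "\<bar>a - b\<bar> powr p < \<epsilon> * s (a, b)" using ab s1 unfolding K_def by auto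
      moreover have "0 \<le> C * g (a, b)" using C gpos by simp
      ultimately show ?thesis by linarith
    qed
  qed
  have "0 \<le> (\<Sum>(c, \<alpha>, \<beta>)\<leftarrow>[(\<epsilon> + C/2, 1, 0), (\<epsilon> + C/2, 0, 1), (-C, 1/2, 1/2), (-1, 1, -1)].
      c * \<bar>\<alpha> * a + \<beta> * b\<bar> powr p)" for a b
    by (rule powr_combination_nonneg)
      (use norm1 in \<open>force simp: s_def g_def algebra_simps add_divide_distrib\<close>)
  then show ?thesis using that[OF C] by (simp add: algebra_simps add_divide_distrib)
qed

text \<open>
  The second difference of \<open>|x|\<^sup>q\<close> with step \<open>t b\<close> is
  \<open>o(t)\<close>, uniformly, because the derivative of \<open>|x|\<^sup>q\<close> is
  uniformly continuous on bounded intervals. Only the factor \<open>t \<eta>\<close> instead of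
  a mere \<open>\<eta>\<close> makes the estimate useful: duality divides by \<open>t\<close>.
\<close>

lemma powr_uniformly_smooth:
  fixes q \<eta> :: real
  assumes q: "1 < q" and \<eta>: "0 < \<eta>"
  obtains t where "0 < t" "t < 1"
    "\<And>a b. \<bar>a + t * b\<bar> powr q + \<bar>a - t * b\<bar> powr q
        \<le> 2 * \<bar>a\<bar> powr q + t * \<eta> * (\<bar>a\<bar> powr q + \<bar>b\<bar> powr q)"
proof -
  define d where "d = (\<lambda>x::real. \<bar>x\<bar> powr (q - 1) * sgn x)"
  have d_alt: "d = (\<lambda>x. (max x 0) powr (q - 1) - (max (-x) 0) powr (q - 1))"
    by (auto simp: d_def fun_eq_iff max_def sgn_real_def)
  have "continuous_on {-2..2} d"
    unfolding d_alt using q by (intro continuous_intros continuous_on_powr') auto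
  then have "uniformly_continuous_on {-2..2} d" by (intro compact_uniformly_continuous) auto
  moreover have "0 < \<eta> / q" using \<eta> q by simp
  ultimately obtain \<delta> where \<delta>: "0 < \<delta>" "\<And>x y. x \<in> {-2..2} \<Longrightarrow> y \<in> {-2..2} \<Longrightarrow> dist x y < \<delta> \<Longrightarrow> dist (d x) (d y) < \<eta> / q"
    unfolding uniformly_continuous_on_def by meson
  define t where "t = min (1/2) (\<delta> / 4)"
  have t: "0 < t" "t < 1" "2 * t < \<delta>" using \<delta>(1) by (auto simp: t_def min_def)
  define s where "s = (\<lambda>a b::real. \<bar>a\<bar> powr q + \<bar>b\<bar> powr q)"
  have norm1: "\<bar>a + t * b\<bar> powr q + \<bar>a - t * b\<bar> powr q \<le> 2 * \<bar>a\<bar> powr q + t * \<eta> * s a b"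
    if m: "max \<bar>a\<bar> \<bar>b\<bar> = 1" for a b
  proof -
    have s1: "1 \<le> s a b" using m by (auto simp: s_def max_def split: if_splits)
    have ab: "\<bar>a\<bar> \<le> 1" "\<bar>b\<bar> \<le> 1" using m by (auto simp: max_def split: if_splits)
    have tb: "\<bar>t * b\<bar> \<le> t" using ab t by (simp add: abs_mult mult_left_le)
    have "dist (a + t * b) (a - t * b) < \<delta>" using tb t unfolding dist_real_def by linarith
    moreover have "a + t * b \<in> {-2..2}" "a - t * b \<in> {-2..2}" using ab tb t by auto
    ultimately have dd: "\<bar>d (a + t * b) - d (a - t * b)\<bar> < \<eta> / q" using \<delta>(2) by (simp add: dist_real_def)
    \<comment> \<open>Tangents at \<open>a + t b\<close> and \<open>a - t b\<close>, both evaluated at \<open>a\<close>: their slopes nearly agree.\<close>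
    have "\<bar>a + t * b\<bar> powr q + q * d (a + t * b) * (a - (a + t * b)) \<le> \<bar>a\<bar> powr q"
      "\<bar>a - t * b\<bar> powr q + q * d (a - t * b) * (a - (a - t * b)) \<le> \<bar>a\<bar> powr q"
      unfolding d_def by (rule powr_tangent[OF q])+
    then have "\<bar>a + t * b\<bar> powr q + \<bar>a - t * b\<bar> powr q - 2 * \<bar>a\<bar> powr q
        \<le> q * (t * b * (d (a + t * b) - d (a - t * b)))" by (simp add: algebra_simps)
    also have "\<dots> \<le> q * (t * (\<eta> / q))"
    proof -
      have "t * b * (d (a + t * b) - d (a - t * b)) \<le> \<bar>t * b\<bar> * \<bar>d (a + t * b) - d (a - t * b)\<bar>"
        by (metis abs_ge_self abs_mult)
      also have "\<dots> \<le> t * (\<eta> / q)" using tb dd t by (intro mult_mono) auto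
      finally show ?thesis using q by (intro mult_left_mono) auto
    qed
    also have "\<dots> = t * \<eta>" using q by simp
    also have "\<dots> \<le> t * \<eta> * s a b" using s1 t \<eta> by simp
    finally show ?thesis by simp
  qed
  have "0 \<le> (\<Sum>(c, \<alpha>, \<beta>)\<leftarrow>[(2 + t * \<eta>, 1, 0), (t * \<eta>, 0, 1), (-1, 1, t), (-1, 1, -t)].
      c * \<bar>\<alpha> * a + \<beta> * b\<bar> powr q)" for a b
    by (rule powr_combination_nonneg) (use norm1 in \<open>force simp: s_def algebra_simps\<close>)
  then show ?thesis using that[OF t(1,2)] by (simp add: algebra_simps)
qed

text \<open>
  The triangle inequality for \<open>J\<^bsup>1/p\<^esup>\<close> when \<open>J\<close> is
  convex and homogeneous of degree \<open>p\<close>: write \<open>u + v = (1-t) (u/(1-t)) + t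
  (v/t)\<close> and choose \<open>t\<close> proportional to the norms. The norms are enlarged by
  \<open>e/2\<close> so that \<open>t\<close> lies strictly between \<open>0\<close> and
  \<open>1\<close>.
\<close>

lemma le_add_of_powr_split:
  fixes p A B c :: real
  assumes p: "1 < p" and A: "0 \<le> A" and B: "0 \<le> B" and c: "0 \<le> c"
    and split: "\<And>t. 0 < t \<Longrightarrow> t < 1 \<Longrightarrow> 
      c powr p \<le> (1 - t) * ((1 / (1 - t)) powr p * A powr p) + t * ((1 / t) powr p * B powr p)"
  shows "c \<le> A + B"
proof (rule field_le_epsilon)
  fix e :: real assume e: "0 < e"
  define A' B' where "A' = A + e/2" and "B' = B + e/2"
  have pos: "0 < A'" "0 < B'" using A B e by (auto simp: A'_def B'_def)
  define S where "S = A' + B'"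
  have S: "0 < S" using pos by (simp add: S_def)
  have r: "(x / S) * ((1 / (x / S)) powr p * x powr p) = x * S powr (p - 1)" if "0 < x" for x
  proof -
    have "(1 / (x / S)) powr p * x powr p = S powr p" using that S by (simp add: powr_divide)
    also have "\<dots> = S * S powr (p - 1)" using S by (simp add: powr_mult_base)
    finally show ?thesis using S by simp
  qed
  have t: "0 < B' / S" "B' / S < 1" "1 - B' / S = A' / S" using pos S by (auto simp: S_def field_simps)
  have "c powr p \<le> (A' / S) * ((1 / (A' / S)) powr p * A powr p) + (B' / S) * ((1 / (B' / S)) powr p * B powr p)"
    using split[OF t(1,2)] unfolding t(3) .
  also have "\<dots> \<le> (A' / S) * ((1 / (A' / S)) powr p * A' powr p) + (B' / S) * ((1 / (B' / S)) powr p * B' powr p)"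
    using A B e p pos S by (intro add_mono mult_left_mono powr_mono2) (auto simp: A'_def B'_def)
  also have "\<dots> = A' * S powr (p - 1) + B' * S powr (p - 1)"
    using r[OF pos(1)] r[OF pos(2)] by simp
  also have "\<dots> = S * S powr (p - 1)" by (simp add: S_def algebra_simps)
  also have "\<dots> = S powr p" using S by (simp add: powr_mult_base)
  finally have "c \<le> S" using p S c by (smt (verit) powr_less_mono2)
  then show "c \<le> A + B + e" by (simp add: S_def A'_def B'_def)
qed

text \<open>
  The bound is immediate when \<open>|x| \<le> l\<close>, and otherwise
  \<open>|x|\<^bsup>1-p\<^esup> \<le> l\<^bsup>1-p\<^esup>\<close>. Integrated over a set of
  finite measure, it controls the \<open>L\<^sup>1\<close> norm by a constant, small with
  \<open>l\<close>, plus a multiple of the integral of \<open>|x|\<^sup>p\<close>.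
\<close>

lemma abs_le_powr_split:
  fixes p x l :: real
  assumes p: "1 < p" and l: "0 < l"
  shows "\<bar>x\<bar> \<le> l + l powr (1 - p) * \<bar>x\<bar> powr p"
proof (cases "\<bar>x\<bar> \<le> l")
  case True
  then show ?thesis by (smt (verit) mult_nonneg_nonneg powr_ge_zero)
next
  case False
  have "\<bar>x\<bar> = \<bar>x\<bar> powr (1 - p) * \<bar>x\<bar> powr p" using False l by (simp add: powr_add[symmetric])
  also have "\<dots> \<le> l powr (1 - p) * \<bar>x\<bar> powr p"
    using False l p by (intro mult_right_mono powr_mono2') auto
  finally show ?thesis using l by simp
qed


section \<open>Minimizers in uniformly convex spaces\<close>

text \<open>
  By coercivity only a closed ball matters; there the sublevel sets \<open>{y. \<Phi> y \<le>
  \<Phi> z}\<close> are closed and have the finite intersection property.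
\<close>

lemma lsc_coercive_attains_min:
  fixes \<Phi> :: "'b::euclidean_space \<Rightarrow> ereal"
  assumes lsc: "\<And>c. open {x. c < \<Phi> x}" and coercive: "(\<Phi> \<longlongrightarrow> \<infinity>) at_infinity"
  shows "\<exists>x. \<forall>y. \<Phi> x \<le> \<Phi> y"
proof (cases "\<exists>y0. \<Phi> y0 < \<infinity>")
  case False
  then show ?thesis by (metis ereal_infty_less(1) linorder_le_cases not_le)
next
  case True
  then obtain y0 where y0: "\<Phi> y0 < \<infinity>" by blast
  have "eventually (\<lambda>x. \<Phi> y0 < \<Phi> x) at_infinity"
    using order_tendstoD(1)[OF coercive, of "\<Phi> y0"] y0 by simp
  then obtain R where R: "\<And>x. R \<le> norm x \<Longrightarrow> \<Phi> y0 < \<Phi> x"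
    unfolding eventually_at_infinity by blast
  define K where "K = cball (0::'b) R"
  have y0K: "y0 \<in> K" using R[of y0] unfolding K_def by force
  have "K \<inter> (\<Inter>z\<in>K. {y. \<Phi> y \<le> \<Phi> z}) \<noteq> {}"
  proof (rule compact_imp_fip_image)
    show "compact K" unfolding K_def by simp
    show "closed {y. \<Phi> y \<le> \<Phi> z}" for z
      using lsc[of "\<Phi> z"] by (simp add: closed_def Compl_eq not_le)
    fix I assume I: "finite I" "I \<subseteq> K"
    show "K \<inter> (\<Inter>z\<in>I. {y. \<Phi> y \<le> \<Phi> z}) \<noteq> {}"
    proof (cases "I = {}")
      case True
      then show ?thesis using y0K by auto
    next
      case False
      then have "Min (\<Phi> ` I) \<in> \<Phi> ` I" using I by simp
      then obtain w where w: "w \<in> I" "\<Phi> w = Min (\<Phi> ` I)" by auto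
      then have "\<forall>z\<in>I. \<Phi> w \<le> \<Phi> z" using I by simp
      then show ?thesis using w I by auto
    qed
  qed
  then obtain x where x: "x \<in> K" "\<And>z. z \<in> K \<Longrightarrow> \<Phi> x \<le> \<Phi> z" by auto
  have "\<Phi> x \<le> \<Phi> y" for y
  proof (cases "y \<in> K")
    case False
    then have "\<Phi> y0 < \<Phi> y" by (intro R) (simp add: K_def)
    then show ?thesis using x(2)[OF y0K] by simp
  qed (use x in auto)
  then show ?thesis by blast
qed

lemma lower_semicont_open:
  assumes "lower_semicont F"
  shows "open {x. c < F x}"
proof (subst open_subopen, safe)
  fix x assume x: "c < F x"
  have "eventually (\<lambda>y. c < F y) (at x)"
    using assms x unfolding lower_semicont_def le_Liminf_iff by blast
  then have "eventually (\<lambda>y. c < F y) (nhds x)" using x by (simp add: eventually_nhds_conv_at)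
  then show "\<exists>T. open T \<and> x \<in> T \<and> T \<subseteq> {x. c < F x}" by (auto simp: eventually_nhds)
qed

lemma open_less_add_continuous:
  fixes F :: "'b::euclidean_space \<Rightarrow> ereal"
  assumes lsc: "\<And>c. open {x. c < F x}" and g: "continuous_on UNIV g"
    and F: "\<And>x. F x \<noteq> -\<infinity>"
  shows "open {x. c < F x + ereal (g x)}"
proof (subst open_subopen, safe)
  fix x assume x: "c < F x + ereal (g x)"
  have "c - ereal (g x) < F x" using x F[of x] by (cases "F x"; cases c) auto
  then obtain d where d: "c - ereal (g x) < ereal d" "ereal d < F x" using ereal_dense2 by blast
  define T where "T = {y. ereal d < F y} \<inter> {y. c < ereal (d + g y)}"
  have "open T" unfolding T_def
    by (intro open_Int lsc open_Collect_less continuous_on_const continuous_on_ereal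
        continuous_on_add g)
  moreover have "x \<in> T" using d unfolding T_def by (cases c) auto
  moreover have "T \<subseteq> {x. c < F x + ereal (g x)}"
  proof
    fix y assume "y \<in> T"
    then show "y \<in> {x. c < F x + ereal (g x)}" unfolding T_def by (cases "F y"; cases c) auto
  qed
  ultimately show "\<exists>T. open T \<and> x \<in> T \<and> T \<subseteq> {x. c < F x + ereal (g x)}" by blast
qed

text \<open>
  \<open>W\<close> stands for a space of distributions and \<open>'f\<close> for the type of
  test functions. Its elements are plain functions with pointwise operations. The assumption
  \<open>uniform\<close> says that on bounded sets two elements are close as soon as the
  convexity gap of the \<open>p\<close>-th power of the norm at their midpoint is small.
\<close>

locale uniformly_convex_space =
  fixes W :: "('f \<Rightarrow> real) set" and N :: "('f \<Rightarrow> real) \<Rightarrow> real" and p :: real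
  assumes p: "1 < p"
    and lin: "\<And>T U a b. T \<in> W \<Longrightarrow> U \<in> W \<Longrightarrow> (\<lambda>i. a * T i + b * U i) \<in> W"
    and nonneg: "\<And>T. T \<in> W \<Longrightarrow> 0 \<le> N T"
    and scale: "\<And>T c. T \<in> W \<Longrightarrow> N (\<lambda>i. c * T i) = \<bar>c\<bar> * N T"
    and definite: "\<And>T. T \<in> W \<Longrightarrow> N T = 0 \<Longrightarrow> T = (\<lambda>_. 0)"
    and triangle: "\<And>T U. T \<in> W \<Longrightarrow> U \<in> W \<Longrightarrow> N (\<lambda>i. T i + U i) \<le> N T + N U"
    and uniform: "\<And>\<epsilon> B. 0 < \<epsilon> \<Longrightarrow> \<exists>\<delta>>0. \<forall>T\<in>W. \<forall>U\<in>W. N T \<le> B \<longrightarrow> N U \<le> B \<longrightarrow>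
        (N T powr p + N U powr p) / 2 - N (\<lambda>i. (1/2) * T i + (1/2) * U i) powr p < \<delta> \<longrightarrow>
        N (\<lambda>i. T i - U i) < \<epsilon>"
    and complete: "\<And>X. (\<And>n::nat. X n \<in> W) \<Longrightarrow>
        (\<And>e. 0 < e \<Longrightarrow> \<exists>n0. \<forall>m\<ge>n0. \<forall>n\<ge>n0. N (\<lambda>i. X m i - X n i) < e) \<Longrightarrow>
        \<exists>T\<in>W. (\<lambda>n. N (\<lambda>i. X n i - T i)) \<longlonglongrightarrow> 0"
    and pointwise: "\<And>X T i. (\<And>n::nat. X n \<in> W) \<Longrightarrow> T \<in> W \<Longrightarrow>
        (\<lambda>n. N (\<lambda>i. X n i - T i)) \<longlonglongrightarrow> 0 \<Longrightarrow> (\<lambda>n. X n i) \<longlonglongrightarrow> T i"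
begin

lemma cmult: "T \<in> W \<Longrightarrow> (\<lambda>i. c * T i) \<in> W"
  using lin[of T T c 0] by simp

lemma diff: "T \<in> W \<Longrightarrow> U \<in> W \<Longrightarrow> (\<lambda>i. T i - U i) \<in> W"
  using lin[of T U 1 "-1"] by simp

lemma convex:
  assumes "T \<in> W" "U \<in> W" "0 \<le> t" "t \<le> 1"
  shows "N (\<lambda>i. (1 - t) * T i + t * U i) powr p \<le> (1 - t) * N T powr p + t * N U powr p"
proof -
  have "N (\<lambda>i. (1 - t) * T i + t * U i) \<le> (1 - t) * N T + t * N U"
    using triangle[OF cmult[OF assms(1)] cmult[OF assms(2)], of "1 - t" t] scale assms by simp
  then have "N (\<lambda>i. (1 - t) * T i + t * U i) powr p \<le> \<bar>(1 - t) * N T + t * N U\<bar> powr p"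
    using p nonneg[OF lin[OF assms(1,2)]] by (intro powr_mono2) auto
  also have "\<dots> \<le> (1 - t) * \<bar>N T\<bar> powr p + t * \<bar>N U\<bar> powr p"
    using assms by (intro powr_convex p) auto
  finally show ?thesis using nonneg assms by simp
qed

definition vec_pow :: "('k::finite \<Rightarrow> 'f \<Rightarrow> real) \<Rightarrow> real" where
  "vec_pow u = (\<Sum>r\<in>UNIV. N (u r) powr p)"

definition vec_norm :: "('k::finite \<Rightarrow> 'f \<Rightarrow> real) \<Rightarrow> real" where
  "vec_norm u = vec_pow u powr (1 / p)"

lemma vec_pow_nonneg: "0 \<le> vec_pow u"
  unfolding vec_pow_def by (intro sum_nonneg) auto

lemma vec_norm_nonneg: "0 \<le> vec_norm u"
  unfolding vec_norm_def by simp

lemma vec_norm_powr: "vec_norm u powr p = vec_pow u"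
  using p vec_pow_nonneg[of u] by (simp add: vec_norm_def powr_powr)

lemma vec_norm_le_iff: "vec_norm u \<le> vec_norm v \<longleftrightarrow> vec_pow u \<le> vec_pow v"
  using p vec_pow_nonneg unfolding vec_norm_def
  by (smt (verit) powr_less_mono2 divide_pos_pos powr_mono2)

lemma component_le_vec_pow: "N (u r) powr p \<le> vec_pow u"
  unfolding vec_pow_def by (intro member_le_sum) auto

lemma component_le:
  assumes "u r \<in> W"
  shows "N (u r) \<le> vec_norm u"
proof -
  have "N (u r) = (N (u r) powr p) powr (1 / p)" using p nonneg[OF assms] by (simp add: powr_powr)
  also have "\<dots> \<le> vec_norm u" unfolding vec_norm_def
    using p component_le_vec_pow by (intro powr_mono2) auto
  finally show ?thesis .
qed

lemma vec_pow_scale: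
  assumes "\<And>r. u r \<in> W"
  shows "vec_pow (\<lambda>r i. c * u r i) = \<bar>c\<bar> powr p * vec_pow u"
  using nonneg[OF assms] unfolding vec_pow_def by (simp add: scale[OF assms] powr_mult sum_distrib_left)

lemma vec_norm_scale:
  assumes "\<And>r. u r \<in> W"
  shows "vec_norm (\<lambda>r i. c * u r i) = \<bar>c\<bar> * vec_norm u"
  using p vec_pow_nonneg[of u] unfolding vec_norm_def vec_pow_scale[OF assms]
  by (simp add: powr_mult powr_powr)

lemma vec_pow_convex:
  assumes "\<And>r. u r \<in> W" "\<And>r. v r \<in> W" "0 \<le> t" "t \<le> 1"
  shows "vec_pow (\<lambda>r i. (1 - t) * u r i + t * v r i) \<le> (1 - t) * vec_pow u + t * vec_pow v"
  unfolding vec_pow_def sum_distrib_left sum.distrib[symmetric]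
  by (intro sum_mono convex assms)

lemma vec_norm_triangle:
  assumes "\<And>r. u r \<in> W" "\<And>r. v r \<in> W"
  shows "vec_norm (\<lambda>r i. u r i + v r i) \<le> vec_norm u + vec_norm v"
proof (rule le_add_of_powr_split[OF p vec_norm_nonneg vec_norm_nonneg vec_norm_nonneg])
  fix t :: real assume t: "0 < t" "t < 1"
  have "vec_pow (\<lambda>r i. (1 - t) * (1 / (1 - t) * u r i) + t * (1 / t * v r i))
      \<le> (1 - t) * vec_pow (\<lambda>r i. 1 / (1 - t) * u r i) + t * vec_pow (\<lambda>r i. 1 / t * v r i)"
    using t by (intro vec_pow_convex cmult assms) auto
  also have "\<dots> = (1 - t) * ((1 / (1 - t)) powr p * vec_pow u) + t * ((1 / t) powr p * vec_pow v)"
    using t by (simp add: vec_pow_scale[OF assms(1)] vec_pow_scale[OF assms(2)] del: times_divide_eq_left)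
  also have "(\<lambda>r i. (1 - t) * (1 / (1 - t) * u r i) + t * (1 / t * v r i)) = (\<lambda>r i. u r i + v r i)"
    using t by (simp add: fun_eq_iff)
  finally show "vec_norm (\<lambda>r i. u r i + v r i) powr p
      \<le> (1 - t) * ((1 / (1 - t)) powr p * vec_norm u powr p) + t * ((1 / t) powr p * vec_norm v powr p)"
    unfolding vec_norm_powr .
qed

text \<open>
  All convexity gaps of the components are nonnegative, so each of them is bounded by the gap of
  the whole vector.
\<close>

lemma vec_uniform:
  fixes B :: real
  assumes "0 < \<epsilon>"
  shows "\<exists>\<delta>>0. \<forall>u v :: 'k::finite \<Rightarrow> 'f \<Rightarrow> real. (\<forall>r. u r \<in> W \<and> v r \<in> W) \<longrightarrow>
      vec_norm u \<le> B \<longrightarrow> vec_norm v \<le> B \<longrightarrow>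
      (vec_pow u + vec_pow v) / 2 - vec_pow (\<lambda>r i. (1/2) * u r i + (1/2) * v r i) < \<delta> \<longrightarrow>
      (\<forall>r. N (\<lambda>i. u r i - v r i) < \<epsilon>)"
proof -
  obtain \<delta> where \<delta>: "0 < \<delta>" "\<And>T U. T \<in> W \<Longrightarrow> U \<in> W \<Longrightarrow> N T \<le> B \<Longrightarrow> N U \<le> B \<Longrightarrow>
        (N T powr p + N U powr p) / 2 - N (\<lambda>i. (1/2) * T i + (1/2) * U i) powr p < \<delta> \<Longrightarrow>
        N (\<lambda>i. T i - U i) < \<epsilon>" using uniform[OF assms, of B] by blast
  show ?thesis
  proof (intro exI[of _ \<delta>] conjI \<delta>(1) allI impI)
    fix u v :: "'k \<Rightarrow> 'f \<Rightarrow> real" and r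
    assume W: "\<forall>r. u r \<in> W \<and> v r \<in> W" and B: "vec_norm u \<le> B" "vec_norm v \<le> B"
      and gap: "(vec_pow u + vec_pow v) / 2 - vec_pow (\<lambda>r i. (1/2) * u r i + (1/2) * v r i) < \<delta>"
    define g where "g = (\<lambda>r. (N (u r) powr p + N (v r) powr p) / 2
        - N (\<lambda>i. (1/2) * u r i + (1/2) * v r i) powr p)"
    have "0 \<le> g r" for r
      using convex[of "u r" "v r" "1/2"] W unfolding g_def by (simp add: field_simps)
    then have "g r \<le> sum g UNIV" by (intro member_le_sum) auto
    also have "sum g UNIV = (vec_pow u + vec_pow v) / 2 - vec_pow (\<lambda>r i. (1/2) * u r i + (1/2) * v r i)"
      unfolding g_def vec_pow_def by (simp only: sum_subtractf sum.distrib sum_divide_distrib[symmetric])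
    finally have "g r < \<delta>" using gap by simp
    then show "N (\<lambda>i. u r i - v r i) < \<epsilon>"
      using W B component_le[of u r] component_le[of v r] unfolding g_def by (intro \<delta>(2)) auto
  qed
qed

end

text \<open>
  \<open>S\<close> plays the role of the solution space and \<open>M\<close> that of the
  observation operator. Closedness under pointwise convergence is the form of stability that a
  linear differential equation for distributions has.
\<close>

locale observed_subspace = uniformly_convex_space W N p
  for W :: "('f \<Rightarrow> real) set" and N and p +
  fixes S :: "('k::finite \<Rightarrow> 'f \<Rightarrow> real) set" and M :: "('k \<Rightarrow> 'f \<Rightarrow> real) \<Rightarrow> real^'N::finite"
  assumes S_sub: "\<And>u r. u \<in> S \<Longrightarrow> u r \<in> W"
    and S_lin: "\<And>u v a b. u \<in> S \<Longrightarrow> v \<in> S \<Longrightarrow> (\<lambda>r i. a * u r i + b * v r i) \<in> S"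
    and S_closed: "\<And>X u. (\<And>n::nat. X n \<in> S) \<Longrightarrow> (\<And>r. u r \<in> W) \<Longrightarrow>
        (\<And>r i. (\<lambda>n. X n r i) \<longlonglongrightarrow> u r i) \<Longrightarrow> u \<in> S"
    and M_lin: "\<And>u v a b. u \<in> S \<Longrightarrow> v \<in> S \<Longrightarrow>
        M (\<lambda>r i. a * u r i + b * v r i) = a *\<^sub>R M u + b *\<^sub>R M v"
    and M_cont: "\<And>u \<epsilon>. u \<in> S \<Longrightarrow> 0 < \<epsilon> \<Longrightarrow>
        \<exists>\<delta>>0. \<forall>v\<in>S. vec_norm (\<lambda>r i. v r i - u r i) < \<delta> \<longrightarrow> norm (M v - M u) < \<epsilon>"
    and M_surj: "M ` S = UNIV"
begin

lemma fibre_midpoint: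
  assumes "u \<in> S" "v \<in> S" "M u = y" "M v = y"
  shows "(\<lambda>r i. (1/2) * u r i + (1/2) * v r i) \<in> S"
    "M (\<lambda>r i. (1/2) * u r i + (1/2) * v r i) = y"
  by (rule S_lin[OF assms(1,2)])
    (simp add: M_lin[OF assms(1,2), of "1/2" "1/2"] assms(3,4) scaleR_left_distrib[symmetric]
      del: times_divide_eq_left)

text \<open>
  The midpoint of two elements of least norm lies in the same fibre, so its convexity gap is not
  positive, and uniform convexity forces the two elements together.
\<close>

lemma fibre_minimum_unique:
  assumes u: "u \<in> S" "\<And>w. w \<in> S \<Longrightarrow> M w = M u \<Longrightarrow> vec_pow u \<le> vec_pow w"
    and v: "v \<in> S" "M v = M u" "vec_pow v \<le> vec_pow u"
  shows "u = v"
proof -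
  define w where "w = (\<lambda>r i. (1/2) * u r i + (1/2) * v r i)"
  have "w \<in> S" "M w = M u" using fibre_midpoint[OF u(1) v(1) refl v(2)] unfolding w_def by blast+
  then have "vec_pow u \<le> vec_pow w" by (rule u(2))
  then have gap: "(vec_pow u + vec_pow v) / 2 - vec_pow w \<le> 0" using v(3) by simp
  have "N (\<lambda>i. u r i - v r i) = 0" for r
  proof -
    have "N (\<lambda>i. u r i - v r i) \<le> \<epsilon>" if "0 < \<epsilon>" for \<epsilon>
    proof -
      from vec_uniform[OF that, of "max (vec_norm u) (vec_norm v)"]
      obtain \<delta> where \<delta>: "0 < \<delta>" "\<And>u' v' :: 'k \<Rightarrow> 'f \<Rightarrow> real. (\<forall>r. u' r \<in> W \<and> v' r \<in> W) \<Longrightarrow>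
        vec_norm u' \<le> max (vec_norm u) (vec_norm v) \<Longrightarrow> vec_norm v' \<le> max (vec_norm u) (vec_norm v) \<Longrightarrow>
        (vec_pow u' + vec_pow v') / 2 - vec_pow (\<lambda>r i. (1/2) * u' r i + (1/2) * v' r i) < \<delta> \<Longrightarrow>
        \<forall>r. N (\<lambda>i. u' r i - v' r i) < \<epsilon>" by blast
      have "\<forall>r. N (\<lambda>i. u r i - v r i) < \<epsilon>"
        using le_less_trans[OF gap \<delta>(1)] S_sub u(1) v(1) unfolding w_def by (intro \<delta>(2)) auto
      then show ?thesis by (simp add: less_imp_le)
    qed
    then show ?thesis
      using nonneg[OF diff[OF S_sub[OF u(1)] S_sub[OF v(1)]]] by (meson dual_order.antisym dense_ge)
  qed
  then have "(\<lambda>i. u r i - v r i) = (\<lambda>_. 0)" for r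
    using definite[OF diff[OF S_sub[OF u(1)] S_sub[OF v(1)]]] by blast
  then show ?thesis by (auto simp: fun_eq_iff)
qed

lemma closed_under_norm_limits:
  assumes X: "\<And>n::nat. X n \<in> S" and u: "\<And>r. u r \<in> W"
    and lim: "\<And>r. (\<lambda>n. N (\<lambda>i. X n r i - u r i)) \<longlonglongrightarrow> 0"
  shows "u \<in> S" "(\<lambda>n. M (X n)) \<longlonglongrightarrow> M u" "(\<lambda>n. vec_norm (\<lambda>r i. X n r i - u r i)) \<longlonglongrightarrow> 0"
proof -
  show uS: "u \<in> S"
    using pointwise[OF _ u lim] S_sub[OF X] by (intro S_closed[OF X u]) auto
  have "(\<lambda>n. vec_pow (\<lambda>r i. X n r i - u r i)) \<longlonglongrightarrow> (\<Sum>r\<in>(UNIV::'k set). 0 powr p)"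
    unfolding vec_pow_def using p nonneg[OF diff[OF S_sub[OF X] u]]
    by (intro tendsto_sum tendsto_powr' lim tendsto_const) auto
  then have "(\<lambda>n. vec_norm (\<lambda>r i. X n r i - u r i)) \<longlonglongrightarrow> 0 powr (1 / p)"
    unfolding vec_norm_def using p vec_pow_nonneg
    by (intro tendsto_powr' tendsto_const) (auto intro: always_eventually)
  then show V: "(\<lambda>n. vec_norm (\<lambda>r i. X n r i - u r i)) \<longlonglongrightarrow> 0" by simp
  show "(\<lambda>n. M (X n)) \<longlonglongrightarrow> M u"
  proof (rule LIMSEQ_I)
    fix e :: real assume "0 < e"
    from M_cont[OF uS this] obtain \<delta> where \<delta>: "0 < \<delta>"
      "\<And>v. v \<in> S \<Longrightarrow> vec_norm (\<lambda>r i. v r i - u r i) < \<delta> \<Longrightarrow> norm (M v - M u) < e" by blast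
    have "eventually (\<lambda>n. vec_norm (\<lambda>r i. X n r i - u r i) < \<delta>) sequentially"
      using order_tendstoD(2)[OF V \<delta>(1)] .
    then show "\<exists>n0. \<forall>n\<ge>n0. norm (M (X n) - M u) < e"
      using \<delta>(2)[OF X] unfolding eventually_sequentially by blast
  qed
qed

text \<open>
  A minimizing sequence is Cauchy: midpoints of its members stay in the fibre, hence their
  convexity gaps tend to \<open>0\<close>.
\<close>

lemma fibre_minimum_exists:
  "\<exists>u\<in>S. M u = y \<and> (\<forall>v\<in>S. M v = y \<longrightarrow> vec_pow u \<le> vec_pow v)"
proof -
  define E where "E = {u \<in> S. M u = y}"
  define I where "I = Inf (vec_pow ` E)"
  have "y \<in> M ` S" using M_surj by simp
  then have ne: "E \<noteq> {}" unfolding E_def by auto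
  have bdd: "bdd_below (vec_pow ` E)" using vec_pow_nonneg by (auto intro!: bdd_belowI)
  have I_le: "I \<le> vec_pow u" if "u \<in> E" for u
    unfolding I_def using that bdd by (intro cInf_lower) auto
  have I0: "0 \<le> I" unfolding I_def using ne vec_pow_nonneg by (intro cInf_greatest) auto
  have "\<exists>u\<in>E. vec_pow u < I + 1 / real (Suc n)" for n
    using cInf_lessD[of "vec_pow ` E" "I + 1 / real (Suc n)"] ne unfolding I_def by auto
  then obtain X where X: "\<And>n. X n \<in> E" "\<And>n. vec_pow (X n) < I + 1 / real (Suc n)" by metis
  have XS: "X n \<in> S" and XM: "M (X n) = y" for n using X(1)[of n] by (auto simp: E_def)
  have XB: "vec_norm (X n) \<le> (I + 1) powr (1 / p)" for n
  proof -
    have "1 / real (Suc n) \<le> 1" by simp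
    then have "vec_pow (X n) \<le> I + 1" using X(2)[of n] by linarith
    then show ?thesis unfolding vec_norm_def using p vec_pow_nonneg by (intro powr_mono2) auto
  qed
  have cauchy: "\<exists>n0. \<forall>m\<ge>n0. \<forall>n\<ge>n0. \<forall>r. N (\<lambda>i. X m r i - X n r i) < e" if e: "0 < e" for e
  proof -
    from vec_uniform[OF e, of "(I + 1) powr (1 / p)"]
    obtain \<delta> where \<delta>: "0 < \<delta>" "\<And>u v :: 'k \<Rightarrow> 'f \<Rightarrow> real. (\<forall>r. u r \<in> W \<and> v r \<in> W) \<Longrightarrow>
        vec_norm u \<le> (I + 1) powr (1 / p) \<Longrightarrow> vec_norm v \<le> (I + 1) powr (1 / p) \<Longrightarrow>
        (vec_pow u + vec_pow v) / 2 - vec_pow (\<lambda>r i. (1/2) * u r i + (1/2) * v r i) < \<delta> \<Longrightarrow>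
        \<forall>r. N (\<lambda>i. u r i - v r i) < e" by blast
    obtain n0 where n0: "1 / real (Suc n0) < \<delta>" using nat_approx_posE[OF \<delta>(1)] by auto
    have "\<forall>r. N (\<lambda>i. X m r i - X n r i) < e" if mn: "m \<ge> n0" "n \<ge> n0" for m n
    proof (rule \<delta>(2))
      have "(\<lambda>r i. (1/2) * X m r i + (1/2) * X n r i) \<in> E"
        using fibre_midpoint[OF XS XS XM XM] unfolding E_def by blast
      from I_le[OF this] have mid: "I \<le> vec_pow (\<lambda>r i. (1/2) * X m r i + (1/2) * X n r i)" .
      have "1 / real (Suc m) \<le> 1 / real (Suc n0)" "1 / real (Suc n) \<le> 1 / real (Suc n0)"
        using mn by (auto simp: field_simps)
      then have "vec_pow (X m) < I + \<delta>" "vec_pow (X n) < I + \<delta>" using X(2)[of m] X(2)[of n] n0 by linarith+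
      then show "(vec_pow (X m) + vec_pow (X n)) / 2
          - vec_pow (\<lambda>r i. (1/2) * X m r i + (1/2) * X n r i) < \<delta>" using mid by argo
    qed (use XB XS S_sub in auto)
    then show ?thesis by blast
  qed
  have "\<exists>T\<in>W. (\<lambda>n. N (\<lambda>i. X n r i - T i)) \<longlonglongrightarrow> 0" for r
    using cauchy by (intro complete S_sub XS) meson
  then obtain u where u: "\<And>r. u r \<in> W" "\<And>r. (\<lambda>n. N (\<lambda>i. X n r i - u r i)) \<longlonglongrightarrow> 0" by metis
  note lim = closed_under_norm_limits[of X u, OF XS u(1) u(2)]
  have "M u = y" using LIMSEQ_unique[OF lim(2), of y] XM by simp
  have "vec_norm u \<le> I powr (1 / p)"
  proof (rule LIMSEQ_le)
    have "(\<lambda>n. I + 1 / real (Suc n)) \<longlonglongrightarrow> I + 0"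
      by (intro tendsto_add tendsto_const LIMSEQ_Suc[OF lim_1_over_n])
    then have "(\<lambda>n. (I + 1 / real (Suc n)) powr (1 / p)) \<longlonglongrightarrow> (I + 0) powr (1 / p)"
      using p I0 by (intro tendsto_powr' tendsto_const) auto
    from tendsto_add[OF this lim(3)]
    show "(\<lambda>n. (I + 1 / real (Suc n)) powr (1 / p) + vec_norm (\<lambda>r i. X n r i - u r i))
        \<longlonglongrightarrow> I powr (1 / p)" by simp
    show "(\<lambda>n. vec_norm u) \<longlonglongrightarrow> vec_norm u" by simp
    show "\<exists>n0. \<forall>n\<ge>n0. vec_norm u \<le> (I + 1 / real (Suc n)) powr (1 / p) + vec_norm (\<lambda>r i. X n r i - u r i)"
    proof (intro exI[of _ 0] allI impI)
      fix n
      have "vec_norm u = vec_norm (\<lambda>r i. X n r i + (-1) * (X n r i - u r i))" by simp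
      also have "\<dots> \<le> vec_norm (X n) + vec_norm (\<lambda>r i. (-1) * (X n r i - u r i))"
        by (intro vec_norm_triangle cmult diff S_sub[OF XS] u)
      also have "vec_norm (\<lambda>r i. (-1) * (X n r i - u r i)) = vec_norm (\<lambda>r i. X n r i - u r i)"
        by (subst vec_norm_scale) (auto intro: diff S_sub[OF XS] u)
      also have "vec_norm (X n) \<le> (I + 1 / real (Suc n)) powr (1 / p)"
        unfolding vec_norm_def using p X(2)[of n] vec_pow_nonneg by (intro powr_mono2) auto
      finally show "vec_norm u \<le> (I + 1 / real (Suc n)) powr (1 / p) + vec_norm (\<lambda>r i. X n r i - u r i)"
        by simp
    qed
  qed
  then have "vec_norm u powr p \<le> (I powr (1 / p)) powr p" using p vec_norm_nonneg by (intro powr_mono2) auto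
  then have "vec_pow u \<le> I" using p I0 by (simp add: vec_norm_powr powr_powr)
  then show ?thesis using lim(1) \<open>M u = y\<close> I_le unfolding E_def by force
qed

text \<open>
  \<open>U y\<close> selects the element of least norm in the fibre over \<open>y\<close>.
  Convexity of \<open>vec_pow (U y)\<close> in \<open>y\<close> holds because a convex
  combination of selected elements is a competitor in its own fibre; finiteness on the whole
  space then gives continuity.
\<close>

theorem exists_minimizer:
  fixes F :: "real^'N \<Rightarrow> ereal" and b :: real
  assumes F: "\<And>x. F x \<noteq> -\<infinity>" "proper_fun F" "coercive_fun F" "lower_semicont F"
    and b: "0 < b"
  shows "(\<exists>u. minimizer_on S (\<lambda>u. F (M u) + ereal (b * vec_norm u)) u) \<and>
    (strictly_convex_fun F \<longrightarrow> (\<exists>!u. minimizer_on S (\<lambda>u. F (M u) + ereal (b * vec_norm u)) u))"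
proof -
  let ?G = "\<lambda>u. F (M u) + ereal (b * vec_norm u)"
  obtain U where U: "\<And>y. U y \<in> S" "\<And>y. M (U y) = y" "\<And>v. v \<in> S \<Longrightarrow> vec_pow (U (M v)) \<le> vec_pow v"
    using fibre_minimum_exists by metis
  have "convex_on UNIV (\<lambda>y. vec_pow (U y))"
  proof (rule convex_onI)
    fix t :: real and x y :: "real^'N" assume t: "0 < t" "t < 1"
    define w where "w = (\<lambda>r i. (1 - t) * U x r i + t * U y r i)"
    have "w \<in> S" "M w = (1 - t) *\<^sub>R x + t *\<^sub>R y"
      unfolding w_def using S_lin M_lin U by auto
    then have "vec_pow (U ((1 - t) *\<^sub>R x + t *\<^sub>R y)) \<le> vec_pow w" using U(3)[of w] by simp
    also have "\<dots> \<le> (1 - t) * vec_pow (U x) + t * vec_pow (U y)"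
      unfolding w_def using t by (intro vec_pow_convex S_sub U) auto
    finally show "vec_pow (U ((1 - t) *\<^sub>R x + t *\<^sub>R y)) \<le> (1 - t) * vec_pow (U x) + t * vec_pow (U y)" .
  qed auto
  then have "continuous_on UNIV (\<lambda>y. vec_pow (U y))" by (intro convex_on_continuous) auto
  then have cont: "continuous_on UNIV (\<lambda>y. b * vec_norm (U y))"
    unfolding vec_norm_def using p vec_pow_nonneg by (intro continuous_intros continuous_on_powr') auto
  define \<Phi> where "\<Phi> = (\<lambda>y. ?G (U y))"
  have \<Phi>: "\<Phi> y = F y + ereal (b * vec_norm (U y))" for y unfolding \<Phi>_def U(2) ..
  have "F y \<le> \<Phi> y" for y
    unfolding \<Phi> using b vec_norm_nonneg[of "U y"] by (cases "F y") auto
  then have "(\<Phi> \<longlongrightarrow> \<infinity>) at_infinity"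
    using F(3) unfolding coercive_fun_def tendsto_PInfty
    by (metis (mono_tags, lifting) eventually_mono less_le_trans)
  moreover have "open {x. c < \<Phi> x}" for c
    unfolding \<Phi> by (intro open_less_add_continuous lower_semicont_open F cont)
  ultimately obtain y0 where y0: "\<And>y. \<Phi> y0 \<le> \<Phi> y" using lsc_coercive_attains_min by blast
  have "?G (U y0) \<le> ?G v" if v: "v \<in> S" for v
  proof -
    have "?G (U y0) \<le> ?G (U (M v))" using y0 unfolding \<Phi>_def .
    also have "\<dots> \<le> ?G v"
      unfolding U(2) using U(3)[OF v] b by (intro add_left_mono) (simp add: vec_norm_le_iff)
    finally show ?thesis .
  qed
  then have ex: "minimizer_on S ?G (U y0)" unfolding minimizer_on_def using U(1) by blast
  \<comment> \<open>Strict convexity is used where \<open>F\<close> is finite; minimizers have finite \<open>F (M u)\<close> since \<open>F\<close> is proper and \<open>M\<close> is onto.\<close>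
  have uniq: "u = v" if sc: "strictly_convex_fun F" and u: "minimizer_on S ?G u" and v: "minimizer_on S ?G v" for u v
  proof -
    have uS: "u \<in> S" and vS: "v \<in> S" and u_le: "\<And>w. w \<in> S \<Longrightarrow> ?G u \<le> ?G w"
      and v_le: "\<And>w. w \<in> S \<Longrightarrow> ?G v \<le> ?G w" using u v unfolding minimizer_on_def by auto
    obtain x where x: "F x \<noteq> \<infinity>" using F(2) unfolding proper_fun_def by blast
    have fin: "F (M w) < \<infinity>" if "\<And>w'. w' \<in> S \<Longrightarrow> ?G w \<le> ?G w'" for w
      using that[OF U(1)[of x]] x unfolding U(2) by (cases "F (M w)"; cases "F x") auto
    obtain fu where fu: "F (M u) = ereal fu" using fin[OF u_le] F(1)[of "M u"] by (cases "F (M u)") auto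
    obtain fv where fv: "F (M v) = ereal fv" using fin[OF v_le] F(1)[of "M v"] by (cases "F (M v)") auto
    have eq: "fu + b * vec_norm u = fv + b * vec_norm v"
      using u_le[OF vS] v_le[OF uS] fu fv by simp
    have "M u = M v"
    proof (rule ccontr)
      assume ne: "M u \<noteq> M v"
      define w where "w = (\<lambda>r i. (1/2) * u r i + (1/2) * v r i)"
      have wS: "w \<in> S" and Mw: "M w = (1 - 1/2) *\<^sub>R M u + (1/2) *\<^sub>R M v"
        unfolding w_def using S_lin[OF uS vS, of "1/2" "1/2"] M_lin[OF uS vS, of "1/2" "1/2"]
        by (simp_all del: times_divide_eq_left)
      have "F (M w) < ereal (1 - 1/2) * F (M u) + ereal (1/2) * F (M v)"
        unfolding Mw using sc[unfolded strictly_convex_fun_def, THEN conjunct2, rule_format,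
            of "1/2" "M u" "M v"] ne fu fv by simp
      also have "\<dots> = ereal ((fu + fv) / 2)" unfolding fu fv by (simp add: field_simps)
      finally have Fw: "F (M w) < ereal ((fu + fv) / 2)" .
      have "vec_norm w \<le> vec_norm (\<lambda>r i. (1/2) * u r i) + vec_norm (\<lambda>r i. (1/2) * v r i)"
        unfolding w_def by (intro vec_norm_triangle cmult S_sub uS vS)
      also have "\<dots> = (vec_norm u + vec_norm v) / 2"
        using vec_norm_scale[of u "1/2"] vec_norm_scale[of v "1/2"] S_sub uS vS by (simp del: times_divide_eq_left)
      finally have "b * vec_norm w \<le> b * ((vec_norm u + vec_norm v) / 2)" using b by simp
      moreover have "ereal (fu + b * vec_norm u) \<le> ?G w" using u_le[OF wS] fu by simp
      ultimately show False using Fw eq F(1)[of "M w"] by (cases "F (M w)") (auto simp: field_simps)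
    qed
    show ?thesis
    proof (rule fibre_minimum_unique[OF uS _ vS])
      have le: "vec_pow z \<le> vec_pow w" if z_le: "?G z \<le> ?G w" and M: "M z = M u" "M w = M u" for w z
      proof -
        have "b * vec_norm z \<le> b * vec_norm w" using z_le M fu by simp
        then show ?thesis using b by (simp add: vec_norm_le_iff)
      qed
      show "vec_pow u \<le> vec_pow w" if "w \<in> S" "M w = M u" for w
        by (rule le) (use u_le[OF that(1)] that in auto)
      show "M v = M u" using \<open>M u = M v\<close> by simp
      show "vec_pow v \<le> vec_pow u"
        by (rule le) (use v_le[OF uS] \<open>M u = M v\<close> in auto)
    qed
  qed
  show ?thesis using ex uniq by blast
qed

end


section \<open>Calculus of test functions\<close>

lemma pdiff_eqI:
  assumes "(f has_derivative f') (at x)"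
  shows "pdiff i f x = f' (axis i 1)"
  using frechet_derivative_at[OF assms] by (simp add: pdiff_def)

lemma smooth_imp_differentiable:
  assumes "smooth_fun_on UNIV f"
  shows "f differentiable (at x)"
  using assms[unfolded smooth_fun_on_def, rule_format, of "[]"] by (simp add: differentiable_on_def)

lemma smooth_imp_continuous:
  assumes "smooth_fun_on UNIV f"
  shows "continuous_on UNIV f"
  using assms[unfolded smooth_fun_on_def, rule_format, of "[]"]
  by (simp add: differentiable_imp_continuous_on)

lemma smooth_pdiff:
  assumes "smooth_fun_on UNIV f"
  shows "smooth_fun_on UNIV (pdiff i f)"
  unfolding smooth_fun_on_def
proof
  fix js
  show "foldr pdiff js (pdiff i f) differentiable_on UNIV"
    using assms[unfolded smooth_fun_on_def, rule_format, of "js @ [i]"] by simp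
qed

lemma smooth_foldr_pdiff:
  "smooth_fun_on UNIV f \<Longrightarrow> smooth_fun_on UNIV (foldr pdiff js f)"
  by (induction js) (auto intro: smooth_pdiff)

text \<open>
  Smoothness is proved by exhibiting a class of differentiable functions that is stable under
  partial derivatives.
\<close>

lemma smooth_if_pdiff_closed:
  assumes "f \<in> C" "\<And>g. g \<in> C \<Longrightarrow> g differentiable_on UNIV" "\<And>g i. g \<in> C \<Longrightarrow> pdiff i g \<in> C"
  shows "smooth_fun_on UNIV f"
proof -
  have "foldr pdiff js f \<in> C" for js by (induction js) (auto intro: assms)
  then show ?thesis unfolding smooth_fun_on_def using assms(2) by blast
qed

lemma foldr_pdiff_lin:
  assumes "smooth_fun_on UNIV f" "smooth_fun_on UNIV g"
  shows "foldr pdiff js (\<lambda>x. a * f x + b * g x)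
    = (\<lambda>x. a * foldr pdiff js f x + b * foldr pdiff js g x)"
proof (induction js)
  case (Cons j js)
  show ?case
  proof
    fix x
    let ?F = "foldr pdiff js f" and ?G = "foldr pdiff js g"
    have "(?F has_derivative frechet_derivative ?F (at x)) (at x)"
      "(?G has_derivative frechet_derivative ?G (at x)) (at x)"
      using assms by (auto intro!: smooth_imp_differentiable smooth_foldr_pdiff simp: frechet_derivative_works[symmetric])
    then have "((\<lambda>x. a * ?F x + b * ?G x) has_derivative
      (\<lambda>h. a * frechet_derivative ?F (at x) h + b * frechet_derivative ?G (at x) h)) (at x)"
      by (intro derivative_intros)
    from pdiff_eqI[OF this]
    show "foldr pdiff (j # js) (\<lambda>x. a * f x + b * g x) x
      = a * foldr pdiff (j # js) f x + b * foldr pdiff (j # js) g x"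
      by (simp add: Cons.IH pdiff_def[of j ?F] pdiff_def[of j ?G])
  qed
qed simp

lemma smooth_lin:
  assumes "smooth_fun_on UNIV f" "smooth_fun_on UNIV g"
  shows "smooth_fun_on UNIV (\<lambda>x. a * f x + b * g x)"
  unfolding smooth_fun_on_def foldr_pdiff_lin[OF assms]
  by (auto intro!: derivative_intros differentiable_on_add differentiable_on_mult differentiable_on_const
      simp: assms[unfolded smooth_fun_on_def, rule_format])

lemma has_real_derivative_along_axis:
  assumes "f differentiable (at (y + s *\<^sub>R axis i 1))"
  shows "((\<lambda>t. f (y + t *\<^sub>R axis i 1)) has_real_derivative pdiff i f (y + s *\<^sub>R axis i 1)) (at s)"
proof -
  let ?f' = "frechet_derivative f (at (y + s *\<^sub>R axis i 1))"
  have f': "(f has_derivative ?f') (at (y + s *\<^sub>R axis i 1))"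
    using assms frechet_derivative_works by blast
  have "((\<lambda>t. y + t *\<^sub>R axis i 1) has_derivative (\<lambda>t. t *\<^sub>R axis i 1)) (at s)"
    by (auto intro!: derivative_eq_intros)
  from has_derivative_compose[OF this f']
  have "((\<lambda>t. f (y + t *\<^sub>R axis i 1)) has_derivative (\<lambda>t. ?f' (t *\<^sub>R axis i 1))) (at s)" .
  moreover have "(\<lambda>t. ?f' (t *\<^sub>R axis i 1)) = (*) (pdiff i f (y + s *\<^sub>R axis i 1))"
    using linear_scale[OF has_derivative_linear[OF f']] by (auto simp: pdiff_def mult.commute)
  ultimately show ?thesis unfolding has_field_derivative_def by simp
qed

text \<open>
  The mean value theorem is applied in direction \<open>i\<close> first and in direction
  \<open>j\<close> second. The left-hand side is symmetric in \<open>i\<close> and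
  \<open>j\<close>, which is the source of the symmetry of mixed derivatives.
\<close>

lemma second_difference:
  assumes "smooth_fun_on UNIV f" and h: "0 < h"
  obtains \<xi> \<eta> where "0 < \<xi>" "\<xi> < h" "0 < \<eta>" "\<eta> < h"
    "f (x + h *\<^sub>R axis i 1 + h *\<^sub>R axis j 1) - f (x + h *\<^sub>R axis i 1) - f (x + h *\<^sub>R axis j 1) + f x
      = h * h * pdiff j (pdiff i f) (x + \<xi> *\<^sub>R axis i 1 + \<eta> *\<^sub>R axis j 1)"
proof -
  note d1 = has_real_derivative_along_axis[OF smooth_imp_differentiable[OF assms(1)]]
  note d2 = has_real_derivative_along_axis[OF smooth_imp_differentiable[OF smooth_pdiff[OF assms(1)]]]
  have "((\<lambda>s. f ((x + h *\<^sub>R axis j 1) + s *\<^sub>R axis i 1) - f (x + s *\<^sub>R axis i 1)) has_real_derivative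
     pdiff i f ((x + h *\<^sub>R axis j 1) + s *\<^sub>R axis i 1) - pdiff i f (x + s *\<^sub>R axis i 1)) (at s)" for s
    by (intro derivative_intros d1)
  from MVT2[OF h this] obtain \<xi> where \<xi>: "0 < \<xi>" "\<xi> < h" and
    e1: "f ((x + h *\<^sub>R axis j 1) + h *\<^sub>R axis i 1) - f (x + h *\<^sub>R axis i 1)
      - (f ((x + h *\<^sub>R axis j 1) + 0 *\<^sub>R axis i 1) - f (x + 0 *\<^sub>R axis i 1))
      = (h - 0) * (pdiff i f ((x + h *\<^sub>R axis j 1) + \<xi> *\<^sub>R axis i 1) - pdiff i f (x + \<xi> *\<^sub>R axis i 1))"
    by metis
  have "((\<lambda>t. pdiff i f (x + \<xi> *\<^sub>R axis i 1 + t *\<^sub>R axis j 1)) has_real_derivative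
     pdiff j (pdiff i f) (x + \<xi> *\<^sub>R axis i 1 + t *\<^sub>R axis j 1)) (at t)" for t
    by (rule d2)
  from MVT2[OF h this] obtain \<eta> where \<eta>: "0 < \<eta>" "\<eta> < h" and
    e2: "pdiff i f (x + \<xi> *\<^sub>R axis i 1 + h *\<^sub>R axis j 1) - pdiff i f (x + \<xi> *\<^sub>R axis i 1 + 0 *\<^sub>R axis j 1)
      = (h - 0) * pdiff j (pdiff i f) (x + \<xi> *\<^sub>R axis i 1 + \<eta> *\<^sub>R axis j 1)"
    by metis
  have c: "x + a *\<^sub>R axis j 1 + b *\<^sub>R axis i 1 = x + b *\<^sub>R axis i 1 + a *\<^sub>R axis j 1" for a b
    by simp
  show ?thesis
  proof (rule that[OF \<xi> \<eta>])
    show "f (x + h *\<^sub>R axis i 1 + h *\<^sub>R axis j 1) - f (x + h *\<^sub>R axis i 1) - f (x + h *\<^sub>R axis j 1) + f x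
      = h * h * pdiff j (pdiff i f) (x + \<xi> *\<^sub>R axis i 1 + \<eta> *\<^sub>R axis j 1)"
      using e1 e2 unfolding c by simp
  qed
qed

text \<open>
  Both mixed derivatives take the same value at some points arbitrarily close to
  \<open>x\<close>, and both are continuous.
\<close>

lemma pdiff_commute:
  assumes f: "smooth_fun_on UNIV f"
  shows "pdiff i (pdiff j f) = pdiff j (pdiff i f)"
proof
  fix x
  define P Q where "P = pdiff j (pdiff i f)" and "Q = pdiff i (pdiff j f)"
  have cont: "isCont P x" "isCont Q x"
    using smooth_imp_continuous[OF smooth_pdiff[OF smooth_pdiff[OF f]]]
    by (auto simp: P_def Q_def continuous_on_eq_continuous_at)
  have "dist (Q x) (P x) \<le> 0 + e" if e: "0 < e" for e
  proof -
    obtain d1 where d1: "0 < d1" "\<And>y. dist y x < d1 \<Longrightarrow> dist (P y) (P x) < e/2"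
      using cont(1) e unfolding continuous_at_eps_delta by (meson half_gt_zero)
    obtain d2 where d2: "0 < d2" "\<And>y. dist y x < d2 \<Longrightarrow> dist (Q y) (Q x) < e/2"
      using cont(2) e unfolding continuous_at_eps_delta by (meson half_gt_zero)
    define h where "h = min d1 d2 / 2"
    have h: "0 < h" "2 * h \<le> d1" "2 * h \<le> d2" using d1 d2 by (auto simp: h_def)
    have near: "dist (x + s *\<^sub>R axis k 1 + t *\<^sub>R axis l 1) x < 2 * h"
      if "0 < s" "s < h" "0 < t" "t < h" for s t and k l :: 'a
    proof -
      have "norm (s *\<^sub>R axis k (1::real) + t *\<^sub>R axis l 1) \<le> s + t"
        using norm_triangle_ineq[of "s *\<^sub>R axis k (1::real)" "t *\<^sub>R axis l 1"] that by simp
      then show ?thesis using that by (simp add: dist_norm add.assoc)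
    qed
    obtain \<xi> \<eta> where 1: "0 < \<xi>" "\<xi> < h" "0 < \<eta>" "\<eta> < h"
      "f (x + h *\<^sub>R axis i 1 + h *\<^sub>R axis j 1) - f (x + h *\<^sub>R axis i 1) - f (x + h *\<^sub>R axis j 1) + f x
      = h * h * P (x + \<xi> *\<^sub>R axis i 1 + \<eta> *\<^sub>R axis j 1)"
      unfolding P_def by (rule second_difference[OF f h(1)])
    obtain \<xi>' \<eta>' where 2: "0 < \<xi>'" "\<xi>' < h" "0 < \<eta>'" "\<eta>' < h"
      "f (x + h *\<^sub>R axis j 1 + h *\<^sub>R axis i 1) - f (x + h *\<^sub>R axis j 1) - f (x + h *\<^sub>R axis i 1) + f x
      = h * h * Q (x + \<xi>' *\<^sub>R axis j 1 + \<eta>' *\<^sub>R axis i 1)"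
      unfolding Q_def by (rule second_difference[OF f h(1)])
    have c: "x + h *\<^sub>R axis j 1 + h *\<^sub>R axis i 1 = x + h *\<^sub>R axis i 1 + h *\<^sub>R axis j 1" by simp
    have "h * h * P (x + \<xi> *\<^sub>R axis i 1 + \<eta> *\<^sub>R axis j 1) = h * h * Q (x + \<xi>' *\<^sub>R axis j 1 + \<eta>' *\<^sub>R axis i 1)"
      using 1(5) 2(5) unfolding c by linarith
    then have "P (x + \<xi> *\<^sub>R axis i 1 + \<eta> *\<^sub>R axis j 1) = Q (x + \<xi>' *\<^sub>R axis j 1 + \<eta>' *\<^sub>R axis i 1)"
      using h(1) by simp
    moreover have "dist (P (x + \<xi> *\<^sub>R axis i 1 + \<eta> *\<^sub>R axis j 1)) (P x) < e/2"
      using near[OF 1(1-4), of i j] h by (intro d1(2)) linarith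
    moreover have "dist (Q (x + \<xi>' *\<^sub>R axis j 1 + \<eta>' *\<^sub>R axis i 1)) (Q x) < e/2"
      using near[OF 2(1-4), of j i] h by (intro d2(2)) linarith
    ultimately show ?thesis unfolding dist_real_def by linarith
  qed
  then have "dist (Q x) (P x) \<le> 0" by (rule field_le_epsilon)
  then show "pdiff i (pdiff j f) x = pdiff j (pdiff i f) x" by (simp add: P_def Q_def)
qed

text \<open>
  Integration by parts moves the derivatives one at a time and reverses their order; this
  restores it.
\<close>

lemma foldr_pdiff_commute:
  assumes "smooth_fun_on UNIV f"
  shows "foldr pdiff js (pdiff i f) = pdiff i (foldr pdiff js f)"
  using assms by (induction js) (simp_all add: pdiff_commute[OF smooth_foldr_pdiff])

lemma supp_subset: "{x. \<phi> x \<noteq> 0} \<subseteq> supp \<phi>"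
  unfolding supp_def by (rule closure_subset)

lemma not_in_supp: "x \<notin> supp \<phi> \<Longrightarrow> \<phi> x = 0"
  using supp_subset[of \<phi>] by blast

lemma supp_minimal: "closed K \<Longrightarrow> (\<And>x. x \<notin> K \<Longrightarrow> \<phi> x = 0) \<Longrightarrow> supp \<phi> \<subseteq> K"
  unfolding supp_def by (intro closure_minimal) auto

lemma closed_supp: "closed (supp \<phi>)"
  unfolding supp_def by simp

lemma pdiff_outside_supp:
  assumes "x \<notin> supp \<phi>"
  shows "pdiff i \<phi> x = 0"
proof -
  have "(\<phi> has_derivative (\<lambda>_. 0)) (at x)"
    by (rule has_derivative_transform_within_open[of "\<lambda>_. 0" _ _ _ "- supp \<phi>"])
      (use assms closed_supp not_in_supp in \<open>auto simp: open_closed\<close>)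
  from pdiff_eqI[OF this] show ?thesis .
qed

lemma supp_pdiff: "supp (pdiff i \<phi>) \<subseteq> supp \<phi>"
  by (intro supp_minimal closed_supp pdiff_outside_supp)

lemma supp_foldr_pdiff: "supp (foldr pdiff js \<phi>) \<subseteq> supp \<phi>"
proof (induction js)
  case (Cons j js)
  then show ?case using supp_pdiff[of j "foldr pdiff js \<phi>"] by simp
qed simp

lemma test_funI:
  assumes "smooth_fun_on UNIV \<phi>" "compact K" "K \<subseteq> U" "\<And>x. x \<notin> K \<Longrightarrow> \<phi> x = 0"
  shows "\<phi> \<in> test_fun U"
proof -
  have "supp \<phi> \<subseteq> K" by (intro supp_minimal compact_imp_closed assms)
  then show ?thesis unfolding test_fun_def
    using assms closed_supp[of \<phi>] compact_Int_closed[OF assms(2) closed_supp[of \<phi>]] by (auto simp: inf.absorb2)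
qed

lemma test_fun_lin:
  assumes "\<phi> \<in> test_fun U" "\<psi> \<in> test_fun U"
  shows "(\<lambda>x. a * \<phi> x + b * \<psi> x) \<in> test_fun U"
  by (rule test_funI[of _ "supp \<phi> \<union> supp \<psi>"])
    (use assms not_in_supp[of _ \<phi>] not_in_supp[of _ \<psi>] in \<open>auto simp: test_fun_def smooth_lin\<close>)

lemma test_fun_foldr_pdiff:
  assumes "\<phi> \<in> test_fun U"
  shows "foldr pdiff js \<phi> \<in> test_fun U"
  by (rule test_funI[of _ "supp \<phi>"])
    (use assms supp_foldr_pdiff[of js \<phi>] not_in_supp[of _ "foldr pdiff js \<phi>"] in \<open>auto simp: test_fun_def smooth_foldr_pdiff\<close>)

lemma test_fun_mdiff: "\<phi> \<in> test_fun U \<Longrightarrow> mdiff \<alpha> \<phi> \<in> test_fun U"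
  unfolding mdiff_def by (rule test_fun_foldr_pdiff)

lemma test_fun_continuous: "\<phi> \<in> test_fun U \<Longrightarrow> continuous_on UNIV \<phi>"
  unfolding test_fun_def using smooth_imp_continuous by blast

lemma test_fun_zero_outside: "\<phi> \<in> test_fun U \<Longrightarrow> x \<notin> U \<Longrightarrow> \<phi> x = 0"
  unfolding test_fun_def using not_in_supp by blast

lemma bounded_compact_support:
  assumes "continuous_on UNIV (f :: real^'n::finite \<Rightarrow> real)" "compact (supp f)"
  obtains B where "0 < B" "\<And>x. \<bar>f x\<bar> \<le> B"
proof -
  have "bounded (f ` supp f)"
    using assms by (meson compact_continuous_image compact_imp_bounded continuous_on_subset subset_UNIV)
  then obtain B where B: "0 < B" "\<And>x. x \<in> supp f \<Longrightarrow> \<bar>f x\<bar> \<le> B"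
    unfolding bounded_pos by auto
  have "\<bar>f x\<bar> \<le> B" for x using B not_in_supp[of x f] by (cases "x \<in> supp f") auto
  then show ?thesis using that B(1) by blast
qed

lemma test_fun_bounded:
  assumes "\<phi> \<in> test_fun U"
  obtains B where "0 < B" "\<And>x. \<bar>\<phi> x\<bar> \<le> B"
  using bounded_compact_support[OF test_fun_continuous[OF assms]] assms unfolding test_fun_def by blast

lemma integrable_compact_support:
  assumes "continuous_on UNIV (f :: real^'n::finite \<Rightarrow> real)" "compact (supp f)"
  shows "integrable lborel f"
proof -
  have "integrable lborel (\<lambda>x. indicat_real (supp f) x *\<^sub>R f x)"
    using assms by (intro borel_integrable_compact continuous_on_subset[OF assms(1)]) auto
  moreover have "(\<lambda>x. indicat_real (supp f) x *\<^sub>R f x) = f"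
    using not_in_supp[of _ f] by (auto simp: fun_eq_iff indicator_def)
  ultimately show ?thesis by simp
qed

text \<open>
  By translation invariance the difference quotients of \<open>f\<close> in direction
  \<open>i\<close> all have integral \<open>0\<close>; dominated convergence passes to the
  derivative.
\<close>

lemma integral_pdiff_zero:
  fixes f :: "real^'n::finite \<Rightarrow> real"
  assumes diff: "\<And>x. f differentiable (at x)" and cont: "continuous_on UNIV (pdiff i f)"
    and supp: "compact (supp f)"
  shows "(LINT x|lborel. pdiff i f x) = 0"
proof -
  define h where "h = (\<lambda>n. 1 / real (Suc n))"
  define g where "g = (\<lambda>n x. (f (h n *\<^sub>R axis i 1 + x) - f x) / h n)"
  have h: "0 < h n" "h n \<le> 1" for n by (auto simp: h_def)
  have fcont: "continuous_on UNIV f"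
    using diff by (simp add: differentiable_on_def differentiable_imp_continuous_on)
  have fint: "integrable lborel f" using integrable_compact_support[OF fcont supp] .
  have trans: "integrable lborel (\<lambda>x. f (c + x))" "(LINT x|lborel. f (c + x)) = (LINT x|lborel. f x)" for c
  proof -
    have m: "(+) c \<in> lborel \<rightarrow>\<^sub>M borel" "f \<in> borel_measurable borel"
      using fcont by (auto intro: borel_measurable_continuous_onI)
    show "integrable lborel (\<lambda>x. f (c + x))"
      using integrable_distr_eq[OF m] fint by (simp add: lborel_distr_plus)
    show "(LINT x|lborel. f (c + x)) = (LINT x|lborel. f x)"
      using integral_distr[OF m] by (simp add: lborel_distr_plus)
  qed
  have g0: "(LINT x|lborel. g n x) = 0" for n
    unfolding g_def using trans fint by (simp add: Bochner_Integration.integral_diff)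
  have "bounded (supp f)" using supp compact_imp_bounded by blast
  then obtain R where R: "\<And>x. x \<in> supp f \<Longrightarrow> norm x \<le> R" unfolding bounded_iff by blast
  have "compact (supp (pdiff i f))"
    using supp_pdiff[of i f] compact_Int_closed[OF supp closed_supp[of "pdiff i f"]] by (simp add: inf.absorb2)
  from bounded_compact_support[OF cont this] obtain B where B: "0 < B" "\<And>x. \<bar>pdiff i f x\<bar> \<le> B" by metis
  have line: "((\<lambda>t. f (x + t *\<^sub>R axis i 1)) has_real_derivative pdiff i f (x + s *\<^sub>R axis i 1)) (at s)" for s x
    by (intro has_real_derivative_along_axis diff)
  \<comment> \<open>The steps are at most \<open>1\<close>, so the difference quotients vanish outside the ball of radius \<open>R + 1\<close>.\<close>
  have gbd: "norm (g n x) \<le> B * indicat_real (cball 0 (R + 1)) x" for n x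
  proof -
    obtain s where s: "0 < s" "s < h n"
      "f (x + h n *\<^sub>R axis i 1) - f (x + 0 *\<^sub>R axis i 1) = (h n - 0) * pdiff i f (x + s *\<^sub>R axis i 1)"
      using MVT2[OF h(1)[of n] line[of x]] by metis
    then have gs: "g n x = pdiff i f (x + s *\<^sub>R axis i 1)"
      unfolding g_def using h(1)[of n] by (simp add: add.commute field_simps)
    show ?thesis
    proof (cases "norm x \<le> R + 1")
      case True
      then show ?thesis using B gs by simp
    next
      case False
      have "norm x \<le> norm (x + s *\<^sub>R axis i 1) + norm (s *\<^sub>R axis i (1::real))"
        using norm_triangle_ineq4[of "x + s *\<^sub>R axis i 1" "s *\<^sub>R axis i (1::real)"] by simp
      then have "R < norm (x + s *\<^sub>R axis i 1)" using False s h(2)[of n] by simp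
      then have "x + s *\<^sub>R axis i 1 \<notin> supp f" using R by force
      then show ?thesis using B(1) gs by (simp add: pdiff_outside_supp)
    qed
  qed
  have glim: "(\<lambda>n. g n x) \<longlonglongrightarrow> pdiff i f x" for x
  proof -
    have "((\<lambda>k. (f (x + (0 + k) *\<^sub>R axis i 1) - f (x + 0 *\<^sub>R axis i 1)) / k) \<longlongrightarrow> pdiff i f (x + 0 *\<^sub>R axis i 1)) (at 0)"
      using line[of x 0] unfolding DERIV_def .
    then have "((\<lambda>k. (f (k *\<^sub>R axis i 1 + x) - f x) / k) \<longlongrightarrow> pdiff i f x) (at 0)"
      by (simp add: add.commute)
    moreover have "filterlim h (at 0) sequentially"
      unfolding h_def filterlim_at using LIMSEQ_Suc[OF lim_1_over_n[where 'a = real]] by auto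
    ultimately show ?thesis unfolding g_def by (rule filterlim_compose)
  qed
  have "(\<lambda>n. LINT x|lborel. g n x) \<longlonglongrightarrow> (LINT x|lborel. pdiff i f x)"
  proof (rule integral_dominated_convergence[where w = "\<lambda>x. B * indicat_real (cball 0 (R + 1)) x"])
    show "pdiff i f \<in> borel_measurable lborel"
      using cont by (simp add: borel_measurable_continuous_onI)
    have "g n \<in> borel_measurable borel" for n
      unfolding g_def using fcont h(1)[of n]
      by (intro borel_measurable_continuous_onI continuous_intros continuous_on_compose2[OF fcont]) auto
    then show "g n \<in> borel_measurable lborel" for n by simp
    have "integrable lborel (\<lambda>x. indicat_real (cball 0 (R + 1)) x *\<^sub>R B)"
      by (intro borel_integrable_compact) auto
    then show "integrable lborel (\<lambda>x. B * indicat_real (cball 0 (R + 1)) x)" by (simp add: mult.commute)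
  qed (use glim gbd in auto)
  then show ?thesis unfolding g0 using LIMSEQ_unique tendsto_const by blast
qed

lemma integral_by_parts_pdiff:
  fixes \<phi> \<psi> :: "real^'n::finite \<Rightarrow> real"
  assumes \<phi>: "\<phi> \<in> test_fun U" and \<psi>: "\<psi> \<in> test_fun V"
  shows "(LINT x|lborel. pdiff i \<phi> x * \<psi> x) = - (LINT x|lborel. \<phi> x * pdiff i \<psi> x)"
proof -
  have s: "smooth_fun_on UNIV \<phi>" "smooth_fun_on UNIV \<psi>" "compact (supp \<phi>)"
    using assms by (auto simp: test_fun_def)
  note c = s(1)[THEN smooth_imp_continuous] s(2)[THEN smooth_imp_continuous]
    s(1)[THEN smooth_pdiff, THEN smooth_imp_continuous] s(2)[THEN smooth_pdiff, THEN smooth_imp_continuous]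
  have p: "pdiff i (\<lambda>x. \<phi> x * \<psi> x) = (\<lambda>x. pdiff i \<phi> x * \<psi> x + \<phi> x * pdiff i \<psi> x)"
  proof
    fix x
    have "(\<phi> has_derivative frechet_derivative \<phi> (at x)) (at x)"
      "(\<psi> has_derivative frechet_derivative \<psi> (at x)) (at x)"
      using s by (auto intro!: smooth_imp_differentiable simp: frechet_derivative_works[symmetric])
    from pdiff_eqI[OF has_derivative_mult[OF this]]
    show "pdiff i (\<lambda>x. \<phi> x * \<psi> x) x = pdiff i \<phi> x * \<psi> x + \<phi> x * pdiff i \<psi> x"
      by (simp add: pdiff_def)
  qed
  have sub: "compact (supp f)" if "\<And>x. x \<notin> supp \<phi> \<Longrightarrow> f x = 0" for f
    using supp_minimal[OF closed_supp[of \<phi>] that] compact_Int_closed[OF s(3) closed_supp[of f]]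
    by (simp add: inf.absorb2)
  have int: "integrable lborel (\<lambda>x. pdiff i \<phi> x * \<psi> x)" "integrable lborel (\<lambda>x. \<phi> x * pdiff i \<psi> x)"
    by (intro integrable_compact_support continuous_intros c sub; simp add: not_in_supp pdiff_outside_supp)+
  have "(LINT x|lborel. pdiff i (\<lambda>x. \<phi> x * \<psi> x) x) = 0"
  proof (rule integral_pdiff_zero)
    show "(\<lambda>x. \<phi> x * \<psi> x) differentiable at x" for x
      using s by (intro differentiable_mult smooth_imp_differentiable)
    show "continuous_on UNIV (pdiff i (\<lambda>x. \<phi> x * \<psi> x))" unfolding p by (intro continuous_intros c)
    show "compact (supp (\<lambda>x. \<phi> x * \<psi> x))" by (intro sub) (simp add: not_in_supp)
  qed
  then show ?thesis unfolding p using int by simp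
qed

lemma integral_by_parts_foldr:
  assumes "\<phi> \<in> test_fun U" and "\<psi> \<in> test_fun V"
  shows "(LINT x|lborel. foldr pdiff js \<phi> x * \<psi> x)
    = (-1) ^ length js * (LINT x|lborel. \<phi> x * foldr pdiff js \<psi> x)"
  using assms
proof (induction js arbitrary: \<psi>)
  case (Cons j js)
  have "(LINT x|lborel. foldr pdiff (j # js) \<phi> x * \<psi> x)
      = - (LINT x|lborel. foldr pdiff js \<phi> x * pdiff j \<psi> x)"
    using integral_by_parts_pdiff[OF test_fun_foldr_pdiff[OF Cons.prems(1)] Cons.prems(2)] by simp
  also have "\<dots> = - ((-1) ^ length js * (LINT x|lborel. \<phi> x * foldr pdiff js (pdiff j \<psi>) x))"
    using Cons.IH[OF Cons.prems(1) test_fun_foldr_pdiff[OF Cons.prems(2), of "[j]"]] by simp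
  also have "foldr pdiff js (pdiff j \<psi>) = pdiff j (foldr pdiff js \<psi>)"
    using Cons.prems(2) by (intro foldr_pdiff_commute) (simp add: test_fun_def)
  finally show ?case by simp
qed simp

lemma multi_index_list_exists: "\<exists>js. \<forall>i. count_list js i = (\<alpha> :: 'n::finite multi_index) i"
proof -
  obtain xs :: "'n list" where xs: "set xs = UNIV" "distinct xs" using finite_distinct_list[of "UNIV :: 'n set"] by auto
  have rep: "count_list (replicate n j) i = (if i = j then n else 0)" for n and i j :: 'n
    by (induction n) auto
  have "count_list (concat (map (\<lambda>j. replicate (\<alpha> j) j) ys)) i = (if i \<in> set ys then \<alpha> i else 0)"
    if "distinct ys" for ys i
    using that by (induction ys) (auto simp: rep)
  then show ?thesis using xs by (metis UNIV_I)
qed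

lemma mdiff_list:
  obtains js where "length js = mi_deg \<alpha>" "mdiff \<alpha> = foldr pdiff js"
proof -
  define js where "js = (SOME js. \<forall>i. count_list js i = \<alpha> i)"
  have "\<forall>i. count_list js i = \<alpha> i" unfolding js_def by (rule someI_ex[OF multi_index_list_exists])
  then have "length js = mi_deg \<alpha>"
    using sum_count_set[of js UNIV] by (simp add: mi_deg_def)
  then show ?thesis using that unfolding mdiff_def js_def by blast
qed

lemma mdiff_zero: "mdiff (\<lambda>_. 0) f = f"
proof -
  obtain js :: "'a list" where "length js = mi_deg (\<lambda>_::'a. 0)" "mdiff (\<lambda>_. 0) = foldr pdiff js"
    by (rule mdiff_list)
  then show ?thesis by (simp add: mi_deg_def)
qed

lemma integral_by_parts:
  assumes "\<phi> \<in> test_fun U" and "\<psi> \<in> test_fun V"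
  shows "(LINT x|lborel. mdiff \<alpha> \<phi> x * \<psi> x) = (-1) ^ mi_deg \<alpha> * (LINT x|lborel. \<phi> x * mdiff \<alpha> \<psi> x)"
proof -
  obtain js where "length js = mi_deg \<alpha>" "mdiff \<alpha> = foldr pdiff js" by (rule mdiff_list)
  then show ?thesis using integral_by_parts_foldr[OF assms, of js] by simp
qed

lemma finite_multi_indices: "finite {\<alpha> :: 'n::finite multi_index. mi_deg \<alpha> \<le> k}"
proof (rule finite_subset)
  show "{\<alpha> :: 'n multi_index. mi_deg \<alpha> \<le> k} \<subseteq> PiE UNIV (\<lambda>_. {..k})"
  proof
    fix \<alpha> :: "'n multi_index" assume "\<alpha> \<in> {\<alpha>. mi_deg \<alpha> \<le> k}"
    moreover have "\<alpha> i \<le> mi_deg \<alpha>" for i unfolding mi_deg_def by (intro member_le_sum) auto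
    ultimately show "\<alpha> \<in> PiE UNIV (\<lambda>_. {..k})" by (auto intro: order_trans)
  qed
qed (intro finite_PiE, auto)


section \<open>Bump functions and the fundamental lemma\<close>

text \<open>
  The factor \<open>(1/t)\<^sup>k\<close> keeps the family of these flat functions closed, up to
  linear combinations, under differentiation.
\<close>

definition flat_exp :: "nat \<Rightarrow> real \<Rightarrow> real" where
  "flat_exp k t = (if 0 < t then (1 / t) ^ k * exp (- (1 / t)) else 0)"

text \<open>
  This is differentiability at \<open>t = 0\<close>, where the two branches of the definition
  meet.
\<close>

lemma flat_exp_over_tendsto_0: "((\<lambda>t. flat_exp k t / t) \<longlongrightarrow> 0) (at 0)"
proof -
  have "((\<lambda>y::real. y ^ Suc k / exp y) \<longlongrightarrow> 0) at_top" by (rule tendsto_power_div_exp_0)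
  from filterlim_compose[OF this filterlim_inverse_at_top_right]
  have "((\<lambda>t::real. inverse t ^ Suc k / exp (inverse t)) \<longlongrightarrow> 0) (at_right 0)" .
  then have "((\<lambda>t. flat_exp k t / t) \<longlongrightarrow> 0) (at_right 0)"
    by (rule Lim_transform_eventually)
      (auto simp: flat_exp_def eventually_at_filter exp_minus field_simps)
  moreover have "((\<lambda>t. flat_exp k t / t) \<longlongrightarrow> 0) (at_left 0)"
    by (rule Lim_transform_eventually[OF tendsto_const]) (auto simp: flat_exp_def eventually_at_filter)
  ultimately show ?thesis by (simp add: filterlim_split_at)
qed

lemma flat_exp_derivative:
  "(flat_exp k has_real_derivative flat_exp (k + 2) t - real k * flat_exp (k + 1) t) (at t)"
proof -
  consider "0 < t" | "t = 0" | "t < 0" by linarith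
  then show ?thesis
  proof cases
    case 1
    have inv: "((\<lambda>t. 1 / t) has_real_derivative - ((1 / t) * (1 / t))) (at t)"
      using 1 by (auto intro!: derivative_eq_intros simp: field_simps)
    have pow: "((\<lambda>t. (1 / t) ^ k) has_real_derivative - (real k * (1 / t) ^ (k + 1))) (at t)"
    proof (induction k)
      case (Suc k)
      have "((\<lambda>t. (1 / t) * (1 / t) ^ k) has_real_derivative
          - ((1 / t) * (1 / t)) * (1 / t) ^ k + - (real k * (1 / t) ^ (k + 1)) * (1 / t)) (at t)"
        by (rule DERIV_mult[OF inv Suc])
      then show ?case by (simp add: algebra_simps add_divide_distrib)
    qed simp
    have "((\<lambda>t. (1 / t) ^ k * exp (- (1 / t))) has_real_derivative
        flat_exp (k + 2) t - real k * flat_exp (k + 1) t) (at t)"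
      by (rule derivative_eq_intros pow inv refl)+
        (use 1 in \<open>simp add: flat_exp_def algebra_simps\<close>)
    then show ?thesis
      by (rule has_field_derivative_transform_within_open[of _ _ _ "{0<..}"]) (use 1 in \<open>auto simp: flat_exp_def\<close>)
  next
    case 2
    then show ?thesis using flat_exp_over_tendsto_0[of k] by (simp add: DERIV_def flat_exp_def)
  next
    case 3
    have "((\<lambda>_. 0) has_real_derivative flat_exp (k + 2) t - real k * flat_exp (k + 1) t) (at t)"
      using 3 by (simp add: flat_exp_def)
    then show ?thesis
      by (rule has_field_derivative_transform_within_open[of _ _ _ "{..<0}"]) (use 3 in \<open>auto simp: flat_exp_def\<close>)
  qed
qed

text \<open>
  An algebra of functions that is stable under partial derivatives and contains enough functions
  with compact support.
\<close>

inductive_set flat_algebra :: "(real^'n::finite \<Rightarrow> real) set" where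
  const: "(\<lambda>_. c) \<in> flat_algebra"
| flat: "(\<lambda>x. flat_exp k (a * x $ i + b)) \<in> flat_algebra"
| add: "f \<in> flat_algebra \<Longrightarrow> g \<in> flat_algebra \<Longrightarrow> (\<lambda>x. f x + g x) \<in> flat_algebra"
| mult: "f \<in> flat_algebra \<Longrightarrow> g \<in> flat_algebra \<Longrightarrow> (\<lambda>x. f x * g x) \<in> flat_algebra"

lemma flat_algebra_derivative:
  fixes f :: "real^'n::finite \<Rightarrow> real"
  assumes "f \<in> flat_algebra"
  shows "\<exists>f'. (\<forall>x. (f has_derivative f' x) (at x)) \<and> (\<forall>v. (\<lambda>x. f' x v) \<in> flat_algebra)"
  using assms
proof induction
  case (const c)
  show ?case by (rule exI[of _ "\<lambda>x v. 0"]) (auto intro: flat_algebra.const)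
next
  case (flat k a i b)
  let ?g = "\<lambda>x. flat_exp (k + 2) (a * x $ i + b) + (- real k) * flat_exp (k + 1) (a * x $ i + b)"
  have "((\<lambda>x. flat_exp k (a * x $ i + b)) has_derivative (\<lambda>v. ?g x * (a * v $ i))) (at x)" for x :: "real^'n"
  proof -
    have lin: "((\<lambda>x. a * x $ i + b) has_derivative (\<lambda>v. a * v $ i)) (at x)"
      by (auto intro!: derivative_eq_intros bounded_linear.has_derivative[OF bounded_linear_vec_nth])
    have "(flat_exp k has_derivative (*) (?g x)) (at (a * x $ i + b))"
      using flat_exp_derivative[of k "a * x $ i + b"] unfolding has_field_derivative_def by simp
    from has_derivative_compose[OF lin this] show ?thesis .
  qed
  moreover have "(\<lambda>x. ?g x * (a * v $ i)) \<in> flat_algebra" for v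
    by (intro flat_algebra.intros)
  ultimately show ?case by (intro exI[of _ "\<lambda>x v. ?g x * (a * v $ i)"]) auto
next
  case (add f g)
  then obtain f' g' where "\<And>x. (f has_derivative f' x) (at x)" "\<And>v. (\<lambda>x. f' x v) \<in> flat_algebra"
    "\<And>x. (g has_derivative g' x) (at x)" "\<And>v. (\<lambda>x. g' x v) \<in> flat_algebra" by blast
  then show ?case
    by (intro exI[of _ "\<lambda>x v. f' x v + g' x v"]) (auto intro!: has_derivative_add flat_algebra.intros)
next
  case (mult f g)
  then obtain f' g' where "\<And>x. (f has_derivative f' x) (at x)" "\<And>v. (\<lambda>x. f' x v) \<in> flat_algebra"
    "\<And>x. (g has_derivative g' x) (at x)" "\<And>v. (\<lambda>x. g' x v) \<in> flat_algebra" by blast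
  then show ?case using mult.hyps
    by (intro exI[of _ "\<lambda>x v. f x * g' x v + f' x v * g x"]) (auto intro!: has_derivative_mult flat_algebra.intros)
qed

lemma flat_algebra_smooth: "f \<in> flat_algebra \<Longrightarrow> smooth_fun_on UNIV f"
proof (rule smooth_if_pdiff_closed[of f flat_algebra])
  fix g :: "real^'n \<Rightarrow> real" and i assume "g \<in> flat_algebra"
  then obtain g' where g': "\<And>x. (g has_derivative g' x) (at x)" "\<And>v. (\<lambda>x. g' x v) \<in> flat_algebra"
    using flat_algebra_derivative by blast
  show "g differentiable_on UNIV" using g'(1) by (auto simp: differentiable_on_def differentiable_def)
  have "pdiff i g = (\<lambda>x. g' x (axis i 1))" using pdiff_eqI[OF g'(1)] by blast
  then show "pdiff i g \<in> flat_algebra" using g'(2) by simp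
qed

lemma flat_algebra_prod:
  "finite I \<Longrightarrow> (\<And>i. i \<in> I \<Longrightarrow> f i \<in> flat_algebra) \<Longrightarrow> (\<lambda>x. \<Prod>i\<in>I. f i x) \<in> flat_algebra"
  by (induction I rule: finite_induct) (auto intro: flat_algebra.intros)

text \<open>
  For large \<open>n\<close> this is close to \<open>1\<close> inside the box; the summand
  \<open>-1\<close> makes the support a compact subset of the open box.
\<close>

definition box_bump :: "real^'n \<Rightarrow> real^'n \<Rightarrow> nat \<Rightarrow> real^'n::finite \<Rightarrow> real" where
  "box_bump a b n x = (\<Prod>i\<in>UNIV. flat_exp 0 (real (Suc n) * (x $ i - a $ i) - 1) *
     flat_exp 0 (real (Suc n) * (b $ i - x $ i) - 1))"

lemma flat_exp_0_bounds: "0 \<le> flat_exp 0 t" "flat_exp 0 t \<le> 1"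
  by (auto simp: flat_exp_def)

lemma box_bump_bounds: "0 \<le> box_bump a b n x" "box_bump a b n x \<le> 1"
  unfolding box_bump_def
  by (auto intro!: prod_nonneg prod_le_1 mult_nonneg_nonneg mult_le_one flat_exp_0_bounds)

lemma box_bump_flat_algebra: "box_bump a b n \<in> flat_algebra"
proof -
  have "(\<lambda>x. \<Prod>i\<in>UNIV. flat_exp 0 (real (Suc n) * x $ i + (- real (Suc n) * a $ i - 1)) *
     flat_exp 0 ((- real (Suc n)) * x $ i + (real (Suc n) * b $ i - 1))) \<in> flat_algebra"
    by (intro flat_algebra_prod flat_algebra.intros) auto
  moreover have "box_bump a b n = (\<lambda>x. \<Prod>i\<in>UNIV. flat_exp 0 (real (Suc n) * x $ i + (- real (Suc n) * a $ i - 1)) *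
     flat_exp 0 ((- real (Suc n)) * x $ i + (real (Suc n) * b $ i - 1)))"
    unfolding box_bump_def by (intro ext prod.cong refl arg_cong2[of _ _ _ _ "(*)"] arg_cong[of _ _ "flat_exp 0"])
      (simp_all add: algebra_simps)
  ultimately show ?thesis by simp
qed

lemma box_bump_support:
  fixes a b :: "real^'n::finite"
  assumes "box_bump a b n x \<noteq> 0"
  shows "x \<in> cbox (\<chi> i. a $ i + 1 / real (Suc n)) (\<chi> i. b $ i - 1 / real (Suc n))"
proof -
  have "0 < real (Suc n) * (x $ i - a $ i) - 1 \<and> 0 < real (Suc n) * (b $ i - x $ i) - 1" for i
    using assms unfolding box_bump_def by (auto simp: prod_zero_iff flat_exp_def split: if_splits)
  then show ?thesis by (auto simp: mem_box_cart field_simps less_imp_le)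
qed

lemma box_bump_support_subset:
  fixes a b :: "real^'n::finite"
  shows "cbox (\<chi> i. a $ i + 1 / real (Suc n)) (\<chi> i. b $ i - 1 / real (Suc n)) \<subseteq> box a b"
proof
  fix x assume x: "x \<in> cbox (\<chi> i. a $ i + 1 / real (Suc n)) (\<chi> i. b $ i - 1 / real (Suc n))"
  have "a $ i < x $ i \<and> x $ i < b $ i" for i
  proof -
    have "0 < 1 / real (Suc n)" by simp
    moreover have "a $ i + 1 / real (Suc n) \<le> x $ i" "x $ i \<le> b $ i - 1 / real (Suc n)"
      using x by (auto simp: mem_box_cart)
    ultimately show ?thesis by linarith
  qed
  then show "x \<in> box a b" by (simp add: mem_box_cart)
qed

lemma flat_exp_0_tendsto_1:
  assumes "0 < c"
  shows "(\<lambda>n. flat_exp 0 (real (Suc n) * c - 1)) \<longlonglongrightarrow> 1"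
proof -
  have "filterlim (\<lambda>n. real (Suc n)) at_top sequentially"
    using filterlim_compose[OF filterlim_real_sequentially filterlim_Suc] .
  from filterlim_tendsto_pos_mult_at_top[OF tendsto_const assms this]
  have "filterlim (\<lambda>n. - 1 + c * real (Suc n)) at_top sequentially"
    by (intro filterlim_tendsto_add_at_top[OF tendsto_const])
  then have lim: "filterlim (\<lambda>n. real (Suc n) * c - 1) at_top sequentially"
    by (simp add: mult.commute)
  from tendsto_exp[OF tendsto_minus[OF tendsto_inverse_0_at_top[OF this]]]
  have "(\<lambda>n. exp (- (1 / (real (Suc n) * c - 1)))) \<longlonglongrightarrow> 1"
    by (simp add: inverse_eq_divide)
  moreover have "eventually (\<lambda>n. exp (- (1 / (real (Suc n) * c - 1))) = flat_exp 0 (real (Suc n) * c - 1)) sequentially"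
    using filterlim_at_top_dense[THEN iffD1, OF lim, rule_format, of 0]
    by eventually_elim (simp add: flat_exp_def)
  ultimately show ?thesis by (rule Lim_transform_eventually)
qed

lemma box_bump_tendsto:
  assumes "x \<in> box a b"
  shows "(\<lambda>n. box_bump a b n x) \<longlonglongrightarrow> 1"
proof -
  have "(\<lambda>n. \<Prod>i\<in>UNIV. flat_exp 0 (real (Suc n) * (x $ i - a $ i) - 1) *
     flat_exp 0 (real (Suc n) * (b $ i - x $ i) - 1)) \<longlonglongrightarrow> (\<Prod>i\<in>(UNIV :: 'a set). 1 * 1)"
    using assms by (intro tendsto_prod tendsto_mult flat_exp_0_tendsto_1) (auto simp: mem_box_cart)
  then show ?thesis unfolding box_bump_def by simp
qed

text \<open>
  An open set is a countable union of open boxes. The functions \<open>1 -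
  \<Prod>\<^sub>i\<^sub><\<^sub>n (1 - \<psi>\<^sub>i)\<close> built from box bumps
  \<open>\<psi>\<^sub>i\<close> form a smooth substitute for the indicators of the unions of the
  first \<open>n\<close> boxes.
\<close>

lemma indicator_open_approx:
  fixes U :: "(real^'n::finite) set"
  assumes "open U"
  obtains \<Phi> :: "nat \<Rightarrow> real^'n \<Rightarrow> real" where "\<And>n. \<Phi> n \<in> test_fun U"
    "\<And>n x. 0 \<le> \<Phi> n x" "\<And>n x. \<Phi> n x \<le> 1" "\<And>x. (\<lambda>n. \<Phi> n x) \<longlonglongrightarrow> indicator U x"
proof -
  obtain \<D> where \<D>: "countable \<D>" "\<D> \<subseteq> Pow U" "\<And>X. X \<in> \<D> \<Longrightarrow> \<exists>a b. X = box a b" "\<Union>\<D> = U"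
    using open_countable_Union_open_box[OF assms] by metis
  define \<D>' where "\<D>' = insert {} \<D>"
  have \<D>': "countable \<D>'" "\<D>' \<noteq> {}" "\<Union>\<D>' = U" using \<D> by (auto simp: \<D>'_def)
  have bx: "\<exists>a b. X = box a b" if "X \<in> \<D>'" for X
  proof (cases "X = {}")
    case True
    then have "X = box 0 0" by simp
    then show ?thesis by blast
  qed (use that \<D> in \<open>auto simp: \<D>'_def\<close>)
  have "\<exists>a b. from_nat_into \<D>' i = box a b" for i
    using bx from_nat_into[OF \<D>'(2)] by blast
  then obtain a b where ab: "\<And>i. from_nat_into \<D>' i = box (a i) (b i)" by metis
  have U: "U = (\<Union>i. box (a i) (b i))"
    using range_from_nat_into[OF \<D>'(2,1)] \<D>'(3) unfolding ab[symmetric] by auto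
  define \<Phi> where "\<Phi> = (\<lambda>n x. 1 - (\<Prod>i<n. 1 - box_bump (a i) (b i) n x))"
  have fac: "0 \<le> 1 - box_bump (a i) (b i) n x" "1 - box_bump (a i) (b i) n x \<le> 1" for i n x
    using box_bump_bounds by auto
  have prod: "0 \<le> (\<Prod>i<n. 1 - box_bump (a i) (b i) n x)" "(\<Prod>i<n. 1 - box_bump (a i) (b i) n x) \<le> 1" for n x
    using fac by (auto intro!: prod_nonneg prod_le_1)
  show ?thesis
  proof
    show "0 \<le> \<Phi> n x" "\<Phi> n x \<le> 1" for n x using prod unfolding \<Phi>_def by auto
    show "\<Phi> n \<in> test_fun U" for n
    proof (rule test_funI)
      have "(\<lambda>x. 1 + (-1) * (\<Prod>i<n. 1 + (-1) * box_bump (a i) (b i) n x)) \<in> flat_algebra"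
        by (intro flat_algebra.add flat_algebra.mult flat_algebra.const flat_algebra_prod box_bump_flat_algebra) auto
      then show "smooth_fun_on UNIV (\<Phi> n)" using flat_algebra_smooth unfolding \<Phi>_def by auto
      let ?K = "\<Union>i<n. cbox (\<chi> j. a i $ j + 1 / real (Suc n)) (\<chi> j. b i $ j - 1 / real (Suc n))"
      show "compact ?K" by (intro compact_UN) auto
      show "?K \<subseteq> U" unfolding U using box_bump_support_subset by blast
      show "\<Phi> n x = 0" if "x \<notin> ?K" for x
      proof -
        have "box_bump (a i) (b i) n x = 0" if "i < n" for i
          using \<open>x \<notin> ?K\<close> that box_bump_support[of "a i" "b i" n x] by blast
        then show ?thesis unfolding \<Phi>_def by simp
      qed
    qed
    show "(\<lambda>n. \<Phi> n x) \<longlonglongrightarrow> indicator U x" for x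
    proof (cases "x \<in> U")
      case True
      then obtain j where j: "x \<in> box (a j) (b j)" unfolding U by blast
      have lim: "(\<lambda>n. 1 - box_bump (a j) (b j) n x) \<longlonglongrightarrow> 1 - 1"
        by (intro tendsto_diff tendsto_const box_bump_tendsto j)
      have "(\<lambda>n. \<Prod>i<n. 1 - box_bump (a i) (b i) n x) \<longlonglongrightarrow> 0"
      proof (rule tendsto_sandwich[of "\<lambda>_. 0"])
        show "eventually (\<lambda>n. (\<Prod>i<n. 1 - box_bump (a i) (b i) n x) \<le> 1 - box_bump (a j) (b j) n x) sequentially"
          using eventually_gt_at_top[of j]
        proof eventually_elim
          case (elim n)
          have "(\<Prod>i<n. 1 - box_bump (a i) (b i) n x)
              = (1 - box_bump (a j) (b j) n x) * (\<Prod>i\<in>{..<n} - {j}. 1 - box_bump (a i) (b i) n x)"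
            using elim by (intro prod.remove) auto
          also have "\<dots> \<le> (1 - box_bump (a j) (b j) n x) * 1"
            using fac by (intro mult_left_mono prod_le_1) auto
          finally show ?case by simp
        qed
      qed (use lim prod in auto)
      from tendsto_diff[OF tendsto_const this, of 1] show ?thesis using True unfolding \<Phi>_def by simp
    next
      case False
      have "box_bump (a i) (b i) n x = 0" for i n
        using False box_bump_support[of "a i" "b i" n x] box_bump_support_subset[where a = "a i" and b = "b i" and n = n] unfolding U by blast
      then show ?thesis using False unfolding \<Phi>_def by simp
    qed
  qed
qed

text \<open>
  The integral of \<open>f\<close> vanishes over open sets by approximation of their indicators,
  over countable intersections of open sets by dominated convergence, and hence over all
  measurable sets, in particular over the sets where \<open>f\<close> is positive or negative.
\<close>

lemma AE_zero_if_orthogonal_to_test_fun: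
  fixes f :: "real^'n::finite \<Rightarrow> real"
  assumes D: "open D" and f: "integrable (lebesgue_on D) f"
    and orth: "\<And>\<phi>. \<phi> \<in> test_fun D \<Longrightarrow> (LINT x|lebesgue_on D. f x * \<phi> x) = 0"
  shows "AE x in lebesgue_on D. f x = 0"
proof -
  let ?M = "lebesgue_on D"
  have Dm: "D \<in> sets lebesgue" using D by simp
  have fm: "f \<in> borel_measurable ?M" using f by auto
  have cont: "h \<in> borel_measurable ?M" if "continuous_on UNIV h" for h :: "real^'n \<Rightarrow> real"
    using that by (intro measurable_restrict_space1 measurable_completion) (simp add: borel_measurable_continuous_onI)
  have ind: "indicat_real E \<in> borel_measurable ?M" if "E \<in> sets lebesgue" for E
    using that by (intro measurable_restrict_space1) simp
  have open0: "(LINT x|?M. f x * indicat_real U x) = 0" if U: "open U" for U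
  proof -
    obtain \<Phi> where \<Phi>: "\<And>n. \<Phi> n \<in> test_fun (U \<inter> D)"
      "\<And>n x. 0 \<le> \<Phi> n x" "\<And>n x. \<Phi> n x \<le> 1" "\<And>x. (\<lambda>n. \<Phi> n x) \<longlonglongrightarrow> indicator (U \<inter> D) x"
      by (rule indicator_open_approx[OF open_Int[OF U D]]) blast
    have "(\<lambda>n. LINT x|?M. f x * \<Phi> n x) \<longlonglongrightarrow> (LINT x|?M. f x * indicat_real U x)"
    proof (rule integral_dominated_convergence[where w = "\<lambda>x. \<bar>f x\<bar>"])
      show "(\<lambda>x. f x * indicat_real U x) \<in> borel_measurable ?M"
        using fm ind that by (intro borel_measurable_times) auto
      show "(\<lambda>x. f x * \<Phi> n x) \<in> borel_measurable ?M" for n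
        using fm cont[OF test_fun_continuous[OF \<Phi>(1)]] by (intro borel_measurable_times)
      show "integrable ?M (\<lambda>x. \<bar>f x\<bar>)" using f by simp
      have "(\<lambda>n. f x * \<Phi> n x) \<longlonglongrightarrow> f x * indicat_real U x" if "x \<in> D" for x
        using tendsto_mult[OF tendsto_const \<Phi>(4)[of x], of "f x"] that by (simp add: indicator_def)
      then show "AE x in ?M. (\<lambda>n. f x * \<Phi> n x) \<longlonglongrightarrow> f x * indicat_real U x"
        by (intro AE_I2) (auto simp: space_restrict_space)
      show "AE x in ?M. norm (f x * \<Phi> n x) \<le> \<bar>f x\<bar>" for n
        using \<Phi>(2,3) by (intro AE_I2) (auto simp: abs_mult intro!: mult_left_le)
    qed
    moreover have "(LINT x|?M. f x * \<Phi> n x) = 0" for n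
      using \<Phi>(1)[of n] by (intro orth) (auto simp: test_fun_def)
    ultimately have "(\<lambda>n::nat. 0) \<longlonglongrightarrow> (LINT x|?M. f x * indicat_real U x)" by simp
    then show ?thesis by (simp add: LIMSEQ_const_iff)
  qed
  have gdelta0: "(LINT x|?M. f x * indicat_real C x) = 0" if C: "gdelta C" for C
  proof -
    obtain G :: "nat \<Rightarrow> (real^'n) set" where G: "C = \<Inter>(range G)" "\<And>i. open (G i)"
      using C unfolding gdelta.simps by blast
    define V where "V = (\<lambda>n. \<Inter>i\<in>{..n}. G i)"
    have V: "open (V n)" for n unfolding V_def using G by (intro open_INT) auto
    have "G i \<in> sets lebesgue" for i using G(2)[of i] by simp
    then have Cm: "C \<in> sets lebesgue" unfolding G(1) by (intro sets.countable_INT) auto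
    have "(\<lambda>n. LINT x|?M. f x * indicat_real (V n) x) \<longlonglongrightarrow> (LINT x|?M. f x * indicat_real C x)"
    proof (rule integral_dominated_convergence[where w = "\<lambda>x. \<bar>f x\<bar>"])
      show "(\<lambda>x. f x * indicat_real C x) \<in> borel_measurable ?M" using fm ind Cm by (intro borel_measurable_times) auto
      show "(\<lambda>x. f x * indicat_real (V n) x) \<in> borel_measurable ?M" for n
        using fm ind V[of n] by (intro borel_measurable_times) auto
      show "integrable ?M (\<lambda>x. \<bar>f x\<bar>)" using f by simp
      show "AE x in ?M. norm (f x * indicat_real (V n) x) \<le> \<bar>f x\<bar>" for n
        by (intro AE_I2) (auto simp: indicator_def)
      have "(\<lambda>n. f x * indicat_real (V n) x) \<longlonglongrightarrow> f x * indicat_real C x" for x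
      proof (cases "x \<in> C")
        case True
        then have "\<And>n. x \<in> V n" unfolding V_def G(1) by auto
        then show ?thesis using True by simp
      next
        case False
        then obtain i where "x \<notin> G i" unfolding G(1) by auto
        then have "\<And>n. n \<ge> i \<Longrightarrow> x \<notin> V n" unfolding V_def by auto
        then have "eventually (\<lambda>n. f x * indicat_real C x = f x * indicat_real (V n) x) sequentially"
          using False by (intro eventually_sequentiallyI[of i]) simp
        then show ?thesis by (rule Lim_transform_eventually[OF tendsto_const])
      qed
      then show "AE x in ?M. (\<lambda>n. f x * indicat_real (V n) x) \<longlonglongrightarrow> f x * indicat_real C x" by simp
    qed
    then show ?thesis by (simp add: open0[OF V] LIMSEQ_const_iff)
  qed
  have sets0: "(LINT x|?M. f x * indicat_real E x) = 0" if E: "E \<in> sets lebesgue" for E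
  proof -
    obtain C T where C: "gdelta C" "T \<in> null_sets lebesgue" "E \<union> T = C" "disjnt E T"
      using lebesgue_set_almost_gdelta[OF E] by metis
    have Cm: "C \<in> sets lebesgue" using C E by (auto simp: null_sets_def)
    have "AE x in lebesgue. x \<notin> T" using AE_not_in[OF C(2)] .
    then have "AE x in ?M. x \<notin> T" using Dm by (auto simp: AE_restrict_space_iff)
    then have "AE x in ?M. f x * indicat_real C x = f x * indicat_real E x"
      by eventually_elim (use C(3) in \<open>auto simp: indicator_def\<close>)
    then have "(LINT x|?M. f x * indicat_real C x) = (LINT x|?M. f x * indicat_real E x)"
      using fm ind Cm E by (intro integral_cong_AE borel_measurable_times) auto
    then show ?thesis using gdelta0[OF C(1)] by simp
  qed
  have half: "AE x in ?M. \<not> 0 < c * f x" if "c = 1 \<or> c = -1" for c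
  proof -
    define E where "E = {x \<in> space ?M. 0 < c * f x}"
    note fm [measurable]
    have "E \<in> sets ?M" unfolding E_def by measurable
    then have E: "E \<in> sets lebesgue" using Dm by (auto simp: sets_restrict_space)
    have "integrable ?M (\<lambda>x. f x * indicat_real E x)"
      using \<open>E \<in> sets ?M\<close> by (intro integrable_real_mult_indicator f)
    then have int: "integrable ?M (\<lambda>x. c * (f x * indicat_real E x))" by simp
    have "AE x in ?M. c * (f x * indicat_real E x) = 0"
    proof (subst integral_nonneg_eq_0_iff_AE[symmetric, OF int])
      show "AE x in ?M. 0 \<le> c * (f x * indicat_real E x)"
        by (intro AE_I2) (auto simp: E_def indicator_def)
    qed (simp add: sets0[OF E])
    moreover have "AE x in ?M. x \<in> space ?M" by (rule AE_space)
    ultimately show ?thesis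
      by eventually_elim (use that in \<open>auto simp: E_def indicator_def\<close>)
  qed
  have "AE x in ?M. \<not> 0 < 1 * f x" "AE x in ?M. \<not> 0 < (-1) * f x" using half by blast+
  then show ?thesis by eventually_elim simp
qed


section \<open>Lebesgue spaces on a bounded open set\<close>

locale bounded_open_set =
  fixes D :: "(real^'n::finite) set"
  assumes D_open: "open D" and D_bounded: "bounded D"
begin

abbreviation LD :: "(real^'n) measure" where "LD \<equiv> lebesgue_on D"

lemma D_sets: "D \<in> sets lebesgue" using D_open by simp

lemma finite_measure_LD: "finite_measure LD"
proof (rule finite_measureI)
  have "emeasure lebesgue D < \<infinity>"
    using emeasure_bounded_finite[OF D_bounded] D_open by (simp add: emeasure_completion)
  then show "emeasure LD (space LD) \<noteq> \<infinity>"
    using D_sets by (simp add: emeasure_restrict_space space_restrict_space)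
qed

lemma integrable_const_LD: "integrable LD (\<lambda>_. c :: real)"
  using finite_measure.integrable_const[OF finite_measure_LD] .

lemma continuous_measurable_LD:
  "continuous_on UNIV h \<Longrightarrow> (h :: real^'n \<Rightarrow> real) \<in> borel_measurable LD"
  by (intro measurable_restrict_space1 measurable_completion) (simp add: borel_measurable_continuous_onI)

lemma LINT_LD_test_fun:
  assumes "continuous_on UNIV g" "\<phi> \<in> test_fun D"
  shows "(LINT x|LD. g x * \<phi> x) = (LINT x|lborel. g x * \<phi> x)"
proof -
  have c: "continuous_on UNIV (\<lambda>x. g x * \<phi> x)"
    using assms test_fun_continuous by (intro continuous_intros) auto
  have "(LINT x|LD. g x * \<phi> x) = (LINT x|lebesgue. indicat_real D x *\<^sub>R (g x * \<phi> x))"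
    using D_sets by (intro integral_restrict_space) simp
  also have "(\<lambda>x. indicat_real D x *\<^sub>R (g x * \<phi> x)) = (\<lambda>x. g x * \<phi> x)"
    using test_fun_zero_outside[OF assms(2)] by (auto simp: fun_eq_iff indicator_def)
  also have "(LINT x|lebesgue. g x * \<phi> x) = (LINT x|lborel. g x * \<phi> x)"
    using c by (intro integral_completion) (simp add: borel_measurable_continuous_onI)
  finally show ?thesis .
qed

lemma integrable_mult_test_fun:
  assumes f: "integrable LD f" and \<phi>: "\<phi> \<in> test_fun D"
  shows "integrable LD (\<lambda>x. f x * \<phi> x)"
proof -
  obtain B where B: "0 < B" "\<And>x. \<bar>\<phi> x\<bar> \<le> B" using test_fun_bounded[OF \<phi>] by metis
  show ?thesis
  proof (rule Bochner_Integration.integrable_bound)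
    show "integrable LD (\<lambda>x. B * \<bar>f x\<bar>)" using f by simp
    show "(\<lambda>x. f x * \<phi> x) \<in> borel_measurable LD"
      using f continuous_measurable_LD[OF test_fun_continuous[OF \<phi>]] by (intro borel_measurable_times) auto
    show "AE x in LD. norm (f x * \<phi> x) \<le> norm (B * \<bar>f x\<bar>)"
      using B by (intro AE_I2) (auto simp: abs_mult mult.commute[of B] intro!: mult_left_mono)
  qed
qed

end

locale Lp_setting = bounded_open_set D for D :: "(real^'n::finite) set" +
  fixes p :: real
  assumes p: "1 < p"
begin

lemma Lp_fun_measurable: "f \<in> Lp_fun D p \<Longrightarrow> f \<in> borel_measurable LD"
  unfolding Lp_fun_def by simp

lemma Lp_fun_integrable_powr: "f \<in> Lp_fun D p \<Longrightarrow> integrable LD (\<lambda>x. \<bar>f x\<bar> powr p)"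
  unfolding Lp_fun_def by simp

lemma Lp_fun_integrable:
  assumes "f \<in> Lp_fun D p"
  shows "integrable LD f"
proof (rule Bochner_Integration.integrable_bound)
  show "integrable LD (\<lambda>x. 1 + \<bar>f x\<bar> powr p)"
    using Lp_fun_integrable_powr[OF assms] integrable_const_LD by simp
  show "AE x in LD. norm (f x) \<le> norm (1 + \<bar>f x\<bar> powr p)"
    using abs_le_powr_split[OF p, of 1] by (intro AE_I2) (simp add: add_nonneg_nonneg)
qed (rule Lp_fun_measurable[OF assms])

lemma Lp_fun_lin:
  assumes f: "f \<in> Lp_fun D p" and g: "g \<in> Lp_fun D p"
  shows "(\<lambda>x. a * f x + b * g x) \<in> Lp_fun D p"
proof -
  note m = f[THEN Lp_fun_measurable] g[THEN Lp_fun_measurable]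
  note [measurable] = m
  have meas: "(\<lambda>x. a * f x + b * g x) \<in> borel_measurable LD" by measurable
  have "integrable LD (\<lambda>x. \<bar>a * f x + b * g x\<bar> powr p)"
  proof (rule Bochner_Integration.integrable_bound)
    show "integrable LD (\<lambda>x. (\<bar>2 * a\<bar> powr p * \<bar>f x\<bar> powr p + \<bar>2 * b\<bar> powr p * \<bar>g x\<bar> powr p) / 2)"
      using f g Lp_fun_integrable_powr by simp
    show "(\<lambda>x. \<bar>a * f x + b * g x\<bar> powr p) \<in> borel_measurable LD" by measurable
    have "\<bar>a * f x + b * g x\<bar> powr p \<le> (\<bar>2 * a\<bar> powr p * \<bar>f x\<bar> powr p + \<bar>2 * b\<bar> powr p * \<bar>g x\<bar> powr p) / 2" for x
      using powr_convex[OF p, of "1/2" "2 * a * f x" "2 * b * g x"]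
      unfolding powr_abs_mult[of "2 * a" "f x"] powr_abs_mult[of "2 * b" "g x"] by simp
    then show "AE x in LD. norm (\<bar>a * f x + b * g x\<bar> powr p)
        \<le> norm ((\<bar>2 * a\<bar> powr p * \<bar>f x\<bar> powr p + \<bar>2 * b\<bar> powr p * \<bar>g x\<bar> powr p) / 2)"
      by (intro AE_I2) simp
  qed
  then show ?thesis using meas unfolding Lp_fun_def by simp
qed

lemma bounded_continuous_Lp_fun:
  assumes "continuous_on UNIV (f :: real^'n \<Rightarrow> real)" "\<And>x. \<bar>f x\<bar> \<le> B"
  shows "f \<in> Lp_fun D p"
proof -
  note [measurable] = continuous_measurable_LD[OF assms(1)]
  have "integrable LD (\<lambda>x. \<bar>f x\<bar> powr p)"
  proof (rule Bochner_Integration.integrable_bound[OF integrable_const_LD[of "B powr p"]])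
    show "AE x in LD. norm (\<bar>f x\<bar> powr p) \<le> norm (B powr p)"
      using assms(2) p by (intro AE_I2) (simp add: powr_mono2)
  qed measurable
  then show ?thesis unfolding Lp_fun_def by simp
qed

lemma test_fun_Lp_fun: "\<phi> \<in> test_fun D \<Longrightarrow> \<phi> \<in> Lp_fun D p"
  by (metis bounded_continuous_Lp_fun test_fun_bounded test_fun_continuous)

lemma distr_of_fun_lin:
  assumes f: "f \<in> Lp_fun D p" and g: "g \<in> Lp_fun D p"
  shows "distr_of_fun D (\<lambda>x. a * f x + b * g x)
    = (\<lambda>\<phi>. a * distr_of_fun D f \<phi> + b * distr_of_fun D g \<phi>)"
proof
  fix \<phi>
  show "distr_of_fun D (\<lambda>x. a * f x + b * g x) \<phi> = a * distr_of_fun D f \<phi> + b * distr_of_fun D g \<phi>"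
  proof (cases "\<phi> \<in> test_fun D")
    case True
    have "integrable LD (\<lambda>x. a * (f x * \<phi> x))" "integrable LD (\<lambda>x. b * (g x * \<phi> x))"
      using integrable_mult_test_fun[OF Lp_fun_integrable True] f g by auto
    from Bochner_Integration.integral_add[OF this]
    have "(LINT x|LD. (a * f x + b * g x) * \<phi> x) = (LINT x|LD. a * (f x * \<phi> x)) + (LINT x|LD. b * (g x * \<phi> x))"
      by (simp add: algebra_simps)
    then show ?thesis using True by (simp add: distr_of_fun_def)
  qed (simp add: distr_of_fun_def)
qed

text \<open>
  This makes the Lebesgue norm of a distribution independent of the density chosen in its
  definition.
\<close>

lemma density_unique:
  assumes f: "f \<in> Lp_fun D p" and g: "g \<in> Lp_fun D p" and eq: "distr_of_fun D f = distr_of_fun D g"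
  shows "AE x in LD. f x = g x"
proof -
  let ?h = "\<lambda>x. 1 * f x + (-1) * g x"
  have h: "?h \<in> Lp_fun D p" by (rule Lp_fun_lin[OF f g])
  have "AE x in LD. ?h x = 0"
  proof (rule AE_zero_if_orthogonal_to_test_fun[OF D_open Lp_fun_integrable[OF h]])
    fix \<phi> assume "\<phi> \<in> test_fun D"
    then show "(LINT x|LD. ?h x * \<phi> x) = 0"
      using fun_cong[OF distr_of_fun_lin[OF f g, of 1 "-1"], of \<phi>] fun_cong[OF eq, of \<phi>]
      by (simp add: distr_of_fun_def)
  qed
  then show ?thesis by eventually_elim simp
qed

lemma Lp_norm_powr:
  assumes f: "f \<in> Lp_fun D p"
  shows "Lp_norm D p (distr_of_fun D f) powr p = (LINT x|LD. \<bar>f x\<bar> powr p)"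
proof -
  define g where "g = (SOME g. g \<in> Lp_fun D p \<and> distr_of_fun D f = distr_of_fun D g)"
  have g: "g \<in> Lp_fun D p \<and> distr_of_fun D f = distr_of_fun D g"
    unfolding g_def by (rule someI[of _ f]) (use f in simp)
  note [measurable] = Lp_fun_measurable[OF f] Lp_fun_measurable[OF conjunct1[OF g]]
  have "AE x in LD. g x = f x" using density_unique[OF _ f] g by simp
  then have "(LINT x|LD. \<bar>g x\<bar> powr p) = (LINT x|LD. \<bar>f x\<bar> powr p)"
    by (intro integral_cong_AE) auto
  moreover have "0 \<le> (LINT x|LD. \<bar>g x\<bar> powr p)" by simp
  ultimately show ?thesis using p by (simp add: Lp_norm_def Let_def g_def[symmetric] powr_powr)
qed

lemma Lp_distr_lin:
  assumes "T \<in> Lp_distr D p" "U \<in> Lp_distr D p"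
  shows "(\<lambda>\<phi>. a * T \<phi> + b * U \<phi>) \<in> Lp_distr D p"
  using assms distr_of_fun_lin Lp_fun_lin unfolding Lp_distr_def by (auto simp flip: distr_of_fun_lin)

definition Lp_pow :: "'n distr \<Rightarrow> real" where
  "Lp_pow T = Lp_norm D p T powr p"

lemma Lp_pow_lin:
  assumes "f \<in> Lp_fun D p" "g \<in> Lp_fun D p"
  shows "Lp_pow (\<lambda>\<phi>. a * distr_of_fun D f \<phi> + b * distr_of_fun D g \<phi>)
    = (LINT x|LD. \<bar>a * f x + b * g x\<bar> powr p)"
    "integrable LD (\<lambda>x. \<bar>a * f x + b * g x\<bar> powr p)"
  unfolding Lp_pow_def distr_of_fun_lin[OF assms, symmetric]
  using Lp_norm_powr[OF Lp_fun_lin[OF assms]] Lp_fun_integrable_powr[OF Lp_fun_lin[OF assms]] by auto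

lemma Lp_pow_scale:
  assumes "T \<in> Lp_distr D p"
  shows "Lp_pow (\<lambda>\<phi>. c * T \<phi>) = \<bar>c\<bar> powr p * Lp_pow T"
proof -
  obtain f where f: "f \<in> Lp_fun D p" "T = distr_of_fun D f" using assms unfolding Lp_distr_def by auto
  show ?thesis using Lp_pow_lin[OF f(1) f(1), of c 0] Lp_pow_lin[OF f(1) f(1), of 1 0] f(2)
    by (simp add: powr_abs_mult)
qed

text \<open>
  The density of a linear combination is the linear combination of the densities, so the
  numerical inequality may be applied pointwise to the densities and integrated.
\<close>

lemma Lp_pow_inequality:
  fixes cs :: "(real \<times> real \<times> real) list"
  assumes ineq: "\<And>x y. 0 \<le> (\<Sum>(c, a, b)\<leftarrow>cs. c * \<bar>a * x + b * y\<bar> powr p)"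
    and T: "T \<in> Lp_distr D p" and U: "U \<in> Lp_distr D p"
  shows "0 \<le> (\<Sum>(c, a, b)\<leftarrow>cs. c * Lp_pow (\<lambda>\<phi>. a * T \<phi> + b * U \<phi>))"
proof -
  obtain f g where f: "f \<in> Lp_fun D p" "T = distr_of_fun D f" and g: "g \<in> Lp_fun D p" "U = distr_of_fun D g"
    using T U unfolding Lp_distr_def by auto
  have "integrable LD (\<lambda>x. \<Sum>(c, a, b)\<leftarrow>cs. c * \<bar>a * f x + b * g x\<bar> powr p) \<and>
    (LINT x|LD. (\<Sum>(c, a, b)\<leftarrow>cs. c * \<bar>a * f x + b * g x\<bar> powr p))
      = (\<Sum>(c, a, b)\<leftarrow>cs. c * Lp_pow (\<lambda>\<phi>. a * T \<phi> + b * U \<phi>))" for cs :: "(real \<times> real \<times> real) list"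
  proof (induction cs)
    case (Cons z cs)
    obtain c a b where z: "z = (c, a, b)" by (cases z)
    note l = Lp_pow_lin[OF f(1) g(1), of a b]
    have "integrable LD (\<lambda>x. c * \<bar>a * f x + b * g x\<bar> powr p)" using l(2) by simp
    then show ?case using Cons l(1) by (simp add: z f(2) g(2))
  qed simp
  moreover have "0 \<le> (LINT x|LD. (\<Sum>(c, a, b)\<leftarrow>cs. c * \<bar>a * f x + b * g x\<bar> powr p))"
    by (intro Bochner_Integration.integral_nonneg ineq)
  ultimately show ?thesis by simp
qed

lemma Lp_distr_bound:
  assumes T: "T \<in> Lp_distr D p" and B: "0 \<le> B" "\<And>x. \<bar>\<phi> x\<bar> \<le> B" and l: "0 < l"
  shows "\<bar>T \<phi>\<bar> \<le> B * (l * measure LD D + l powr (1 - p) * Lp_pow T)"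
proof (cases "\<phi> \<in> test_fun D")
  case True
  obtain f where f: "f \<in> Lp_fun D p" "T = distr_of_fun D f" using T unfolding Lp_distr_def by auto
  have i: "integrable LD (\<lambda>x. B * (l + l powr (1 - p) * \<bar>f x\<bar> powr p))"
    using Lp_fun_integrable_powr[OF f(1)] integrable_const_LD by simp
  have sp: "space LD = D" by (simp add: space_restrict_space)
  have "\<bar>T \<phi>\<bar> = norm (LINT x|LD. f x * \<phi> x)" using f True by (simp add: distr_of_fun_def)
  also have "\<dots> \<le> (LINT x|LD. B * (l + l powr (1 - p) * \<bar>f x\<bar> powr p))"
  proof (rule Bochner_Integration.integral_norm_bound_integral[OF integrable_mult_test_fun[OF Lp_fun_integrable[OF f(1)] True] i])
    fix x
    have "\<bar>f x\<bar> * \<bar>\<phi> x\<bar> \<le> (l + l powr (1 - p) * \<bar>f x\<bar> powr p) * B"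
      using abs_le_powr_split[OF p l] B l by (intro mult_mono) (auto intro: add_nonneg_nonneg less_imp_le)
    then show "norm (f x * \<phi> x) \<le> B * (l + l powr (1 - p) * \<bar>f x\<bar> powr p)"
      by (simp add: abs_mult mult.commute)
  qed
  also have "\<dots> = B * (l * measure LD D + l powr (1 - p) * Lp_pow T)"
    using Lp_fun_integrable_powr[OF f(1)] integrable_const_LD f
    by (simp add: Lp_pow_def Lp_norm_powr sp mult.commute)
  finally show ?thesis .
next
  case False
  then have "T \<phi> = 0" using T unfolding Lp_distr_def by (auto simp: distr_of_fun_def)
  moreover have "0 \<le> Lp_pow T" by (simp add: Lp_pow_def)
  ultimately show ?thesis using B l by simp
qed

text \<open>
  The theorem of Riesz and Fischer. Along a subsequence \<open>r\<close> the differences are so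
  small that their \<open>p\<close>-th powers, weighted by \<open>2\<^bsup>kp\<^esup>\<close>,
  have a finite sum of integrals. So almost everywhere the differences are
  \<open>O(2\<^bsup>-k\<^esup>)\<close> and the subsequence converges; Fatou's lemma bounds the
  distance to the limit.
\<close>

lemma Lp_fun_complete:
  fixes f :: "nat \<Rightarrow> real^'n \<Rightarrow> real"
  assumes f: "\<And>n. f n \<in> Lp_fun D p"
    and Cauchy: "\<And>e. 0 < e \<Longrightarrow> \<exists>n0. \<forall>m\<ge>n0. \<forall>n\<ge>n0. (LINT x|LD. \<bar>f m x - f n x\<bar> powr p) < e"
  obtains g where "g \<in> Lp_fun D p" "(\<lambda>n. LINT x|LD. \<bar>f n x - g x\<bar> powr p) \<longlonglongrightarrow> 0"
proof -
  have diff: "(\<lambda>x. f m x - f n x) \<in> Lp_fun D p" for m n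
    using Lp_fun_lin[OF f f, of 1 m "-1" n] by simp
  note [measurable] = Lp_fun_measurable[OF f]
  define \<delta> where "\<delta> = (\<lambda>k::nat. (1/2) ^ k * ((1/2) ^ k) powr p :: real)"
  have "0 < \<delta> k" for k unfolding \<delta>_def by simp
  then have "\<exists>n0. \<forall>m\<ge>n0. \<forall>n\<ge>n0. (LINT x|LD. \<bar>f m x - f n x\<bar> powr p) < \<delta> k" for k by (rule Cauchy)
  then obtain nn where nn: "\<And>k m n. nn k \<le> m \<Longrightarrow> nn k \<le> n \<Longrightarrow> (LINT x|LD. \<bar>f m x - f n x\<bar> powr p) < \<delta> k"
    by metis
  define r where "r = (\<lambda>k. k + (\<Sum>i\<le>k. nn i))"
  have r: "k \<le> r k" "nn k \<le> r k" "nn k \<le> r (Suc k)" for k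
  proof -
    have "nn k \<le> (\<Sum>i\<le>k. nn i)" by (intro member_le_sum) auto
    then show "k \<le> r k" "nn k \<le> r k" "nn k \<le> r (Suc k)" unfolding r_def by auto
  qed
  define a where "a = (\<lambda>k x. \<bar>f (r (Suc k)) x - f (r k) x\<bar> powr p * (2 ^ k) powr p)"
  have a0: "0 \<le> a k x" for k x unfolding a_def by simp
  have am [measurable]: "a k \<in> borel_measurable LD" for k unfolding a_def by measurable
  have int_a: "(\<integral>\<^sup>+x. ennreal (a k x) \<partial>LD) \<le> ennreal ((1/2) ^ k)" for k
  proof -
    have i: "integrable LD (a k)" unfolding a_def using Lp_fun_integrable_powr[OF diff] by simp
    have "(\<integral>\<^sup>+x. ennreal (a k x) \<partial>LD) = ennreal (LINT x|LD. a k x)"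
      using i a0 by (intro nn_integral_eq_integral) auto
    also have "(LINT x|LD. a k x) = (LINT x|LD. \<bar>f (r (Suc k)) x - f (r k) x\<bar> powr p) * (2 ^ k) powr p"
      unfolding a_def by simp
    also have "\<dots> \<le> \<delta> k * (2 ^ k) powr p"
      using nn[OF r(3) r(2)] by (intro mult_right_mono) (auto intro: less_imp_le)
    also have "\<dots> = (1/2) ^ k"
    proof -
      have "((1/2) ^ k :: real) * 2 ^ k = 1" by (simp add: power_one_over)
      then have "(((1/2) ^ k :: real) * 2 ^ k) powr p = 1" by simp
      then have "((1/2) ^ k) powr p * (2 ^ k) powr p = (1 :: real)" unfolding powr_mult .
      then show ?thesis unfolding \<delta>_def by (simp only: mult.assoc mult_1_right)
    qed
    finally show ?thesis by (simp add: ennreal_leI)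
  qed
  have "(\<integral>\<^sup>+x. (\<Sum>k. ennreal (a k x)) \<partial>LD) = (\<Sum>k. \<integral>\<^sup>+x. ennreal (a k x) \<partial>LD)"
    by (intro nn_integral_suminf) measurable
  also have "\<dots> \<le> (\<Sum>k. ennreal ((1/2) ^ k))" by (intro suminf_le int_a) auto
  also have "(\<Sum>k. ennreal ((1/2) ^ k)) < top"
    unfolding less_top[symmetric] by (intro ennreal_suminf_neq_top summable_geometric) auto
  finally have "(\<integral>\<^sup>+x. (\<Sum>k. ennreal (a k x)) \<partial>LD) \<noteq> \<infinity>" by (simp add: less_top)
  then have "AE x in LD. (\<Sum>k. ennreal (a k x)) \<noteq> \<infinity>" by (intro nn_integral_PInf_AE) measurable
  then have conv: "AE x in LD. convergent (\<lambda>k. f (r k) x)"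
  proof eventually_elim
    case (elim x)
    define s where "s = enn2real (\<Sum>k. ennreal (a k x))"
    have as: "a k x \<le> s" for k
    proof -
      have "ennreal (a k x) \<le> (\<Sum>k. ennreal (a k x))"
        using sum_le_suminf[of "\<lambda>k. ennreal (a k x)" "{k}"] by simp
      also have "\<dots> = ennreal s" unfolding s_def using elim by (simp add: less_top)
      finally show ?thesis using a0[of k x] by (simp add: s_def)
    qed
    have "\<bar>f (r (Suc k)) x - f (r k) x\<bar> \<le> s powr (1 / p) * (1/2) ^ k" for k
    proof -
      have "a k x = (\<bar>f (r (Suc k)) x - f (r k) x\<bar> * 2 ^ k) powr p"
        unfolding a_def by (simp add: powr_mult)
      then have "((\<bar>f (r (Suc k)) x - f (r k) x\<bar> * 2 ^ k) powr p) powr (1 / p) \<le> s powr (1 / p)"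
        using as[of k] p by (intro powr_mono2) auto
      then have "\<bar>f (r (Suc k)) x - f (r k) x\<bar> * 2 ^ k \<le> s powr (1 / p)"
        using p by (simp add: powr_powr)
      then show ?thesis by (simp add: field_simps power_one_over)
    qed
    moreover have "summable (\<lambda>k. s powr (1 / p) * (1/2) ^ k)"
      by (rule summable_mult, rule summable_geometric) simp
    ultimately have "summable (\<lambda>k. f (r (Suc k)) x - f (r k) x)"
      using summable_comparison_test'[of "\<lambda>k. s powr (1 / p) * (1/2) ^ k" 0
          "\<lambda>k. f (r (Suc k)) x - f (r k) x"] by simp
    then have "convergent (\<lambda>n. \<Sum>k<n. f (r (Suc k)) x - f (r k) x)" by (simp add: summable_iff_convergent)
    moreover have "(\<Sum>k<n. f (r (Suc k)) x - f (r k) x) = f (r n) x - f (r 0) x" for n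
      by (rule sum_lessThan_telescope)
    ultimately have "convergent (\<lambda>n. (f (r n) x - f (r 0) x) + f (r 0) x)"
      by (intro convergent_add convergent_const) simp
    then show ?case by simp
  qed
  define g where "g = (\<lambda>x. lim (\<lambda>k. f (r k) x))"
  have gm [measurable]: "g \<in> borel_measurable LD" unfolding g_def by measurable
  have bound: "(\<lambda>x. f n x - g x) \<in> Lp_fun D p \<and> (LINT x|LD. \<bar>f n x - g x\<bar> powr p) \<le> e"
    if e: "0 < e" and n0: "\<And>m n. n0 \<le> m \<Longrightarrow> n0 \<le> n \<Longrightarrow> (LINT x|LD. \<bar>f m x - f n x\<bar> powr p) < e"
      and n: "n0 \<le> n" for e n0 n
  proof -
    have lim: "AE x in LD. ennreal (\<bar>f n x - g x\<bar> powr p) = liminf (\<lambda>k. ennreal (\<bar>f n x - f (r k) x\<bar> powr p))"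
      using conv
    proof eventually_elim
      case (elim x)
      then have "(\<lambda>k. f (r k) x) \<longlonglongrightarrow> g x" unfolding g_def by (simp add: convergent_LIMSEQ_iff)
      then have "(\<lambda>k. \<bar>f n x - f (r k) x\<bar> powr p) \<longlonglongrightarrow> \<bar>f n x - g x\<bar> powr p"
        using p by (intro tendsto_powr' tendsto_intros) auto
      then have "(\<lambda>k. ennreal (\<bar>f n x - f (r k) x\<bar> powr p)) \<longlonglongrightarrow> ennreal (\<bar>f n x - g x\<bar> powr p)"
        by (rule tendsto_ennrealI)
      then show ?case by (intro lim_imp_Liminf[symmetric]) auto
    qed
    have "(\<integral>\<^sup>+x. ennreal (\<bar>f n x - g x\<bar> powr p) \<partial>LD)
        = (\<integral>\<^sup>+x. liminf (\<lambda>k. ennreal (\<bar>f n x - f (r k) x\<bar> powr p)) \<partial>LD)"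
      using lim by (rule nn_integral_cong_AE)
    also have "\<dots> \<le> liminf (\<lambda>k. \<integral>\<^sup>+x. ennreal (\<bar>f n x - f (r k) x\<bar> powr p) \<partial>LD)"
      by (intro nn_integral_liminf) measurable
    also have "\<dots> \<le> ennreal e"
    proof (rule Liminf_le)
      show "\<forall>\<^sub>F k in sequentially. (\<integral>\<^sup>+x. ennreal (\<bar>f n x - f (r k) x\<bar> powr p) \<partial>LD) \<le> ennreal e"
        using eventually_ge_at_top[of n0]
      proof eventually_elim
        case (elim k)
        have "(\<integral>\<^sup>+x. ennreal (\<bar>f n x - f (r k) x\<bar> powr p) \<partial>LD) = ennreal (LINT x|LD. \<bar>f n x - f (r k) x\<bar> powr p)"
          using Lp_fun_integrable_powr[OF diff] by (intro nn_integral_eq_integral) auto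
        then show ?case using n0[OF n order_trans[OF elim r(1)]] by (simp add: ennreal_leI less_imp_le)
      qed
    qed simp
    finally have le: "(\<integral>\<^sup>+x. ennreal (\<bar>f n x - g x\<bar> powr p) \<partial>LD) \<le> ennreal e" .
    then have int: "integrable LD (\<lambda>x. \<bar>f n x - g x\<bar> powr p)"
      by (intro integrableI_bounded) (auto intro: le_less_trans)
    then have "ennreal (LINT x|LD. \<bar>f n x - g x\<bar> powr p) \<le> ennreal e"
      using le by (subst nn_integral_eq_integral[symmetric]) auto
    then show ?thesis using int e unfolding Lp_fun_def by simp
  qed
  show ?thesis
  proof (rule that)
    obtain n0 where n0: "\<And>m n. n0 \<le> m \<Longrightarrow> n0 \<le> n \<Longrightarrow> (LINT x|LD. \<bar>f m x - f n x\<bar> powr p) < 1"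
      using Cauchy[of 1] by auto
    have "(\<lambda>x. f n0 x - g x) \<in> Lp_fun D p" using bound[OF _ n0, of n0] by simp
    from Lp_fun_lin[OF f[of n0] this, of 1 "-1"] show "g \<in> Lp_fun D p" by simp
    show "(\<lambda>n. LINT x|LD. \<bar>f n x - g x\<bar> powr p) \<longlonglongrightarrow> 0"
    proof (rule LIMSEQ_I)
      fix e :: real assume e: "0 < e"
      then obtain n0 where n0: "\<And>m n. n0 \<le> m \<Longrightarrow> n0 \<le> n \<Longrightarrow> (LINT x|LD. \<bar>f m x - f n x\<bar> powr p) < e/2"
        using Cauchy[of "e/2"] by auto
      have "norm ((LINT x|LD. \<bar>f n x - g x\<bar> powr p) - 0) < e" if "n0 \<le> n" for n
        using bound[OF _ n0 that] e by simp
      then show "\<exists>n0. \<forall>n\<ge>n0. norm ((LINT x|LD. \<bar>f n x - g x\<bar> powr p) - 0) < e" by blast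
    qed
  qed
qed

lemma Lp_distr_complete:
  assumes X: "\<And>n::nat. X n \<in> Lp_distr D p"
    and Cauchy: "\<And>e. 0 < e \<Longrightarrow> \<exists>n0. \<forall>m\<ge>n0. \<forall>n\<ge>n0. Lp_pow (\<lambda>\<phi>. X m \<phi> - X n \<phi>) < e"
  obtains T where "T \<in> Lp_distr D p" "(\<lambda>n. Lp_pow (\<lambda>\<phi>. X n \<phi> - T \<phi>)) \<longlonglongrightarrow> 0"
proof -
  have "\<exists>f. f \<in> Lp_fun D p \<and> X n = distr_of_fun D f" for n using X[of n] unfolding Lp_distr_def by auto
  then obtain f where f: "\<And>n. f n \<in> Lp_fun D p" "\<And>n. X n = distr_of_fun D (f n)" by metis
  have pow: "Lp_pow (\<lambda>\<phi>. X m \<phi> - distr_of_fun D g \<phi>) = (LINT x|LD. \<bar>f m x - g x\<bar> powr p)"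
    if "g \<in> Lp_fun D p" for m g
    using Lp_pow_lin(1)[OF f(1) that, of 1 m "-1"] f(2) by simp
  obtain g where g: "g \<in> Lp_fun D p" "(\<lambda>n. LINT x|LD. \<bar>f n x - g x\<bar> powr p) \<longlonglongrightarrow> 0"
  proof (rule Lp_fun_complete[OF f(1)])
    show "\<exists>n0. \<forall>m\<ge>n0. \<forall>n\<ge>n0. (LINT x|LD. \<bar>f m x - f n x\<bar> powr p) < e" if "0 < e" for e
      using Cauchy[OF that] unfolding f(2) pow[OF f(1), unfolded f(2)] .
  qed blast
  show ?thesis
  proof (rule that)
    show "distr_of_fun D g \<in> Lp_distr D p" using g(1) unfolding Lp_distr_def by blast
    show "(\<lambda>n. Lp_pow (\<lambda>\<phi>. X n \<phi> - distr_of_fun D g \<phi>)) \<longlonglongrightarrow> 0" using g pow by simp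
  qed
qed

end


section \<open>Sobolev spaces of nonnegative order\<close>

lemma test_fun_le_SUP:
  assumes "\<phi> \<in> test_fun U"
  shows "\<bar>\<phi> x\<bar> \<le> (SUP x. \<bar>\<phi> x\<bar>)"
proof -
  obtain B where "\<And>x. \<bar>\<phi> x\<bar> \<le> B" using test_fun_bounded[OF assms] by metis
  then have "bdd_above (range (\<lambda>x. \<bar>\<phi> x\<bar>))" by (auto intro!: bdd_aboveI)
  then show ?thesis by (intro cSUP_upper) auto
qed

lemma SUP_test_fun_nonneg: "\<phi> \<in> test_fun U \<Longrightarrow> 0 \<le> (SUP x. \<bar>\<phi> x\<bar>)"
  using test_fun_le_SUP[of \<phi> U 0] by linarith

text \<open>
  The seminorms that define continuity of distributions.
\<close>

definition mdiff_seminorm :: "nat \<Rightarrow> (real^'n::finite \<Rightarrow> real) \<Rightarrow> real" where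
  "mdiff_seminorm j \<phi> = (\<Sum>\<alpha> | mi_deg \<alpha> \<le> j. SUP x. \<bar>mdiff \<alpha> \<phi> x\<bar>)"

lemma mdiff_seminorm_nonneg: "\<phi> \<in> test_fun U \<Longrightarrow> 0 \<le> mdiff_seminorm j \<phi>"
  unfolding mdiff_seminorm_def by (intro sum_nonneg SUP_test_fun_nonneg test_fun_mdiff)

lemma mdiff_seminorm_mono: "\<phi> \<in> test_fun U \<Longrightarrow> i \<le> j \<Longrightarrow> mdiff_seminorm i \<phi> \<le> mdiff_seminorm j \<phi>"
  unfolding mdiff_seminorm_def
  by (intro sum_mono2 finite_multi_indices SUP_test_fun_nonneg test_fun_mdiff) auto

lemma mdiff_le_seminorm:
  assumes "\<phi> \<in> test_fun U" "mi_deg \<alpha> \<le> j"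
  shows "\<bar>mdiff \<alpha> \<phi> x\<bar> \<le> mdiff_seminorm j \<phi>"
proof -
  have "\<bar>mdiff \<alpha> \<phi> x\<bar> \<le> (SUP x. \<bar>mdiff \<alpha> \<phi> x\<bar>)"
    by (rule test_fun_le_SUP[OF test_fun_mdiff[OF assms(1)]])
  also have "\<dots> \<le> mdiff_seminorm j \<phi>" unfolding mdiff_seminorm_def
    using assms by (intro member_le_sum[of \<alpha>] finite_multi_indices SUP_test_fun_nonneg test_fun_mdiff) auto
  finally show ?thesis .
qed

lemma distributionsI:
  assumes "\<And>\<phi>. \<phi> \<notin> test_fun U \<Longrightarrow> T \<phi> = 0"
    and "\<And>\<phi> \<psi> a b. \<phi> \<in> test_fun U \<Longrightarrow> \<psi> \<in> test_fun U \<Longrightarrow> T (\<lambda>x. a * \<phi> x + b * \<psi> x) = a * T \<phi> + b * T \<psi>"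
    and "\<And>K. compact K \<Longrightarrow> K \<subseteq> U \<Longrightarrow>
      \<exists>C j. \<forall>\<phi>\<in>test_fun U. supp \<phi> \<subseteq> K \<longrightarrow> \<bar>T \<phi>\<bar> \<le> C * mdiff_seminorm j \<phi>"
  shows "T \<in> distributions U"
  unfolding distributions_def mem_Collect_eq mdiff_seminorm_def[symmetric]
proof (intro conjI ballI allI impI)
  fix \<phi> \<psi> assume "\<phi> \<in> test_fun U" "\<psi> \<in> test_fun U"
  from assms(2)[OF this, of 1 1] show "T (\<lambda>x. \<phi> x + \<psi> x) = T \<phi> + T \<psi>" by simp
next
  fix \<phi> c assume "\<phi> \<in> test_fun U"
  from assms(2)[OF this this, of c 0] show "T (\<lambda>x. c * \<phi> x) = c * T \<phi>" by simp
qed (use assms(1,3) in auto)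

lemma distributions_outside: "T \<in> distributions U \<Longrightarrow> \<phi> \<notin> test_fun U \<Longrightarrow> T \<phi> = 0"
  unfolding distributions_def by blast

lemma distributions_linear:
  assumes "T \<in> distributions U" "\<phi> \<in> test_fun U" "\<psi> \<in> test_fun U"
  shows "T (\<lambda>x. a * \<phi> x + b * \<psi> x) = a * T \<phi> + b * T \<psi>"
proof -
  have "(\<lambda>x. a * \<phi> x) \<in> test_fun U" "(\<lambda>x. b * \<psi> x) \<in> test_fun U"
    using test_fun_lin[OF assms(2,2), of a 0] test_fun_lin[OF assms(3,3), of b 0] by auto
  then have "T (\<lambda>x. a * \<phi> x + b * \<psi> x) = T (\<lambda>x. a * \<phi> x) + T (\<lambda>x. b * \<psi> x)"
    using assms(1) unfolding distributions_def by simp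
  moreover have "T (\<lambda>x. a * \<phi> x) = a * T \<phi>" "T (\<lambda>x. b * \<psi> x) = b * T \<psi>"
    using assms unfolding distributions_def by simp_all
  ultimately show ?thesis by simp
qed

lemma distributions_bound:
  assumes "T \<in> distributions U" "compact K" "K \<subseteq> U"
  obtains C j where "0 \<le> C" "\<And>\<phi> i. \<phi> \<in> test_fun U \<Longrightarrow> supp \<phi> \<subseteq> K \<Longrightarrow> j \<le> i \<Longrightarrow> \<bar>T \<phi>\<bar> \<le> C * mdiff_seminorm i \<phi>"
proof -
  obtain C j where C: "\<And>\<phi>. \<phi> \<in> test_fun U \<Longrightarrow> supp \<phi> \<subseteq> K \<Longrightarrow> \<bar>T \<phi>\<bar> \<le> C * mdiff_seminorm j \<phi>"
    using assms unfolding distributions_def mdiff_seminorm_def mem_Collect_eq by meson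
  have "\<bar>T \<phi>\<bar> \<le> \<bar>C\<bar> * mdiff_seminorm i \<phi>" if "\<phi> \<in> test_fun U" "supp \<phi> \<subseteq> K" "j \<le> i" for \<phi> i
  proof -
    have "\<bar>T \<phi>\<bar> \<le> C * mdiff_seminorm j \<phi>" using that by (intro C)
    also have "\<dots> \<le> \<bar>C\<bar> * mdiff_seminorm i \<phi>"
      using mdiff_seminorm_mono[OF that(1,3)] mdiff_seminorm_nonneg[OF that(1)] by (intro mult_mono) auto
    finally show ?thesis .
  qed
  then show ?thesis using that[of "\<bar>C\<bar>" j] by simp
qed

lemma distributions_lin:
  assumes T: "T \<in> distributions U" and S: "S \<in> distributions U"
  shows "(\<lambda>\<phi>. a * T \<phi> + b * S \<phi>) \<in> distributions U"
proof (rule distributionsI)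
  fix K :: "(real^'a) set" assume K: "compact K" "K \<subseteq> U"
  obtain C1 j1 where 1: "0 \<le> C1" "\<And>\<phi> i. \<phi> \<in> test_fun U \<Longrightarrow> supp \<phi> \<subseteq> K \<Longrightarrow> j1 \<le> i \<Longrightarrow> \<bar>T \<phi>\<bar> \<le> C1 * mdiff_seminorm i \<phi>"
    using distributions_bound[OF T K] by metis
  obtain C2 j2 where 2: "0 \<le> C2" "\<And>\<phi> i. \<phi> \<in> test_fun U \<Longrightarrow> supp \<phi> \<subseteq> K \<Longrightarrow> j2 \<le> i \<Longrightarrow> \<bar>S \<phi>\<bar> \<le> C2 * mdiff_seminorm i \<phi>"
    using distributions_bound[OF S K] by metis
  show "\<exists>C j. \<forall>\<phi>\<in>test_fun U. supp \<phi> \<subseteq> K \<longrightarrow> \<bar>a * T \<phi> + b * S \<phi>\<bar> \<le> C * mdiff_seminorm j \<phi>"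
  proof (intro exI ballI impI)
    fix \<phi> assume \<phi>: "\<phi> \<in> test_fun U" "supp \<phi> \<subseteq> K"
    have "\<bar>a * T \<phi> + b * S \<phi>\<bar> \<le> \<bar>a\<bar> * \<bar>T \<phi>\<bar> + \<bar>b\<bar> * \<bar>S \<phi>\<bar>" by (metis abs_mult abs_triangle_ineq)
    also have "\<dots> \<le> \<bar>a\<bar> * (C1 * mdiff_seminorm (max j1 j2) \<phi>) + \<bar>b\<bar> * (C2 * mdiff_seminorm (max j1 j2) \<phi>)"
      by (intro add_mono mult_left_mono 1(2) 2(2) \<phi>) auto
    finally show "\<bar>a * T \<phi> + b * S \<phi>\<bar> \<le> (\<bar>a\<bar> * C1 + \<bar>b\<bar> * C2) * mdiff_seminorm (max j1 j2) \<phi>"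
      by (simp add: algebra_simps)
  qed
qed (simp_all add: distributions_outside[OF T] distributions_outside[OF S] distributions_linear[OF T]
    distributions_linear[OF S] algebra_simps)

lemma distr_diff_lin:
  "distr_diff U \<alpha> (\<lambda>\<phi>. a * T \<phi> + b * S \<phi>) = (\<lambda>\<phi>. a * distr_diff U \<alpha> T \<phi> + b * distr_diff U \<alpha> S \<phi>)"
  by (auto simp: distr_diff_def fun_eq_iff algebra_simps)

lemma distr_diff_scale: "distr_diff U \<alpha> (\<lambda>\<phi>. c * T \<phi>) = (\<lambda>\<phi>. c * distr_diff U \<alpha> T \<phi>)"
  using distr_diff_lin[of U \<alpha> c T 0 T] by simp

lemma distr_diff_diff: "distr_diff U \<alpha> (\<lambda>\<phi>. T \<phi> - S \<phi>) = (\<lambda>\<phi>. distr_diff U \<alpha> T \<phi> - distr_diff U \<alpha> S \<phi>)"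
  using distr_diff_lin[of U \<alpha> 1 T "-1" S] by simp

lemma distr_diff_zero: "T \<in> distributions U \<Longrightarrow> distr_diff U (\<lambda>_. 0) T = T"
  by (auto simp: distr_diff_def fun_eq_iff mdiff_zero mi_deg_def distributions_outside)

context Lp_setting
begin

lemma Lp_pow_nonneg: "0 \<le> Lp_pow T"
  by (simp add: Lp_pow_def)

lemma Lp_distr_diff: "T \<in> Lp_distr D p \<Longrightarrow> U \<in> Lp_distr D p \<Longrightarrow> (\<lambda>\<phi>. T \<phi> - U \<phi>) \<in> Lp_distr D p"
  using Lp_distr_lin[of T U 1 "-1"] by simp

lemma Lp_distr_pointwise:
  assumes X: "\<And>n::nat. X n \<in> Lp_distr D p" and T: "T \<in> Lp_distr D p"
    and lim: "(\<lambda>n. Lp_pow (\<lambda>\<phi>. X n \<phi> - T \<phi>)) \<longlonglongrightarrow> 0"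
  shows "(\<lambda>n. X n \<phi>) \<longlonglongrightarrow> T \<phi>"
proof (cases "\<phi> \<in> test_fun D")
  case True
  obtain B where B: "0 < B" "\<And>x. \<bar>\<phi> x\<bar> \<le> B" using test_fun_bounded[OF True] by metis
  define v where "v = measure LD D"
  have v: "0 \<le> v" by (simp add: v_def)
  show ?thesis
  proof (rule LIMSEQ_I)
    fix e :: real assume e: "0 < e"
    define l where "l = e / (2 * B * (v + 1))"
    have l: "0 < l" using e B v by (simp add: l_def)
    have lv: "B * (l * v) < e / 2"
    proof -
      have "B * (l * v) < B * (l * (v + 1))" using B l by simp
      also have "\<dots> = e / 2"
      proof -
        have "2 * B * (v + 1) \<noteq> 0" using B v by simp
        then have "l * (2 * B * (v + 1)) = e" unfolding l_def by simp
        then show ?thesis by (simp add: algebra_simps)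
      qed
      finally show ?thesis .
    qed
    have "(\<lambda>n. B * (l * v + l powr (1 - p) * Lp_pow (\<lambda>\<phi>. X n \<phi> - T \<phi>)))
        \<longlonglongrightarrow> B * (l * v + l powr (1 - p) * 0)" by (intro tendsto_intros lim)
    from order_tendstoD(2)[OF this, of e]
    have "\<forall>\<^sub>F n in sequentially. B * (l * v + l powr (1 - p) * Lp_pow (\<lambda>\<phi>. X n \<phi> - T \<phi>)) < e"
      using lv e by simp
    then have "\<forall>\<^sub>F n in sequentially. norm (X n \<phi> - T \<phi>) < e"
    proof eventually_elim
      case (elim n)
      have "\<bar>X n \<phi> - T \<phi>\<bar> \<le> B * (l * v + l powr (1 - p) * Lp_pow (\<lambda>\<phi>. X n \<phi> - T \<phi>))"
        unfolding v_def using B l by (intro Lp_distr_bound[OF Lp_distr_diff[OF X T]]) auto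
      then show ?case using elim by simp
    qed
    then show "\<exists>n0. \<forall>n\<ge>n0. norm (X n \<phi> - T \<phi>) < e" unfolding eventually_sequentially .
  qed
next
  case False
  then have "S \<phi> = 0" if "S \<in> Lp_distr D p" for S
    using that by (auto simp: Lp_distr_def distr_of_fun_def)
  from this[OF X] this[OF T] show ?thesis by simp
qed

lemma Lp_distr_definite:
  assumes T: "T \<in> Lp_distr D p" and "Lp_pow T = 0"
  shows "T = (\<lambda>_. 0)"
proof
  fix \<phi>
  have Z: "(\<lambda>\<phi>. 0 * T \<phi>) \<in> Lp_distr D p" using Lp_distr_lin[OF T T, of 0 0] by simp
  have "(\<lambda>n::nat. T \<phi>) \<longlonglongrightarrow> 0 * T \<phi>"
    by (rule Lp_distr_pointwise[where X = "\<lambda>_. T" and T = "\<lambda>\<phi>. 0 * T \<phi>", OF T Z]) (simp add: assms)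
  then show "T \<phi> = 0" by (simp add: LIMSEQ_const_iff)
qed

lemma Lp_distr_distributions:
  assumes "T \<in> Lp_distr D p"
  shows "T \<in> distributions D"
proof -
  obtain f where f: "f \<in> Lp_fun D p" "T = distr_of_fun D f" using assms unfolding Lp_distr_def by auto
  note i = integrable_mult_test_fun[OF Lp_fun_integrable[OF f(1)]]
  show ?thesis
  proof (rule distributionsI)
    show "T \<phi> = 0" if "\<phi> \<notin> test_fun D" for \<phi> using that f by (simp add: distr_of_fun_def)
    fix \<phi> \<psi> and a b :: real assume t: "\<phi> \<in> test_fun D" "\<psi> \<in> test_fun D"
    have "(LINT x|LD. f x * (a * \<phi> x + b * \<psi> x)) = (LINT x|LD. a * (f x * \<phi> x) + b * (f x * \<psi> x))"
      by (simp add: algebra_simps)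
    also have "\<dots> = a * (LINT x|LD. f x * \<phi> x) + b * (LINT x|LD. f x * \<psi> x)"
      using i[OF t(1)] i[OF t(2)] by simp
    finally show "T (\<lambda>x. a * \<phi> x + b * \<psi> x) = a * T \<phi> + b * T \<psi>"
      using t test_fun_lin[OF t] f by (simp add: distr_of_fun_def)
  next
    fix K assume "compact K" "K \<subseteq> D"
    have "\<bar>T \<phi>\<bar> \<le> (1 * measure LD D + 1 powr (1 - p) * Lp_pow T) * mdiff_seminorm 0 \<phi>"
      if "\<phi> \<in> test_fun D" for \<phi>
    proof -
      have "\<bar>\<phi> x\<bar> \<le> mdiff_seminorm 0 \<phi>" for x
        using mdiff_le_seminorm[OF that, of "\<lambda>_. 0" 0 x] by (simp add: mdiff_zero mi_deg_def)
      from Lp_distr_bound[OF assms mdiff_seminorm_nonneg[OF that] this, of 1]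
      show ?thesis by (simp add: mult.commute)
    qed
    then show "\<exists>C j. \<forall>\<phi>\<in>test_fun D. supp \<phi> \<subseteq> K \<longrightarrow> \<bar>T \<phi>\<bar> \<le> C * mdiff_seminorm j \<phi>" by blast
  qed
qed

end

locale sobolev_setting = Lp_setting D p for D :: "(real^'n::finite) set" and p +
  fixes s :: nat
begin

abbreviation "W \<equiv> sobolev_pos D s p"
abbreviation "N \<equiv> sobolev_pos_norm D s p"

text \<open>
  The \<open>p\<close>-th power of the Sobolev norm. Unlike the norm it is additive over the
  derivatives, so that inequalities for integrals can be summed.
\<close>

definition energy :: "'n distr \<Rightarrow> real" where
  "energy T = (\<Sum>\<alpha> | mi_deg \<alpha> \<le> s. Lp_pow (distr_diff D \<alpha> T))"

lemma energy_nonneg: "0 \<le> energy T"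
  unfolding energy_def by (intro sum_nonneg Lp_pow_nonneg)

lemma N_eq: "N T = energy T powr (1 / p)"
  unfolding sobolev_pos_norm_def energy_def Lp_pow_def ..

lemma N_powr: "N T powr p = energy T"
  using p energy_nonneg[of T] by (simp add: N_eq powr_powr)

lemma N_nonneg: "0 \<le> N T"
  by (simp add: N_eq)

lemma N_less_iff: "0 \<le> e \<Longrightarrow> N T < e \<longleftrightarrow> energy T < e powr p"
  using p N_powr N_nonneg by (smt (verit) powr_less_mono2 powr_mono2)

lemma Lp_pow_le_energy: "mi_deg \<alpha> \<le> s \<Longrightarrow> Lp_pow (distr_diff D \<alpha> T) \<le> energy T"
  unfolding energy_def by (intro member_le_sum finite_multi_indices Lp_pow_nonneg) auto

lemma W_diff: "T \<in> W \<Longrightarrow> mi_deg \<alpha> \<le> s \<Longrightarrow> distr_diff D \<alpha> T \<in> Lp_distr D p"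
  unfolding sobolev_pos_def by blast

lemma W_distributions: "T \<in> W \<Longrightarrow> T \<in> distributions D"
  unfolding sobolev_pos_def by blast

lemma W_lin: "T \<in> W \<Longrightarrow> U \<in> W \<Longrightarrow> (\<lambda>\<phi>. a * T \<phi> + b * U \<phi>) \<in> W"
  unfolding sobolev_pos_def by (auto simp: distributions_lin distr_diff_lin Lp_distr_lin)

lemma W_Lp: "T \<in> W \<Longrightarrow> T \<in> Lp_distr D p"
  using W_diff[of T "\<lambda>_. 0"] distr_diff_zero[OF W_distributions] by (simp add: mi_deg_def)

lemma Lp_pow_le_energy_0: "T \<in> W \<Longrightarrow> Lp_pow T \<le> energy T"
  using Lp_pow_le_energy[of "\<lambda>_. 0" T] distr_diff_zero[OF W_distributions] by (simp add: mi_deg_def)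

lemma energy_scale: "T \<in> W \<Longrightarrow> energy (\<lambda>\<phi>. c * T \<phi>) = \<bar>c\<bar> powr p * energy T"
  unfolding energy_def distr_diff_scale sum_distrib_left
  by (intro sum.cong refl Lp_pow_scale W_diff) auto

lemma N_scale: "T \<in> W \<Longrightarrow> N (\<lambda>\<phi>. c * T \<phi>) = \<bar>c\<bar> * N T"
  using p energy_nonneg[of T] by (simp add: N_eq energy_scale powr_mult powr_powr)

lemma energy_inequality:
  fixes cs :: "(real \<times> real \<times> real) list"
  assumes ineq: "\<And>x y. 0 \<le> (\<Sum>(c, a, b)\<leftarrow>cs. c * \<bar>a * x + b * y\<bar> powr p)"
    and T: "T \<in> W" and U: "U \<in> W"
  shows "0 \<le> (\<Sum>(c, a, b)\<leftarrow>cs. c * energy (\<lambda>\<phi>. a * T \<phi> + b * U \<phi>))"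
proof -
  have "(\<Sum>(c, a, b)\<leftarrow>cs. c * energy (\<lambda>\<phi>. a * T \<phi> + b * U \<phi>)) = (\<Sum>\<alpha> | mi_deg \<alpha> \<le> s.
      \<Sum>(c, a, b)\<leftarrow>cs. c * Lp_pow (\<lambda>\<phi>. a * distr_diff D \<alpha> T \<phi> + b * distr_diff D \<alpha> U \<phi>))"
    for cs :: "(real \<times> real \<times> real) list"
    by (induction cs) (auto simp: energy_def distr_diff_lin sum.distrib sum_distrib_left)
  then show ?thesis
    using T U by (auto intro!: sum_nonneg Lp_pow_inequality[OF ineq] W_diff)
qed

lemma energy_convex:
  assumes "T \<in> W" "U \<in> W" and t: "0 \<le> t" "t \<le> 1"
  shows "energy (\<lambda>\<phi>. (1 - t) * T \<phi> + t * U \<phi>) \<le> (1 - t) * energy T + t * energy U"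
proof -
  have "0 \<le> (\<Sum>(c, a, b)\<leftarrow>[(1 - t, 1, 0), (t, 0, 1), (-1, 1 - t, t)]. c * \<bar>a * x + b * y\<bar> powr p)" for x y
    using powr_convex[OF p t, of x y] by simp
  from energy_inequality[OF this assms(1,2)] show ?thesis by simp
qed

lemma N_triangle:
  assumes T: "T \<in> W" and U: "U \<in> W"
  shows "N (\<lambda>\<phi>. T \<phi> + U \<phi>) \<le> N T + N U"
proof (rule le_add_of_powr_split[OF p N_nonneg N_nonneg N_nonneg])
  fix t :: real assume t: "0 < t" "t < 1"
  have W: "(\<lambda>\<phi>. 1 / (1 - t) * T \<phi>) \<in> W" "(\<lambda>\<phi>. 1 / t * U \<phi>) \<in> W"
    using W_lin[OF T T, of "1 / (1 - t)" 0] W_lin[OF U U, of "1 / t" 0] by auto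
  have "energy (\<lambda>\<phi>. (1 - t) * (1 / (1 - t) * T \<phi>) + t * (1 / t * U \<phi>))
      \<le> (1 - t) * energy (\<lambda>\<phi>. 1 / (1 - t) * T \<phi>) + t * energy (\<lambda>\<phi>. 1 / t * U \<phi>)"
    using t by (intro energy_convex W) auto
  also have "\<dots> = (1 - t) * ((1 / (1 - t)) powr p * energy T) + t * ((1 / t) powr p * energy U)"
    using t by (simp add: energy_scale[OF T] energy_scale[OF U] del: times_divide_eq_left)
  also have "(\<lambda>\<phi>. (1 - t) * (1 / (1 - t) * T \<phi>) + t * (1 / t * U \<phi>)) = (\<lambda>\<phi>. T \<phi> + U \<phi>)"
    using t by (simp add: fun_eq_iff)
  finally show "N (\<lambda>\<phi>. T \<phi> + U \<phi>) powr p
      \<le> (1 - t) * ((1 / (1 - t)) powr p * N T powr p) + t * ((1 / t) powr p * N U powr p)"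
    unfolding N_powr .
qed

lemma energy_uniformly_convex:
  assumes "0 < \<epsilon>"
  obtains C where "0 < C" "\<And>T U. T \<in> W \<Longrightarrow> U \<in> W \<Longrightarrow>
    energy (\<lambda>\<phi>. T \<phi> - U \<phi>) \<le> \<epsilon> * (energy T + energy U)
      + C * ((energy T + energy U) / 2 - energy (\<lambda>\<phi>. (1/2) * T \<phi> + (1/2) * U \<phi>))"
proof -
  obtain C where C: "0 < C" "\<And>x y. \<bar>x - y\<bar> powr p \<le> \<epsilon> * (\<bar>x\<bar> powr p + \<bar>y\<bar> powr p)
        + C * ((\<bar>x\<bar> powr p + \<bar>y\<bar> powr p) / 2 - \<bar>(x + y) / 2\<bar> powr p)"
    by (rule powr_uniformly_convex[OF p assms]) blast
  have "0 \<le> (\<Sum>(c, a, b)\<leftarrow>[(\<epsilon> + C/2, 1, 0), (\<epsilon> + C/2, 0, 1), (-C, 1/2, 1/2), (-1, 1, -1)].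
      c * \<bar>a * x + b * y\<bar> powr p)" for x y
    using C(2)[of x y] by (simp add: algebra_simps add_divide_distrib)
  from energy_inequality[OF this] that[OF C(1)] show ?thesis
    by (simp add: algebra_simps add_divide_distrib)
qed

lemma energy_uniformly_smooth:
  assumes "0 < \<eta>"
  obtains t where "0 < t" "t < 1" "\<And>T U. T \<in> W \<Longrightarrow> U \<in> W \<Longrightarrow>
    energy (\<lambda>\<phi>. T \<phi> + t * U \<phi>) + energy (\<lambda>\<phi>. T \<phi> - t * U \<phi>)
      \<le> 2 * energy T + t * \<eta> * (energy T + energy U)"
proof -
  obtain t where t: "0 < t" "t < 1" "\<And>x y. \<bar>x + t * y\<bar> powr p + \<bar>x - t * y\<bar> powr p
        \<le> 2 * \<bar>x\<bar> powr p + t * \<eta> * (\<bar>x\<bar> powr p + \<bar>y\<bar> powr p)"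
    by (rule powr_uniformly_smooth[OF p assms]) blast
  have "0 \<le> (\<Sum>(c, a, b)\<leftarrow>[(2 + t * \<eta>, 1, 0), (t * \<eta>, 0, 1), (-1, 1, t), (-1, 1, -t)].
      c * \<bar>a * x + b * y\<bar> powr p)" for x y
    using t(3)[of x y] by (simp add: algebra_simps)
  from energy_inequality[OF this] that[OF t(1,2)] show ?thesis by (simp add: algebra_simps)
qed

lemma W_minus: "T \<in> W \<Longrightarrow> U \<in> W \<Longrightarrow> (\<lambda>\<phi>. T \<phi> - U \<phi>) \<in> W"
  using W_lin[of T U 1 "-1"] by simp

lemma energy_tendsto_0:
  assumes "(\<lambda>n. N (X n)) \<longlonglongrightarrow> 0"
  shows "(\<lambda>n. energy (X n)) \<longlonglongrightarrow> 0"
proof -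
  have "(\<lambda>n. N (X n) powr p) \<longlonglongrightarrow> 0 powr p"
    using p N_nonneg by (intro tendsto_powr' assms tendsto_const) (auto intro: always_eventually)
  then show ?thesis by (simp add: N_powr)
qed

lemma W_pointwise:
  assumes X: "\<And>n::nat. X n \<in> W" and T: "T \<in> W" and lim: "(\<lambda>n. N (\<lambda>\<phi>. X n \<phi> - T \<phi>)) \<longlonglongrightarrow> 0"
  shows "(\<lambda>n. X n \<phi>) \<longlonglongrightarrow> T \<phi>"
proof (rule Lp_distr_pointwise[OF W_Lp[OF X] W_Lp[OF T]])
  show "(\<lambda>n. Lp_pow (\<lambda>\<phi>. X n \<phi> - T \<phi>)) \<longlonglongrightarrow> 0"
    by (rule tendsto_sandwich[OF _ _ tendsto_const energy_tendsto_0[OF lim]])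
      (auto intro!: always_eventually Lp_pow_nonneg Lp_pow_le_energy_0 W_minus X T)
qed

text \<open>
  The derivatives converge in \<open>L\<^sup>p\<close> separately; pointwise convergence on test
  functions identifies their limits as the derivatives of the limit.
\<close>

lemma W_complete:
  assumes X: "\<And>n::nat. X n \<in> W"
    and Cauchy: "\<And>e. 0 < e \<Longrightarrow> \<exists>n0. \<forall>m\<ge>n0. \<forall>n\<ge>n0. N (\<lambda>\<phi>. X m \<phi> - X n \<phi>) < e"
  shows "\<exists>T\<in>W. (\<lambda>n. N (\<lambda>\<phi>. X n \<phi> - T \<phi>)) \<longlonglongrightarrow> 0"
proof -
  have "\<forall>\<alpha>. \<exists>T. mi_deg \<alpha> \<le> s \<longrightarrow> T \<in> Lp_distr D p \<and>
      (\<lambda>n. Lp_pow (\<lambda>\<phi>. distr_diff D \<alpha> (X n) \<phi> - T \<phi>)) \<longlonglongrightarrow> 0" (is "\<forall>\<alpha>. ?Q \<alpha>")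
  proof
    fix \<alpha>
    show "?Q \<alpha>"
    proof (cases "mi_deg \<alpha> \<le> s")
      case True
      have Cauchy_\<alpha>: "\<exists>n0. \<forall>m\<ge>n0. \<forall>n\<ge>n0. Lp_pow (\<lambda>\<phi>. distr_diff D \<alpha> (X m) \<phi> - distr_diff D \<alpha> (X n) \<phi>) < e"
        if e: "0 < e" for e
      proof -
        have "0 < e powr (1 / p)" using e by simp
        from Cauchy[OF this] obtain n0 where n0: "\<And>m n. n0 \<le> m \<Longrightarrow> n0 \<le> n \<Longrightarrow> N (\<lambda>\<phi>. X m \<phi> - X n \<phi>) < e powr (1 / p)"
          by blast
        have "Lp_pow (\<lambda>\<phi>. distr_diff D \<alpha> (X m) \<phi> - distr_diff D \<alpha> (X n) \<phi>) < e" if "n0 \<le> m" "n0 \<le> n" for m n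
        proof -
          have "energy (\<lambda>\<phi>. X m \<phi> - X n \<phi>) < (e powr (1 / p)) powr p"
            using n0[OF that] by (simp add: N_less_iff)
          then show ?thesis
            using Lp_pow_le_energy[OF True, of "\<lambda>\<phi>. X m \<phi> - X n \<phi>"] p e by (simp add: distr_diff_diff powr_powr)
        qed
        then show ?thesis by blast
      qed
      obtain T where "T \<in> Lp_distr D p" "(\<lambda>n. Lp_pow (\<lambda>\<phi>. distr_diff D \<alpha> (X n) \<phi> - T \<phi>)) \<longlonglongrightarrow> 0"
        by (rule Lp_distr_complete[OF W_diff[OF X True] Cauchy_\<alpha>])
      then show ?thesis by blast
    qed simp
  qed
  from choice[OF this] obtain T where T: "\<And>\<alpha>. mi_deg \<alpha> \<le> s \<Longrightarrow> T \<alpha> \<in> Lp_distr D p"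
    "\<And>\<alpha>. mi_deg \<alpha> \<le> s \<Longrightarrow> (\<lambda>n. Lp_pow (\<lambda>\<phi>. distr_diff D \<alpha> (X n) \<phi> - T \<alpha> \<phi>)) \<longlonglongrightarrow> 0" by auto
  have pt: "(\<lambda>n. distr_diff D \<alpha> (X n) \<phi>) \<longlonglongrightarrow> T \<alpha> \<phi>" if "mi_deg \<alpha> \<le> s" for \<alpha> \<phi>
    by (rule Lp_distr_pointwise[OF W_diff[OF X that] T(1)[OF that] T(2)[OF that]])
  define T0 where "T0 = T (\<lambda>_. 0)"
  have T0: "T0 \<in> Lp_distr D p" unfolding T0_def by (rule T(1)) (simp add: mi_deg_def)
  have pt0: "(\<lambda>n. X n \<phi>) \<longlonglongrightarrow> T0 \<phi>" for \<phi>
    using pt[of "\<lambda>_. 0" \<phi>] distr_diff_zero[OF W_distributions[OF X]] unfolding T0_def by (simp add: mi_deg_def)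
  have diff: "distr_diff D \<alpha> T0 = T \<alpha>" if "mi_deg \<alpha> \<le> s" for \<alpha>
  proof
    fix \<phi>
    have "(\<lambda>n. distr_diff D \<alpha> (X n) \<phi>) \<longlonglongrightarrow> distr_diff D \<alpha> T0 \<phi>"
      unfolding distr_diff_def by (cases "\<phi> \<in> test_fun D") (auto intro!: tendsto_intros pt0)
    then show "distr_diff D \<alpha> T0 \<phi> = T \<alpha> \<phi>" using pt[OF that] LIMSEQ_unique by blast
  qed
  have T0W: "T0 \<in> W" unfolding sobolev_pos_def using Lp_distr_distributions[OF T0] diff T(1) by auto
  have "(\<lambda>n. energy (\<lambda>\<phi>. X n \<phi> - T0 \<phi>)) \<longlonglongrightarrow> (\<Sum>\<alpha> :: 'n multi_index | mi_deg \<alpha> \<le> s. 0)"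
    unfolding energy_def distr_diff_diff by (intro tendsto_sum) (use T(2) diff in auto)
  then have "(\<lambda>n. energy (\<lambda>\<phi>. X n \<phi> - T0 \<phi>) powr (1 / p)) \<longlonglongrightarrow> 0 powr (1 / p)"
    using p energy_nonneg by (intro tendsto_powr' tendsto_const) (auto intro: always_eventually)
  then show ?thesis using T0W by (auto simp: N_eq)
qed

lemma N_definite: "T \<in> W \<Longrightarrow> N T = 0 \<Longrightarrow> T = (\<lambda>_. 0)"
proof (rule Lp_distr_definite[OF W_Lp])
  assume "T \<in> W" "N T = 0"
  then show "Lp_pow T = 0"
    using N_powr[of T] p Lp_pow_le_energy_0[of T] Lp_pow_nonneg[of T] by simp
qed

theorem uniformly_convex_sobolev_pos: "uniformly_convex_space W N p"
proof (rule uniformly_convex_space.intro)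
  fix \<epsilon> B :: real assume \<epsilon>: "0 < \<epsilon>"
  \<comment> \<open>The two error terms of the convexity estimate are each made at most \<open>\<epsilon>\<^sup>p / 2\<close>.\<close>
  define c where "c = \<epsilon> powr p / (4 * (\<bar>B\<bar> powr p + 1))"
  have c: "0 < c" using \<epsilon> by (simp add: c_def add_nonneg_pos)
  obtain C where C: "0 < C" "\<And>T U. T \<in> W \<Longrightarrow> U \<in> W \<Longrightarrow>
    energy (\<lambda>\<phi>. T \<phi> - U \<phi>) \<le> c * (energy T + energy U)
      + C * ((energy T + energy U) / 2 - energy (\<lambda>\<phi>. (1/2) * T \<phi> + (1/2) * U \<phi>))"
    by (rule energy_uniformly_convex[OF c]) blast
  define \<delta> where "\<delta> = \<epsilon> powr p / (2 * C)"
  show "\<exists>\<delta>>0. \<forall>T\<in>W. \<forall>U\<in>W. N T \<le> B \<longrightarrow> N U \<le> B \<longrightarrow>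
        (N T powr p + N U powr p) / 2 - N (\<lambda>\<phi>. (1/2) * T \<phi> + (1/2) * U \<phi>) powr p < \<delta> \<longrightarrow>
        N (\<lambda>\<phi>. T \<phi> - U \<phi>) < \<epsilon>"
  proof (intro exI[of _ \<delta>] conjI ballI impI)
    show "0 < \<delta>" using \<epsilon> C by (simp add: \<delta>_def)
    fix T U assume TU: "T \<in> W" "U \<in> W" and B: "N T \<le> B" "N U \<le> B"
      and gap: "(N T powr p + N U powr p) / 2 - N (\<lambda>\<phi>. (1/2) * T \<phi> + (1/2) * U \<phi>) powr p < \<delta>"
    have "energy V \<le> \<bar>B\<bar> powr p" if "N V \<le> B" for V
      unfolding N_powr[symmetric] using that p N_nonneg[of V] by (intro powr_mono2) auto
    then have "energy T + energy U \<le> 2 * (\<bar>B\<bar> powr p + 1)" using B by (smt (verit))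
    then have "c * (energy T + energy U) \<le> c * (2 * (\<bar>B\<bar> powr p + 1))" using c by simp
    also have "\<dots> = \<epsilon> powr p / 2"
    proof -
      have "\<bar>B\<bar> powr p + 1 \<noteq> 0" by (smt (verit) powr_ge_zero)
      then show ?thesis by (simp add: c_def field_simps)
    qed
    finally have 1: "c * (energy T + energy U) \<le> \<epsilon> powr p / 2" .
    have "C * ((energy T + energy U) / 2 - energy (\<lambda>\<phi>. (1/2) * T \<phi> + (1/2) * U \<phi>)) < C * \<delta>"
      using gap C(1) unfolding N_powr by simp
    also have "C * \<delta> = \<epsilon> powr p / 2" using C(1) by (simp add: \<delta>_def)
    finally have "energy (\<lambda>\<phi>. T \<phi> - U \<phi>) < \<epsilon> powr p" using C(2)[OF TU] 1 by linarith
    then show "N (\<lambda>\<phi>. T \<phi> - U \<phi>) < \<epsilon>" using \<epsilon> by (simp add: N_less_iff)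
  qed
qed (use p W_lin N_nonneg N_scale N_definite N_triangle W_complete W_pointwise in auto)

text \<open>
  Here integration by parts enters: the distributional derivative of a test function is its
  classical derivative.
\<close>

lemma distr_diff_distr_of_test_fun:
  assumes \<phi>: "\<phi> \<in> test_fun D"
  shows "distr_diff D \<alpha> (distr_of_fun D \<phi>) = distr_of_fun D (mdiff \<alpha> \<phi>)"
proof
  fix \<psi>
  show "distr_diff D \<alpha> (distr_of_fun D \<phi>) \<psi> = distr_of_fun D (mdiff \<alpha> \<phi>) \<psi>"
  proof (cases "\<psi> \<in> test_fun D")
    case True
    note c = test_fun_continuous[OF \<phi>] test_fun_continuous[OF test_fun_mdiff[OF \<phi>]]
    show ?thesis using \<phi> True
      by (simp add: distr_diff_def distr_of_fun_def test_fun_mdiff LINT_LD_test_fun c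
          integral_by_parts[OF \<phi> True])
  qed (simp add: distr_diff_def distr_of_fun_def)
qed

lemma test_fun_W:
  assumes \<phi>: "\<phi> \<in> test_fun D"
  shows "distr_of_fun D \<phi> \<in> W"
  unfolding sobolev_pos_def
proof (intro CollectI conjI allI impI)
  show "distr_of_fun D \<phi> \<in> distributions D"
    using test_fun_Lp_fun[OF \<phi>] by (intro Lp_distr_distributions) (simp add: Lp_distr_def)
  show "distr_diff D \<alpha> (distr_of_fun D \<phi>) \<in> Lp_distr D p" for \<alpha>
    unfolding distr_diff_distr_of_test_fun[OF \<phi>] Lp_distr_def
    using test_fun_Lp_fun[OF test_fun_mdiff[OF \<phi>]] by blast
qed

text \<open>
  Functionals on the Sobolev space thereby induce distributions.
\<close>

lemma N_test_fun_bound: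
  obtains C where "0 \<le> C" "\<And>\<phi>. \<phi> \<in> test_fun D \<Longrightarrow> N (distr_of_fun D \<phi>) \<le> C * mdiff_seminorm s \<phi>"
proof
  let ?A = "{\<alpha> :: 'n multi_index. mi_deg \<alpha> \<le> s}"
  define v where "v = real (card ?A) * measure LD D"
  show "0 \<le> v powr (1 / p)" by simp
  fix \<phi> assume \<phi>: "\<phi> \<in> test_fun D"
  define S where "S = mdiff_seminorm s \<phi>"
  have S: "0 \<le> S" unfolding S_def by (rule mdiff_seminorm_nonneg[OF \<phi>])
  have "Lp_pow (distr_diff D \<alpha> (distr_of_fun D \<phi>)) \<le> measure LD D * S powr p" if "\<alpha> \<in> ?A" for \<alpha>
  proof -
    have f: "mdiff \<alpha> \<phi> \<in> Lp_fun D p" by (intro test_fun_Lp_fun test_fun_mdiff \<phi>)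
    have "Lp_pow (distr_diff D \<alpha> (distr_of_fun D \<phi>)) = (LINT x|LD. \<bar>mdiff \<alpha> \<phi> x\<bar> powr p)"
      unfolding distr_diff_distr_of_test_fun[OF \<phi>] Lp_pow_def by (rule Lp_norm_powr[OF f])
    also have "\<dots> \<le> (LINT x|LD. S powr p)"
      using p mdiff_le_seminorm[OF \<phi>] that unfolding S_def
      by (intro integral_mono Lp_fun_integrable_powr f integrable_const_LD powr_mono2) auto
    also have "\<dots> = measure LD D * S powr p" by (simp add: space_restrict_space)
    finally show ?thesis .
  qed
  then have "energy (distr_of_fun D \<phi>) \<le> (\<Sum>\<alpha>\<in>?A. measure LD D * S powr p)"
    unfolding energy_def by (intro sum_mono)
  also have "\<dots> = v * S powr p" by (simp add: v_def)
  finally have "N (distr_of_fun D \<phi>) \<le> (v * S powr p) powr (1 / p)"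
    unfolding N_eq using p energy_nonneg by (intro powr_mono2) auto
  also have "\<dots> = v powr (1 / p) * S" using p S by (simp add: powr_mult powr_powr)
  finally show "N (distr_of_fun D \<phi>) \<le> v powr (1 / p) * mdiff_seminorm s \<phi>" unfolding S_def .
qed

end


section \<open>Sobolev spaces of negative order\<close>

locale dual_sobolev_setting = sobolev_setting D q s
  for D :: "(real^'n::finite) set" and q :: real and s :: nat +
  fixes r :: real
  assumes r: "1 < r" and q_eq: "q = conj_exp r"
begin

abbreviation "Z \<equiv> sobolev_zero D s q"
abbreviation "Z' \<equiv> sobolev_zero_dual D s q"

lemma conj: "1 / r + 1 / q = 1" "(r - 1) * q = r"
  using r by (auto simp: q_eq conj_exp_def field_simps)

lemma Z_W: "v \<in> Z \<Longrightarrow> v \<in> W"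
  unfolding sobolev_zero_def by blast

lemma Z_approx: "v \<in> Z \<Longrightarrow> 0 < \<epsilon> \<Longrightarrow> \<exists>\<phi>\<in>test_fun D. N (\<lambda>\<psi>. v \<psi> - distr_of_fun D \<phi> \<psi>) < \<epsilon>"
  unfolding sobolev_zero_def by blast

lemma zero_test_fun: "(\<lambda>_. 0) \<in> test_fun D"
  by (rule test_funI[of _ "{}"]) (auto intro: flat_algebra_smooth flat_algebra.const)

lemma N_zero: "N (\<lambda>_. 0) = 0"
  using N_scale[OF test_fun_W[OF zero_test_fun], of 0] by simp

lemma test_fun_Z: "\<phi> \<in> test_fun D \<Longrightarrow> distr_of_fun D \<phi> \<in> Z"
  unfolding sobolev_zero_def using test_fun_W N_zero by (auto intro!: bexI[of _ \<phi>])

lemma Z_lin: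
  assumes v: "v \<in> Z" and w: "w \<in> Z"
  shows "(\<lambda>\<psi>. a * v \<psi> + b * w \<psi>) \<in> Z"
  unfolding sobolev_zero_def
proof (intro CollectI conjI allI impI W_lin Z_W v w)
  fix \<epsilon> :: real assume \<epsilon>: "0 < \<epsilon>"
  define d where "d = \<epsilon> / (\<bar>a\<bar> + \<bar>b\<bar> + 1)"
  have c: "0 < \<bar>a\<bar> + \<bar>b\<bar> + 1" by linarith
  have d: "0 < d" using \<epsilon> c by (simp add: d_def)
  obtain \<phi> where \<phi>: "\<phi> \<in> test_fun D" "N (\<lambda>\<psi>. v \<psi> - distr_of_fun D \<phi> \<psi>) < d" using Z_approx[OF v d] by blast
  obtain \<theta> where \<theta>: "\<theta> \<in> test_fun D" "N (\<lambda>\<psi>. w \<psi> - distr_of_fun D \<theta> \<psi>) < d" using Z_approx[OF w d] by blast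
  note W = W_minus[OF Z_W[OF v] test_fun_W[OF \<phi>(1)]] W_minus[OF Z_W[OF w] test_fun_W[OF \<theta>(1)]]
  have cW: "(\<lambda>\<psi>. c * T \<psi>) \<in> W" if "T \<in> W" for c T using W_lin[OF that that, of c 0] by simp
  have eq: "(\<lambda>\<psi>. a * v \<psi> + b * w \<psi> - distr_of_fun D (\<lambda>x. a * \<phi> x + b * \<theta> x) \<psi>)
    = (\<lambda>\<psi>. a * (v \<psi> - distr_of_fun D \<phi> \<psi>) + b * (w \<psi> - distr_of_fun D \<theta> \<psi>))"
    using distr_of_fun_lin[OF test_fun_Lp_fun[OF \<phi>(1)] test_fun_Lp_fun[OF \<theta>(1)], of a b]
    by (simp add: algebra_simps)
  have "N (\<lambda>\<psi>. a * (v \<psi> - distr_of_fun D \<phi> \<psi>) + b * (w \<psi> - distr_of_fun D \<theta> \<psi>))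
      \<le> N (\<lambda>\<psi>. a * (v \<psi> - distr_of_fun D \<phi> \<psi>)) + N (\<lambda>\<psi>. b * (w \<psi> - distr_of_fun D \<theta> \<psi>))"
    by (intro N_triangle cW W)
  also have "\<dots> = \<bar>a\<bar> * N (\<lambda>\<psi>. v \<psi> - distr_of_fun D \<phi> \<psi>) + \<bar>b\<bar> * N (\<lambda>\<psi>. w \<psi> - distr_of_fun D \<theta> \<psi>)"
    by (simp add: N_scale[OF W(1)] N_scale[OF W(2)])
  also have "\<dots> \<le> \<bar>a\<bar> * d + \<bar>b\<bar> * d" using \<phi> \<theta> by (intro add_mono mult_left_mono) auto
  also have "\<dots> < (\<bar>a\<bar> + \<bar>b\<bar> + 1) * d" using d by (simp add: algebra_simps)
  also have "\<dots> = \<epsilon>" using c by (simp add: d_def)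
  finally show "\<exists>\<phi>\<in>test_fun D. N (\<lambda>\<psi>. a * v \<psi> + b * w \<psi> - distr_of_fun D \<phi> \<psi>) < \<epsilon>"
    unfolding eq[symmetric] using test_fun_lin[OF \<phi>(1) \<theta>(1)] by blast
qed

lemma Z_scale: "v \<in> Z \<Longrightarrow> (\<lambda>\<psi>. c * v \<psi>) \<in> Z"
  using Z_lin[of v v c 0] by simp

lemma dual_linear:
  assumes L: "L \<in> Z'" and v: "v \<in> Z" and w: "w \<in> Z"
  shows "L (\<lambda>\<psi>. a * v \<psi> + b * w \<psi>) = a * L v + b * L w"
proof -
  have "L (\<lambda>\<psi>. a * v \<psi> + b * w \<psi>) = L (\<lambda>\<psi>. a * v \<psi>) + L (\<lambda>\<psi>. b * w \<psi>)"
    using L Z_scale[OF v, of a] Z_scale[OF w, of b] unfolding sobolev_zero_dual_def by simp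
  moreover have "L (\<lambda>\<psi>. a * v \<psi>) = a * L v" "L (\<lambda>\<psi>. b * w \<psi>) = b * L w"
    using L v w unfolding sobolev_zero_dual_def by simp_all
  ultimately show ?thesis by simp
qed

lemma dual_scale: "L \<in> Z' \<Longrightarrow> v \<in> Z \<Longrightarrow> L (\<lambda>\<psi>. c * v \<psi>) = c * L v"
  unfolding sobolev_zero_dual_def by simp

lemma dualI:
  assumes "\<And>v w a b. v \<in> Z \<Longrightarrow> w \<in> Z \<Longrightarrow> L (\<lambda>\<psi>. a * v \<psi> + b * w \<psi>) = a * L v + b * L w"
    and "\<And>v. v \<in> Z \<Longrightarrow> \<bar>L v\<bar> \<le> C * N v"
  shows "L \<in> Z'"
  unfolding sobolev_zero_dual_def
proof (intro CollectI conjI ballI allI)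
  show "L (\<lambda>\<psi>. v \<psi> + w \<psi>) = L v + L w" if "v \<in> Z" "w \<in> Z" for v w using assms(1)[OF that, of 1 1] by simp
  show "L (\<lambda>\<psi>. c * v \<psi>) = c * L v" if "v \<in> Z" for v c using assms(1)[OF that that, of c 0] by simp
  show "\<exists>C. \<forall>v\<in>Z. \<bar>L v\<bar> \<le> C * N v" using assms(2) by blast
qed

definition dual_norm :: "('n distr \<Rightarrow> real) \<Rightarrow> real" where
  "dual_norm L = Sup {\<bar>L v\<bar> | v. v \<in> Z \<and> N v \<le> 1}"

lemma zero_Z: "(\<lambda>_. 0) \<in> Z"
  using Z_scale[OF test_fun_Z[OF zero_test_fun], of 0] by simp

lemma dual_bounded: "L \<in> Z' \<Longrightarrow> \<exists>C. \<forall>v\<in>Z. \<bar>L v\<bar> \<le> C * N v"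
  unfolding sobolev_zero_dual_def by simp

lemma dual_bdd:
  assumes "L \<in> Z'"
  shows "bdd_above {\<bar>L v\<bar> | v. v \<in> Z \<and> N v \<le> 1}"
proof -
  obtain C where C: "\<And>v. v \<in> Z \<Longrightarrow> \<bar>L v\<bar> \<le> C * N v" using dual_bounded[OF assms] by blast
  have "\<bar>L v\<bar> \<le> \<bar>C\<bar>" if "v \<in> Z" "N v \<le> 1" for v
  proof -
    have "\<bar>L v\<bar> \<le> C * N v" using C that by simp
    also have "\<dots> \<le> \<bar>C\<bar> * 1" using that N_nonneg by (intro mult_mono) auto
    finally show ?thesis by simp
  qed
  then show ?thesis by (auto intro!: bdd_aboveI)
qed

lemma dual_norm_upper: "L \<in> Z' \<Longrightarrow> v \<in> Z \<Longrightarrow> N v \<le> 1 \<Longrightarrow> \<bar>L v\<bar> \<le> dual_norm L"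
  unfolding dual_norm_def by (rule cSup_upper[OF _ dual_bdd]) auto

lemma dual_norm_least:
  assumes "\<And>v. v \<in> Z \<Longrightarrow> N v \<le> 1 \<Longrightarrow> \<bar>L v\<bar> \<le> C"
  shows "dual_norm L \<le> C"
  unfolding dual_norm_def using zero_Z N_zero by (intro cSup_least) (auto intro: assms)

lemma dual_norm_nonneg: "L \<in> Z' \<Longrightarrow> 0 \<le> dual_norm L"
  using dual_norm_upper[OF _ zero_Z] N_zero by (smt (verit))

lemma dual_norm_bound:
  assumes L: "L \<in> Z'" and v: "v \<in> Z"
  shows "\<bar>L v\<bar> \<le> dual_norm L * N v"
proof (cases "N v = 0")
  case True
  obtain C where "\<And>v. v \<in> Z \<Longrightarrow> \<bar>L v\<bar> \<le> C * N v" using dual_bounded[OF L] by blast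
  from this[OF v] show ?thesis using True by simp
next
  case False
  then have pos: "0 < N v" using N_nonneg[of v] by simp
  have "N (\<lambda>\<psi>. (1 / N v) * v \<psi>) = \<bar>1 / N v\<bar> * N v" by (rule N_scale[OF Z_W[OF v]])
  then have "N (\<lambda>\<psi>. (1 / N v) * v \<psi>) = 1" using pos by simp
  then have "\<bar>L (\<lambda>\<psi>. (1 / N v) * v \<psi>)\<bar> \<le> dual_norm L"
    by (intro dual_norm_upper[OF L Z_scale[OF v]]) (rule eq_refl)
  then have "\<bar>(1 / N v) * L v\<bar> \<le> dual_norm L" unfolding dual_scale[OF L v] .
  then show ?thesis using pos by (simp add: abs_mult field_simps)
qed

lemma dual_norm_approx:
  assumes L: "L \<in> Z'" and \<gamma>: "0 < \<gamma>"
  obtains v where "v \<in> Z" "N v \<le> 1" "dual_norm L - \<gamma> < L v"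
proof -
  have "dual_norm L - \<gamma> < Sup {\<bar>L v\<bar> | v. v \<in> Z \<and> N v \<le> 1}" using \<gamma> by (simp add: dual_norm_def)
  moreover have "{\<bar>L v\<bar> | v. v \<in> Z \<and> N v \<le> 1} \<noteq> {}" using zero_Z N_zero by (auto intro!: exI[of _ "\<lambda>_. 0"])
  ultimately obtain v where v: "v \<in> Z" "N v \<le> 1" "dual_norm L - \<gamma> < \<bar>L v\<bar>"
    by (auto elim!: less_cSupE)
  show ?thesis
  proof (cases "0 \<le> L v")
    case True
    then show ?thesis using v that by simp
  next
    case False
    have "N (\<lambda>\<psi>. (-1) * v \<psi>) = N v" using N_scale[OF Z_W[OF v(1)], of "-1"] by simp
    moreover have "L (\<lambda>\<psi>. (-1) * v \<psi>) = - L v" using dual_scale[OF L v(1), of "-1"] by simp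
    ultimately show ?thesis using that[OF Z_scale[OF v(1), of "-1"]] v False by simp
  qed
qed

lemma dual_lin:
  assumes L: "L \<in> Z'" and K: "K \<in> Z'"
  shows "(\<lambda>v. a * L v + b * K v) \<in> Z'"
proof (rule dualI)
  fix v assume v: "v \<in> Z"
  have "\<bar>a * L v + b * K v\<bar> \<le> \<bar>a\<bar> * \<bar>L v\<bar> + \<bar>b\<bar> * \<bar>K v\<bar>" by (metis abs_mult abs_triangle_ineq)
  also have "\<dots> \<le> \<bar>a\<bar> * (dual_norm L * N v) + \<bar>b\<bar> * (dual_norm K * N v)"
    by (intro add_mono mult_left_mono dual_norm_bound L K v) auto
  finally show "\<bar>a * L v + b * K v\<bar> \<le> (\<bar>a\<bar> * dual_norm L + \<bar>b\<bar> * dual_norm K) * N v"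
    by (simp add: algebra_simps)
qed (simp add: dual_linear[OF L] dual_linear[OF K] algebra_simps)

lemma dual_minus: "L \<in> Z' \<Longrightarrow> K \<in> Z' \<Longrightarrow> (\<lambda>v. L v - K v) \<in> Z'"
  using dual_lin[of L K 1 "-1"] by simp

abbreviation "induced \<equiv> distr_of_functional D"

lemma induced_lin: "induced (\<lambda>v. a * L v + b * K v) = (\<lambda>\<phi>. a * induced L \<phi> + b * induced K \<phi>)"
  by (auto simp: distr_of_functional_def)

lemma induced_minus: "induced (\<lambda>v. L v - K v) = (\<lambda>\<phi>. induced L \<phi> - induced K \<phi>)"
  by (auto simp: distr_of_functional_def)

text \<open>
  Test functions are dense in \<open>Z\<close> by definition.
\<close>

lemma dual_determined:
  assumes L: "L \<in> Z'" and K: "K \<in> Z'" and eq: "induced L = induced K" and v: "v \<in> Z"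
  shows "L v = K v"
proof -
  define C where "C = dual_norm (\<lambda>v. L v - K v)"
  have LK: "(\<lambda>v. L v - K v) \<in> Z'" by (rule dual_minus[OF L K])
  have C: "0 \<le> C" unfolding C_def by (rule dual_norm_nonneg[OF LK])
  have "\<bar>L v - K v\<bar> \<le> 0 + e" if e: "0 < e" for e
  proof -
    have "0 < e / (C + 1)" using e C by simp
    from Z_approx[OF v this] obtain \<phi> where \<phi>: "\<phi> \<in> test_fun D" "N (\<lambda>\<psi>. v \<psi> - distr_of_fun D \<phi> \<psi>) < e / (C + 1)"
      by blast
    have z: "(\<lambda>\<psi>. 1 * v \<psi> + (-1) * distr_of_fun D \<phi> \<psi>) \<in> Z" by (intro Z_lin v test_fun_Z \<phi>(1))
    have "L (distr_of_fun D \<phi>) = K (distr_of_fun D \<phi>)"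
      using fun_cong[OF eq, of \<phi>] \<phi>(1) by (simp add: distr_of_functional_def)
    then have "L v - K v = (\<lambda>v. L v - K v) (\<lambda>\<psi>. 1 * v \<psi> + (-1) * distr_of_fun D \<phi> \<psi>)"
      using dual_linear[OF L v test_fun_Z[OF \<phi>(1)], of 1 "-1"] dual_linear[OF K v test_fun_Z[OF \<phi>(1)], of 1 "-1"] by simp
    then have "\<bar>L v - K v\<bar> \<le> C * N (\<lambda>\<psi>. v \<psi> - distr_of_fun D \<phi> \<psi>)"
      using dual_norm_bound[OF LK z] unfolding C_def by simp
    also have "\<dots> \<le> C * (e / (C + 1))" using \<phi>(2) C by (intro mult_left_mono) auto
    also have "\<dots> \<le> e" using C e by (simp add: field_simps)
    finally show ?thesis by simp
  qed
  then have "\<bar>L v - K v\<bar> \<le> 0" by (rule field_le_epsilon)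
  then show ?thesis by simp
qed

abbreviation "W' \<equiv> sobolev_neg D s r"
abbreviation "N' \<equiv> sobolev_neg_norm D s r"

lemma W'_eq: "W' = induced ` Z'"
  unfolding sobolev_neg_def q_eq ..

text \<open>
  By density the norm does not depend on which functional is chosen to represent the
  distribution.
\<close>

lemma N'_induced:
  assumes L: "L \<in> Z'"
  shows "N' (induced L) = dual_norm L"
proof -
  define K where "K = (SOME K. K \<in> Z' \<and> induced L = induced K)"
  have K: "K \<in> Z' \<and> induced L = induced K" unfolding K_def by (rule someI[of _ L]) (use L in simp)
  have "K v = L v" if "v \<in> Z" for v using dual_determined[OF conjunct1[OF K] L _ that] K by simp
  then have "{\<bar>K v\<bar> | v. v \<in> Z \<and> N v \<le> 1} = {\<bar>L v\<bar> | v. v \<in> Z \<and> N v \<le> 1}" by auto metis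
  then show ?thesis
    unfolding sobolev_neg_norm_def Let_def q_eq[symmetric] K_def[symmetric] dual_norm_def by simp
qed

lemma dual_norm_scale_le: "L \<in> Z' \<Longrightarrow> dual_norm (\<lambda>v. c * L v) \<le> \<bar>c\<bar> * dual_norm L"
  by (intro dual_norm_least) (simp add: abs_mult mult_left_mono dual_norm_upper)

lemma dual_norm_scale:
  assumes L: "L \<in> Z'"
  shows "dual_norm (\<lambda>v. c * L v) = \<bar>c\<bar> * dual_norm L"
proof (cases "c = 0")
  case True
  have "dual_norm (\<lambda>v. c * L v) \<le> 0" using dual_norm_scale_le[OF L, of c] True by simp
  moreover have "0 \<le> dual_norm (\<lambda>v. c * L v)"
    using dual_norm_nonneg[OF dual_lin[OF L L, of c 0]] by simp
  ultimately show ?thesis using True by simp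
next
  case False
  have cL: "(\<lambda>v. c * L v) \<in> Z'" using dual_lin[OF L L, of c 0] by simp
  have "dual_norm L = dual_norm (\<lambda>v. (1 / c) * (c * L v))" using False by simp
  also have "\<dots> \<le> \<bar>1 / c\<bar> * dual_norm (\<lambda>v. c * L v)" by (rule dual_norm_scale_le[OF cL])
  finally have "\<bar>c\<bar> * dual_norm L \<le> dual_norm (\<lambda>v. c * L v)" using False by (simp add: field_simps)
  then show ?thesis using dual_norm_scale_le[OF L, of c] by simp
qed

lemma dual_norm_triangle:
  assumes "L \<in> Z'" "K \<in> Z'"
  shows "dual_norm (\<lambda>v. L v + K v) \<le> dual_norm L + dual_norm K"
proof (rule dual_norm_least)
  fix v assume "v \<in> Z" "N v \<le> 1"
  then show "\<bar>L v + K v\<bar> \<le> dual_norm L + dual_norm K"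
    using dual_norm_upper[OF assms(1), of v] dual_norm_upper[OF assms(2), of v] by linarith
qed

text \<open>
  Lindenstrauss duality between smoothness and convexity. For functionals \<open>L, K\<close>
  with mean \<open>M\<close> pick \<open>v\<close> almost extremal in Young's inequality for
  \<open>M\<close>, and an element \<open>w\<close> of norm at most \<open>1\<close> on which
  \<open>L - K\<close> is almost extremal. Young's inequality for \<open>L\<close> at \<open>v +
  t w\<close> and for \<open>K\<close> at \<open>v - t w\<close>, added up, gives the convexity
  gap on one side and \<open>t\<close> times the norm of \<open>L - K\<close> on the other, with
  an error that uniform smoothness makes small compared with \<open>t\<close>.
\<close>

lemma dual_norm_gap:
  assumes L: "L \<in> Z'" and K: "K \<in> Z'" and B: "dual_norm L \<le> B" "dual_norm K \<le> B"
    and t: "0 < t" and \<eta>: "0 \<le> \<eta>" and \<gamma>: "0 < \<gamma>"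
    and smooth: "\<And>T U. T \<in> W \<Longrightarrow> U \<in> W \<Longrightarrow>
      energy (\<lambda>\<phi>. T \<phi> + t * U \<phi>) + energy (\<lambda>\<phi>. T \<phi> - t * U \<phi>)
        \<le> 2 * energy T + t * \<eta> * (energy T + energy U)"
  shows "t * (dual_norm (\<lambda>v. L v - K v) - \<gamma>)
    \<le> 2 * ((dual_norm L powr r + dual_norm K powr r) / 2 - dual_norm (\<lambda>v. (1/2) * L v + (1/2) * K v) powr r) / r
      + 2 * \<gamma> * B powr (r - 1) + t * \<eta> * (B powr r + 1) / q"
proof -
  define M where "M = (\<lambda>v. (1/2) * L v + (1/2) * K v)"
  define \<mu> where "\<mu> = dual_norm M"
  define \<Delta> where "\<Delta> = dual_norm (\<lambda>v. L v - K v)"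
  have M: "M \<in> Z'" unfolding M_def by (rule dual_lin[OF L K])
  have \<mu>0: "0 \<le> \<mu>" unfolding \<mu>_def by (rule dual_norm_nonneg[OF M])
  have \<mu>B: "\<mu> \<le> B"
  proof -
    have "\<mu> \<le> dual_norm (\<lambda>v. (1/2) * L v) + dual_norm (\<lambda>v. (1/2) * K v)"
      unfolding \<mu>_def M_def using dual_norm_triangle[OF dual_lin[OF L L, of "1/2" 0] dual_lin[OF K K, of "1/2" 0]] by simp
    also have "\<dots> = \<bar>1/2\<bar> * dual_norm L + \<bar>1/2\<bar> * dual_norm K"
      unfolding dual_norm_scale[OF L] dual_norm_scale[OF K] ..
    finally show ?thesis using B by simp
  qed
  have q1: "1 < q" by (rule p)
  obtain v0 where v0: "v0 \<in> Z" "N v0 \<le> 1" "\<mu> - \<gamma> < M v0"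
    unfolding \<mu>_def by (rule dual_norm_approx[OF M \<gamma>])
  obtain w where w: "w \<in> Z" "N w \<le> 1" "\<Delta> - \<gamma> < L w - K w"
    unfolding \<Delta>_def by (rule dual_norm_approx[OF dual_minus[OF L K] \<gamma>])
  define m where "m = \<mu> powr (r - 1)"
  have m0: "0 \<le> m" by (simp add: m_def)
  have m\<mu>: "m * \<mu> = \<mu> powr r" unfolding m_def using \<mu>0 powr_mult_base[of \<mu> "r - 1"] by (simp add: mult.commute)
  have mq: "m powr q = \<mu> powr r" unfolding m_def using conj(2) by (simp add: powr_powr)
  \<comment> \<open>With this scaling both sides of Young's inequality for \<open>M\<close> at \<open>v\<close> nearly agree.\<close>
  define v where "v = (\<lambda>\<psi>. m * v0 \<psi>)"
  have v: "v \<in> Z" unfolding v_def by (rule Z_scale[OF v0(1)])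
  have e1: "energy u \<le> 1" if "N u \<le> 1" for u
    unfolding N_powr[symmetric] using that N_nonneg[of u] q1 by (simp add: powr_le1)
  have Ev: "energy v \<le> \<mu> powr r"
  proof -
    have "energy v = \<mu> powr r * energy v0"
      unfolding v_def energy_scale[OF Z_W[OF v0(1)]] using m0 mq by simp
    also have "\<dots> \<le> \<mu> powr r * 1" by (intro mult_left_mono e1 v0) auto
    finally show ?thesis by simp
  qed
  have young: "J u \<le> dual_norm J powr r / r + energy u / q" if "J \<in> Z'" "u \<in> Z" for J u
  proof -
    have "J u \<le> dual_norm J * N u" using dual_norm_bound[OF that] by linarith
    also have "\<dots> \<le> dual_norm J powr r / r + N u powr q / q"
      by (intro Youngs_inequality r q1 conj dual_norm_nonneg that N_nonneg)
    finally show ?thesis by (simp add: N_powr)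
  qed
  have vw: "(\<lambda>\<psi>. v \<psi> + t * w \<psi>) \<in> Z" "(\<lambda>\<psi>. v \<psi> - t * w \<psi>) \<in> Z"
    using Z_lin[OF v w(1), of 1 t] Z_lin[OF v w(1), of 1 "- t"] by simp_all
  have Lv: "L (\<lambda>\<psi>. v \<psi> + t * w \<psi>) = L v + t * L w" using dual_linear[OF L v w(1), of 1 t] by simp
  have Kv: "K (\<lambda>\<psi>. v \<psi> - t * w \<psi>) = K v - t * K w" using dual_linear[OF K v w(1), of 1 "- t"] by simp
  have "m * (\<mu> - \<gamma>) \<le> m * M v0" using m0 v0(3) by (intro mult_left_mono) auto
  also have "\<dots> = M v" unfolding v_def dual_scale[OF M v0(1)] ..
  finally have Mv: "2 * (m * \<mu>) - 2 * (m * \<gamma>) \<le> L v + K v" by (simp add: M_def algebra_simps)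
  have "t * (\<Delta> - \<gamma>) \<le> t * (L w - K w)" using t w(3) by (intro mult_left_mono) auto
  then have "2 * \<mu> powr r - 2 * (m * \<gamma>) + t * (\<Delta> - \<gamma>)
      \<le> L (\<lambda>\<psi>. v \<psi> + t * w \<psi>) + K (\<lambda>\<psi>. v \<psi> - t * w \<psi>)"
    using Mv unfolding Lv Kv m\<mu> by (simp add: algebra_simps)
  also have "\<dots> \<le> (dual_norm L powr r / r + energy (\<lambda>\<psi>. v \<psi> + t * w \<psi>) / q)
      + (dual_norm K powr r / r + energy (\<lambda>\<psi>. v \<psi> - t * w \<psi>) / q)"
    by (intro add_mono young L K vw)
  also have "\<dots> = (dual_norm L powr r + dual_norm K powr r) / r
      + (energy (\<lambda>\<psi>. v \<psi> + t * w \<psi>) + energy (\<lambda>\<psi>. v \<psi> - t * w \<psi>)) / q"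
    by (simp add: add_divide_distrib)
  also have "\<dots> \<le> (dual_norm L powr r + dual_norm K powr r) / r
      + (2 * energy v + t * \<eta> * (energy v + energy w)) / q"
    using q1 by (intro add_left_mono divide_right_mono smooth Z_W v w) auto
  also have "\<dots> \<le> (dual_norm L powr r + dual_norm K powr r) / r
      + (2 * \<mu> powr r + t * \<eta> * (B powr r + 1)) / q"
  proof (intro add_left_mono divide_right_mono add_mono mult_left_mono)
    have "\<mu> powr r \<le> B powr r" using \<mu>0 \<mu>B r by (intro powr_mono2) auto
    then show "energy v \<le> B powr r" using Ev by simp
  qed (use q1 Ev e1[OF w(2)] t \<eta> in auto)
  finally have main: "2 * \<mu> powr r - 2 * (m * \<gamma>) + t * (\<Delta> - \<gamma>)
      \<le> (dual_norm L powr r + dual_norm K powr r) / r + (2 * \<mu> powr r + t * \<eta> * (B powr r + 1)) / q" .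
  have split: "2 * \<mu> powr r = 2 * \<mu> powr r / r + 2 * \<mu> powr r / q"
  proof -
    have "2 * \<mu> powr r * (1 / r + 1 / q) = 2 * \<mu> powr r" unfolding conj by simp
    then show ?thesis by (simp add: distrib_left)
  qed
  have "m \<le> B powr (r - 1)" unfolding m_def using \<mu>0 \<mu>B r by (intro powr_mono2) auto
  then have "m * \<gamma> \<le> \<gamma> * B powr (r - 1)" using \<gamma> by (simp add: mult.commute)
  then have "t * (\<Delta> - \<gamma>) \<le> (dual_norm L powr r + dual_norm K powr r) / r - 2 * \<mu> powr r / r
      + 2 * (\<gamma> * B powr (r - 1)) + t * \<eta> * (B powr r + 1) / q"
    using main split unfolding add_divide_distrib by linarith
  also have "\<dots> = 2 * ((dual_norm L powr r + dual_norm K powr r) / 2 - \<mu> powr r) / r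
      + 2 * \<gamma> * B powr (r - 1) + t * \<eta> * (B powr r + 1) / q"
    by (simp add: diff_divide_distrib add_divide_distrib)
  finally show ?thesis unfolding \<mu>_def M_def \<Delta>_def .
qed

lemma dual_uniformly_convex:
  assumes \<epsilon>: "0 < \<epsilon>"
  shows "\<exists>\<delta>>0. \<forall>L\<in>Z'. \<forall>K\<in>Z'. dual_norm L \<le> B \<longrightarrow> dual_norm K \<le> B \<longrightarrow>
      (dual_norm L powr r + dual_norm K powr r) / 2 - dual_norm (\<lambda>v. (1/2) * L v + (1/2) * K v) powr r < \<delta> \<longrightarrow>
      dual_norm (\<lambda>v. L v - K v) < \<epsilon>"
proof -
  \<comment> \<open>The constants split \<open>t \<epsilon>\<close>: half of it for the smoothness error \<open>\<eta>\<close>, a quarter each for \<open>\<gamma>\<close> and \<open>\<delta>\<close>.\<close>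
  define c where "c = \<bar>B\<bar> powr r + 1"
  have c: "0 < c" unfolding c_def by (simp add: add_nonneg_pos)
  have q1: "1 < q" by (rule p)
  define \<eta> where "\<eta> = \<epsilon> * q / (2 * c)"
  have \<eta>: "0 < \<eta>" using \<epsilon> q1 c by (simp add: \<eta>_def)
  obtain t where t: "0 < t" "t < 1" and smooth: "\<And>T U. T \<in> W \<Longrightarrow> U \<in> W \<Longrightarrow>
      energy (\<lambda>\<phi>. T \<phi> + t * U \<phi>) + energy (\<lambda>\<phi>. T \<phi> - t * U \<phi>)
        \<le> 2 * energy T + t * \<eta> * (energy T + energy U)"
    by (rule energy_uniformly_smooth[OF \<eta>]) blast
  define d where "d = t + 2 * \<bar>B\<bar> powr (r - 1)"
  have d: "0 < d" unfolding d_def using t by (simp add: add_pos_nonneg)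
  define \<gamma> where "\<gamma> = t * \<epsilon> / (4 * d)"
  have \<gamma>: "0 < \<gamma>" using t \<epsilon> d by (simp add: \<gamma>_def)
  define \<delta> where "\<delta> = r * (t * \<epsilon>) / 8"
  show ?thesis
  proof (intro exI[of _ \<delta>] conjI ballI impI)
    show "0 < \<delta>" using r t \<epsilon> by (simp add: \<delta>_def)
    fix L K assume L: "L \<in> Z'" and K: "K \<in> Z'" and B: "dual_norm L \<le> B" "dual_norm K \<le> B"
      and gap: "(dual_norm L powr r + dual_norm K powr r) / 2 - dual_norm (\<lambda>v. (1/2) * L v + (1/2) * K v) powr r < \<delta>"
        (is "?G < \<delta>")
    have "t * (dual_norm (\<lambda>v. L v - K v) - \<gamma>)
      \<le> 2 * ?G / r + 2 * \<gamma> * \<bar>B\<bar> powr (r - 1) + t * \<eta> * (\<bar>B\<bar> powr r + 1) / q"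
      by (rule dual_norm_gap[OF L K _ _ t(1) less_imp_le[OF \<eta>] \<gamma> smooth]) (use B in auto)
    then have "t * dual_norm (\<lambda>v. L v - K v) \<le> 2 * ?G / r + \<gamma> * d + t * \<eta> * c / q"
      by (simp add: d_def c_def algebra_simps)
    moreover have "2 * ?G / r < 2 * \<delta> / r"       using divide_strict_right_mono[OF mult_strict_left_mono[OF gap, of 2], of r] r by simp
    moreover have "2 * \<delta> / r = t * \<epsilon> / 4" using r by (simp add: \<delta>_def)
    moreover have "\<gamma> * d = t * \<epsilon> / 4" using d by (simp add: \<gamma>_def)
    moreover have "t * \<eta> * c / q = t * \<epsilon> / 2" using c q1 by (simp add: \<eta>_def)
    ultimately have "t * dual_norm (\<lambda>v. L v - K v) < t * \<epsilon>" by argo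
    then show "dual_norm (\<lambda>v. L v - K v) < \<epsilon>" using t by simp
  qed
qed

text \<open>
  The limit is taken pointwise on \<open>Z\<close>, where the functionals form Cauchy sequences
  of reals.
\<close>

lemma dual_complete:
  assumes L: "\<And>n::nat. L n \<in> Z'"
    and Cauchy: "\<And>e. 0 < e \<Longrightarrow> \<exists>n0. \<forall>m\<ge>n0. \<forall>n\<ge>n0. dual_norm (\<lambda>v. L m v - L n v) < e"
  obtains K where "K \<in> Z'" "(\<lambda>n. dual_norm (\<lambda>v. L n v - K v)) \<longlonglongrightarrow> 0"
proof -
  have diff: "\<bar>L m v - L n v\<bar> \<le> dual_norm (\<lambda>v. L m v - L n v) * N v" if "v \<in> Z" for m n v
    by (rule dual_norm_bound[OF dual_minus[OF L L] that])
  have conv: "convergent (\<lambda>n. L n v)" if v: "v \<in> Z" for v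
  proof (rule Cauchy_convergent, rule CauchyI)
    fix e :: real assume e: "0 < e"
    have N1: "0 < N v + 1" using N_nonneg[of v] by simp
    then have "0 < e / (N v + 1)" using e by simp
    from Cauchy[OF this] obtain n0 where n0: "\<And>m n. n0 \<le> m \<Longrightarrow> n0 \<le> n \<Longrightarrow> dual_norm (\<lambda>v. L m v - L n v) < e / (N v + 1)"
      by blast
    have "norm (L m v - L n v) < e" if "n0 \<le> m" "n0 \<le> n" for m n
    proof -
      have "norm (L m v - L n v) \<le> dual_norm (\<lambda>v. L m v - L n v) * N v" using diff[OF v] by simp
      also have "\<dots> \<le> e / (N v + 1) * N v" using n0[OF that] N_nonneg[of v] by (intro mult_right_mono) auto
      also have "\<dots> < e" using e N1 by (simp add: field_simps)
      finally show ?thesis .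
    qed
    then show "\<exists>M. \<forall>m\<ge>M. \<forall>n\<ge>M. norm (L m v - L n v) < e" by blast
  qed
  define K where "K = (\<lambda>v. lim (\<lambda>n. L n v))"
  have lim: "(\<lambda>n. L n v) \<longlonglongrightarrow> K v" if "v \<in> Z" for v
    unfolding K_def using conv[OF that] by (simp add: convergent_LIMSEQ_iff)
  have close: "\<bar>L m v - K v\<bar> \<le> e * N v"
    if v: "v \<in> Z" and n0: "\<And>n. n0 \<le> n \<Longrightarrow> dual_norm (\<lambda>v. L m v - L n v) < e" for m v e n0
  proof (rule LIMSEQ_le_const2)
    show "(\<lambda>n. \<bar>L m v - L n v\<bar>) \<longlonglongrightarrow> \<bar>L m v - K v\<bar>" by (intro tendsto_intros lim v)
    have "\<bar>L m v - L n v\<bar> \<le> e * N v" if "n0 \<le> n" for n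
      using diff[OF v, of m n] mult_right_mono[OF less_imp_le[OF n0[OF that]] N_nonneg[of v]] by linarith
    then show "\<exists>M. \<forall>n\<ge>M. \<bar>L m v - L n v\<bar> \<le> e * N v" by blast
  qed
  obtain n1 where n1: "\<And>n. n1 \<le> n \<Longrightarrow> dual_norm (\<lambda>v. L n1 v - L n v) < 1" using Cauchy[of 1] by auto
  have K: "K \<in> Z'"
  proof (rule dualI)
    fix v w :: "'n distr" and a b :: real assume v: "v \<in> Z" and w: "w \<in> Z"
    have "(\<lambda>n. L n (\<lambda>\<psi>. a * v \<psi> + b * w \<psi>)) \<longlonglongrightarrow> a * K v + b * K w"
      unfolding dual_linear[OF L v w] by (intro tendsto_intros lim v w)
    then show "K (\<lambda>\<psi>. a * v \<psi> + b * w \<psi>) = a * K v + b * K w"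
      using lim[OF Z_lin[OF v w, of a b]] LIMSEQ_unique by blast
  next
    fix v assume v: "v \<in> Z"
    have "\<bar>L n1 v - K v\<bar> \<le> 1 * N v" by (rule close[OF v n1])
    then show "\<bar>K v\<bar> \<le> (dual_norm (L n1) + 1) * N v"
      using dual_norm_bound[OF L v, of n1] by (simp add: algebra_simps)
  qed
  show ?thesis
  proof (rule that[OF K], rule LIMSEQ_I)
    fix e :: real assume e: "0 < e"
    then obtain n0 where n0: "\<And>m n. n0 \<le> m \<Longrightarrow> n0 \<le> n \<Longrightarrow> dual_norm (\<lambda>v. L m v - L n v) < e/2"
      using Cauchy[of "e/2"] by auto
    have "norm (dual_norm (\<lambda>v. L m v - K v) - 0) < e" if m: "n0 \<le> m" for m
    proof -
      have "dual_norm (\<lambda>v. L m v - K v) \<le> e/2"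
      proof (rule dual_norm_least)
        fix v assume v: "v \<in> Z" "N v \<le> 1"
        have "\<bar>L m v - K v\<bar> \<le> e/2 * N v" by (rule close[OF v(1) n0[OF m]])
        also have "\<dots> \<le> e/2 * 1" using v e by (intro mult_left_mono) auto
        finally show "\<bar>L m v - K v\<bar> \<le> e/2" by simp
      qed
      then show ?thesis using e dual_norm_nonneg[OF dual_minus[OF L K]] by simp
    qed
    then show "\<exists>n0. \<forall>m\<ge>n0. norm (dual_norm (\<lambda>v. L m v - K v) - 0) < e" by blast
  qed
qed

lemma induced_bound:
  assumes "L \<in> Z'" "\<phi> \<in> test_fun D"
  shows "\<bar>induced L \<phi>\<bar> \<le> dual_norm L * N (distr_of_fun D \<phi>)"
  using dual_norm_bound[OF assms(1) test_fun_Z[OF assms(2)]] assms(2) by (simp add: distr_of_functional_def)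

lemma W'_distributions:
  assumes "T \<in> W'"
  shows "T \<in> distributions D"
proof -
  obtain L where L: "L \<in> Z'" "T = induced L" using assms unfolding W'_eq by blast
  show ?thesis
  proof (rule distributionsI)
    show "T \<phi> = 0" if "\<phi> \<notin> test_fun D" for \<phi> using that L by (simp add: distr_of_functional_def)
    fix \<phi> \<psi> and a b :: real assume t: "\<phi> \<in> test_fun D" "\<psi> \<in> test_fun D"
    show "T (\<lambda>x. a * \<phi> x + b * \<psi> x) = a * T \<phi> + b * T \<psi>"
      using t test_fun_lin[OF t] dual_linear[OF L(1) test_fun_Z[OF t(1)] test_fun_Z[OF t(2)], of a b]
        distr_of_fun_lin[OF test_fun_Lp_fun[OF t(1)] test_fun_Lp_fun[OF t(2)], of a b] L(2)
      by (simp add: distr_of_functional_def)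
  next
    fix K
    obtain C where C: "0 \<le> C" "\<And>\<phi>. \<phi> \<in> test_fun D \<Longrightarrow> N (distr_of_fun D \<phi>) \<le> C * mdiff_seminorm s \<phi>"
      by (rule N_test_fun_bound) blast
    have "\<bar>T \<phi>\<bar> \<le> (dual_norm L * C) * mdiff_seminorm s \<phi>" if "\<phi> \<in> test_fun D" for \<phi>
      using induced_bound[OF L(1) that] mult_left_mono[OF C(2)[OF that] dual_norm_nonneg[OF L(1)]] L(2) by simp
    then show "\<exists>C j. \<forall>\<phi>\<in>test_fun D. supp \<phi> \<subseteq> K \<longrightarrow> \<bar>T \<phi>\<bar> \<le> C * mdiff_seminorm j \<phi>" by blast
  qed
qed

text \<open>
  The dual norm is transported along \<open>induced\<close>, which is injective on functionals
  restricted to \<open>Z\<close>.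
\<close>

theorem uniformly_convex_sobolev_neg: "uniformly_convex_space W' N' r"
proof -
  note P = N'_induced
  have P0: "N' (induced L) = 0 \<Longrightarrow> L \<in> Z' \<Longrightarrow> induced L = (\<lambda>_. 0)" for L
  proof
    fix \<phi> assume "N' (induced L) = 0" "L \<in> Z'"
    then show "induced L \<phi> = 0"
      using induced_bound[of L \<phi>] P by (cases "\<phi> \<in> test_fun D") (auto simp: distr_of_functional_def)
  qed
  show ?thesis
  proof (rule uniformly_convex_space.intro)
    show "1 < r" by (rule r)
    show "0 \<le> N' T" if "T \<in> W'" for T
      using that P dual_norm_nonneg unfolding W'_eq by auto
  next
    fix T U and a b :: real assume "T \<in> W'" "U \<in> W'"
    then obtain L K where "L \<in> Z'" "T = induced L" "K \<in> Z'" "U = induced K" unfolding W'_eq by blast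
    then show "(\<lambda>\<phi>. a * T \<phi> + b * U \<phi>) \<in> W'" unfolding W'_eq by (auto simp flip: induced_lin intro: dual_lin)
  next
    fix T and c :: real assume "T \<in> W'"
    then obtain L where L: "L \<in> Z'" "T = induced L" unfolding W'_eq by blast
    have "(\<lambda>\<phi>. c * T \<phi>) = induced (\<lambda>v. c * L v)" using induced_lin[of c L 0 L] L by simp
    moreover have "(\<lambda>v. c * L v) \<in> Z'" using dual_lin[OF L(1) L(1), of c 0] by simp
    ultimately show "N' (\<lambda>\<phi>. c * T \<phi>) = \<bar>c\<bar> * N' T" using L P dual_norm_scale by simp
  next
    fix T assume "T \<in> W'" "N' T = 0"
    then show "T = (\<lambda>_. 0)" using P0 unfolding W'_eq by blast
  next
    fix T U assume "T \<in> W'" "U \<in> W'"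
    then obtain L K where LK: "L \<in> Z'" "T = induced L" "K \<in> Z'" "U = induced K" unfolding W'_eq by blast
    have "(\<lambda>\<phi>. T \<phi> + U \<phi>) = induced (\<lambda>v. L v + K v)" using induced_lin[of 1 L 1 K] LK by simp
    moreover have "(\<lambda>v. L v + K v) \<in> Z'" using dual_lin[OF LK(1,3), of 1 1] by simp
    ultimately show "N' (\<lambda>\<phi>. T \<phi> + U \<phi>) \<le> N' T + N' U" using LK P dual_norm_triangle by simp
  next
    fix \<epsilon> B :: real assume "0 < \<epsilon>"
    from dual_uniformly_convex[OF this, of B] obtain \<delta> where \<delta>: "0 < \<delta>"
      "\<And>L K. L \<in> Z' \<Longrightarrow> K \<in> Z' \<Longrightarrow> dual_norm L \<le> B \<Longrightarrow> dual_norm K \<le> B \<Longrightarrow>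
      (dual_norm L powr r + dual_norm K powr r) / 2 - dual_norm (\<lambda>v. (1/2) * L v + (1/2) * K v) powr r < \<delta> \<Longrightarrow>
      dual_norm (\<lambda>v. L v - K v) < \<epsilon>" by blast
    show "\<exists>\<delta>>0. \<forall>T\<in>W'. \<forall>U\<in>W'. N' T \<le> B \<longrightarrow> N' U \<le> B \<longrightarrow>
        (N' T powr r + N' U powr r) / 2 - N' (\<lambda>\<phi>. (1/2) * T \<phi> + (1/2) * U \<phi>) powr r < \<delta> \<longrightarrow>
        N' (\<lambda>\<phi>. T \<phi> - U \<phi>) < \<epsilon>"
    proof (intro exI[of _ \<delta>] conjI \<delta>(1) ballI impI)
      fix T U assume "T \<in> W'" "U \<in> W'" and B: "N' T \<le> B" "N' U \<le> B"
        and gap: "(N' T powr r + N' U powr r) / 2 - N' (\<lambda>\<phi>. (1/2) * T \<phi> + (1/2) * U \<phi>) powr r < \<delta>"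
      then obtain L K where LK: "L \<in> Z'" "T = induced L" "K \<in> Z'" "U = induced K" unfolding W'_eq by blast
      show "N' (\<lambda>\<phi>. T \<phi> - U \<phi>) < \<epsilon>"
        unfolding LK induced_minus[symmetric] P[OF dual_minus[OF LK(1,3)]]
      proof (rule \<delta>(2)[OF LK(1,3)])
        show "dual_norm L \<le> B" "dual_norm K \<le> B" using B LK P by auto
        show "(dual_norm L powr r + dual_norm K powr r) / 2 - dual_norm (\<lambda>v. (1/2) * L v + (1/2) * K v) powr r < \<delta>"
          using gap unfolding LK(2,4) induced_lin[symmetric] P[OF dual_lin[OF LK(1,3)]] P[OF LK(1)] P[OF LK(3)] .
      qed
    qed
  next
    fix X :: "nat \<Rightarrow> 'n distr"
    assume X: "\<And>n. X n \<in> W'" and Cauchy: "\<And>e. 0 < e \<Longrightarrow> \<exists>n0. \<forall>m\<ge>n0. \<forall>n\<ge>n0. N' (\<lambda>\<phi>. X m \<phi> - X n \<phi>) < e"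
    have "\<forall>n. \<exists>L. L \<in> Z' \<and> X n = induced L" using X unfolding W'_eq by blast
    from choice[OF this] obtain L where L: "\<And>n. L n \<in> Z'" "\<And>n. X n = induced (L n)" by blast
    have "N' (\<lambda>\<phi>. X m \<phi> - induced K \<phi>) = dual_norm (\<lambda>v. L m v - K v)" if "K \<in> Z'" for K m
      unfolding L(2) induced_minus[symmetric] by (rule P[OF dual_minus[OF L(1) that]])
    note PX = this
    obtain K where K: "K \<in> Z'" "(\<lambda>n. dual_norm (\<lambda>v. L n v - K v)) \<longlonglongrightarrow> 0"
    proof (rule dual_complete[of L, OF L(1)])
      show "\<exists>n0. \<forall>m\<ge>n0. \<forall>n\<ge>n0. dual_norm (\<lambda>v. L m v - L n v) < e" if "0 < e" for e
        using Cauchy[OF that] PX[OF L(1)] unfolding L(2) by simp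
    qed blast
    show "\<exists>T\<in>W'. (\<lambda>n. N' (\<lambda>\<phi>. X n \<phi> - T \<phi>)) \<longlonglongrightarrow> 0"
    proof (rule bexI[of _ "induced K"])
      show "(\<lambda>n. N' (\<lambda>\<phi>. X n \<phi> - induced K \<phi>)) \<longlonglongrightarrow> 0" unfolding PX[OF K(1)] by (rule K(2))
      show "induced K \<in> W'" unfolding W'_eq using K(1) by blast
    qed
  next
    fix X :: "nat \<Rightarrow> 'n distr" and T \<phi>
    assume X: "\<And>n. X n \<in> W'" and T: "T \<in> W'" and lim: "(\<lambda>n. N' (\<lambda>\<phi>. X n \<phi> - T \<phi>)) \<longlonglongrightarrow> 0"
    obtain K where K: "K \<in> Z'" "T = induced K" using T unfolding W'_eq by blast
    show "(\<lambda>n. X n \<phi>) \<longlonglongrightarrow> T \<phi>"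
    proof (cases "\<phi> \<in> test_fun D")
      case True
      have b: "norm (X n \<phi> - T \<phi>) \<le> N' (\<lambda>\<phi>. X n \<phi> - T \<phi>) * N (distr_of_fun D \<phi>)" for n
      proof -
        obtain L where L: "L \<in> Z'" "X n = induced L" using X unfolding W'_eq by blast
        show ?thesis using induced_bound[OF dual_minus[OF L(1) K(1)] True]
          unfolding L(2) K(2) induced_minus P[OF dual_minus[OF L(1) K(1)], unfolded induced_minus] by simp
      qed
      have "(\<lambda>n. N' (\<lambda>\<phi>. X n \<phi> - T \<phi>) * N (distr_of_fun D \<phi>)) \<longlonglongrightarrow> 0"
        using tendsto_mult[OF lim tendsto_const] by simp
      from tendsto_sandwich[OF _ _ tendsto_const this, of "\<lambda>n. norm (X n \<phi> - T \<phi>)"]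
      have "(\<lambda>n. norm (X n \<phi> - T \<phi>)) \<longlonglongrightarrow> 0" using b by simp
      then have "(\<lambda>n. X n \<phi> - T \<phi>) \<longlonglongrightarrow> 0" by (rule tendsto_norm_zero_cancel)
      then show ?thesis by (rule LIM_zero_cancel)
    next
      case False
      then have "X n \<phi> = 0" "T \<phi> = 0" for n using distributions_outside W'_distributions X T by blast+
      then show ?thesis by simp
    qed
  qed
qed

end


section \<open>Solutions of the differential equation\<close>

lemma uniformly_convex_sobolev:
  fixes D :: "(real^'n::finite) set"
  assumes "open D" "bounded D" "1 < p"
  shows "uniformly_convex_space (sobolev D s p) (sobolev_norm D s p) p"
    and "sobolev D s p \<subseteq> distributions D"
proof -
  have q: "1 < conj_exp p" using assms(3) by (simp add: conj_exp_def)
  interpret pos: sobolev_setting D p "nat s" by unfold_locales (use assms in auto)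
  interpret neg: dual_sobolev_setting D "conj_exp p" "nat (- s)" p
    by unfold_locales (use assms q in auto)
  show "uniformly_convex_space (sobolev D s p) (sobolev_norm D s p) p"
    using pos.uniformly_convex_sobolev_pos neg.uniformly_convex_sobolev_neg
    by (cases "0 \<le> s") (simp_all add: sobolev_def[abs_def] sobolev_norm_def[abs_def])
  show "sobolev D s p \<subseteq> distributions D"
    using pos.W_distributions neg.W'_distributions by (auto simp: sobolev_def)
qed

lemma diff_op_lin:
  "diff_op m a D (\<lambda>j \<phi>. b * u j \<phi> + c * v j \<phi>) r \<phi> = b * diff_op m a D u r \<phi> + c * diff_op m a D v r \<phi>"
proof (cases "\<phi> \<in> test_fun D")
  case True
  then show ?thesis
    by (simp add: diff_op_def distr_diff_lin distr_mult_def sum.distrib sum_distrib_left)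
qed (simp add: diff_op_def distr_mult_def)

text \<open>
  Applying the operator to a distribution means evaluating the components at finitely many
  functions, so it respects pointwise convergence.
\<close>

lemma diff_op_tendsto:
  assumes "\<And>j \<phi>. (\<lambda>n. X n j \<phi>) \<longlonglongrightarrow> u j \<phi>"
  shows "(\<lambda>n. diff_op m a D (X n) r \<phi>) \<longlonglongrightarrow> diff_op m a D u r \<phi>"
  unfolding diff_op_def distr_mult_def distr_diff_def
  by (intro tendsto_sum) (auto intro!: tendsto_intros assms)

theorem proposition2p1:
  fixes X D :: "(real^'n::finite) set"
    and m :: nat
    and a :: "('n, 'k::finite) coeffs"
    and s :: int
    and p b\<^sub>N :: real
    and M :: "('k \<Rightarrow> 'n distr) \<Rightarrow> real^'N::finite"
    and F :: "real^'N \<Rightarrow> ereal"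
  defines "\<F> \<equiv> \<lambda>u. F (M u) + ereal (b\<^sub>N * sobolev_vec_norm D s p u)"
  assumes "CARD('n) \<ge> 2"
    and "open X" and "connected X"
    and "smooth_coeffs X m a"
    and "elliptic X m a"
    and "unique_continuation X (diff_op m a)"
    and "unique_continuation X (adjoint_op m a)"
    and "is_domain D" and "compact (closure D)" and "closure D \<subseteq> X"
    and "smooth_boundary D"
    and "\<forall>C\<in>components (X - D). \<not> compact C"
    and "1 < p"
    and "continuous_linear_on_solutions m a D s p M"
    and "M ` sobolev_solutions m a D s p = UNIV"
    and "\<forall>x. F x \<noteq> -\<infinity>"
    and "proper_fun F" and "convex_fun F" and "coercive_fun F" and "lower_semicont F"
    and "b\<^sub>N > 0"
  shows "(\<exists>u. minimizer_on (sobolev_solutions m a D s p) \<F> u) \<and>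
         (strictly_convex_fun F \<longrightarrow>
           (\<exists>!u. minimizer_on (sobolev_solutions m a D s p) \<F> u))"
proof -
  let ?S = "sobolev_solutions m a D s p"
  have D: "open D" "bounded D"
    using assms(9,10) by (auto simp: is_domain_def intro: bounded_subset[OF compact_imp_bounded closure_subset])
  note sob = uniformly_convex_sobolev[OF D \<open>1 < p\<close>, of s]
  interpret uniformly_convex_space "sobolev D s p" "sobolev_norm D s p" p by (rule sob(1))
  have vec_norm: "sobolev_vec_norm D s p u = vec_norm u" for u :: "'k \<Rightarrow> 'n distr"
    unfolding sobolev_vec_norm_def vec_norm_def vec_pow_def ..
  have S_lin: "(\<lambda>r \<phi>. b * u r \<phi> + c * v r \<phi>) \<in> ?S" if "u \<in> ?S" "v \<in> ?S" for u v b c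
    using that unfolding sobolev_solutions_def solutions_def
    by (auto intro!: distributions_lin lin simp: diff_op_lin fun_eq_iff)
  have M_lin: "M (\<lambda>r \<phi>. b * u r \<phi> + c * v r \<phi>) = b *\<^sub>R M u + c *\<^sub>R M v" if u: "u \<in> ?S" and v: "v \<in> ?S" for u v b c
  proof -
    note M = assms(15)[unfolded continuous_linear_on_solutions_def Let_def]
    have S: "(\<lambda>r \<phi>. b * u r \<phi>) \<in> ?S" "(\<lambda>r \<phi>. c * v r \<phi>) \<in> ?S"
      using S_lin[OF u u, of b 0] S_lin[OF v v, of c 0] by auto
    have "M (\<lambda>r \<phi>. b * u r \<phi> + c * v r \<phi>) = M (\<lambda>r \<phi>. b * u r \<phi>) + M (\<lambda>r \<phi>. c * v r \<phi>)"
      using M S by simp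
    then show ?thesis using M u v by simp
  qed
  interpret observed_subspace "sobolev D s p" "sobolev_norm D s p" p ?S M
  proof unfold_locales
    show "u r \<in> sobolev D s p" if "u \<in> ?S" for u r using that by (simp add: sobolev_solutions_def)
    show "u \<in> ?S" if X: "\<And>n::nat. X n \<in> ?S" and u: "\<And>r. u r \<in> sobolev D s p"
      and lim: "\<And>r \<phi>. (\<lambda>n. X n r \<phi>) \<longlonglongrightarrow> u r \<phi>" for X u
    proof -
      have "diff_op m a D u r \<phi> = 0" for r \<phi>
      proof -
        have "diff_op m a D (X n) r \<phi> = 0" for n
          using X[of n] by (simp add: sobolev_solutions_def solutions_def)
        then show ?thesis using diff_op_tendsto[of X u, OF lim, of m a D r \<phi>] by (simp add: LIMSEQ_const_iff)
      qed
      then show ?thesis using u sob(2) by (auto simp: sobolev_solutions_def solutions_def fun_eq_iff)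
    qed
    show "\<exists>\<delta>>0. \<forall>v\<in>?S. vec_norm (\<lambda>r \<phi>. v r \<phi> - u r \<phi>) < \<delta> \<longrightarrow> norm (M v - M u) < \<epsilon>"
      if "u \<in> ?S" "0 < \<epsilon>" for u \<epsilon>
      using assms(15) that unfolding continuous_linear_on_solutions_def Let_def vec_norm by blast
    show "M ` ?S = UNIV" by (rule assms(16))
  qed (fact S_lin M_lin)+
  show ?thesis
    unfolding \<F>_def vec_norm using assms(17,18,20,21,22) by (intro exists_minimizer) auto
qed

end
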